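(* Let $k\in\mathbb{N}_0$, $s\in(-1,\infty)$ and $1\le q\le\infty$ be given. If $u\in\mathcal{D}'$ and $\partial^\beta u\in M^{s,q}$ (respectively $\partial^\beta u\in M_0^{s,q}$) for all multi-indices $\beta$ with $|\beta|_1=k$, then $u\in M^{s+k,q}$ (respectively $u\in M_0^{s+k,q}$). If, in addition to $\partial^\beta u\in M^{s,q}$ for all $|\beta|_1=k$, one has $k\ge 1$, $s=0$, $q=\infty$ and $\lim_{|x|\to\infty}|\nabla^k u(x)|=0$, then $u\in M_0^{k,\infty}$. (Since $M_0^{0,\infty}=\{0\}$, this last implication is false if $k=0$.)
   Context: All function spaces are spaces of complex-valued functions or distributions on $\mathbb{R}^N$; derivatives are in the sense of distributions; $\mathcal{D}'$ is the space of distributions on $\mathbb{R}^N$; $\mathbb{N}_0=\mathbb{N}\cup\{0\}$; $|\beta|_1:=\beta_1+\cdots+\beta_N$; $\nabla^k u$ is the tensor of all partial derivatives of order $k$ of $u$. Pointwise limits at infinity of measurable functions are understood after modification on a null set. $B_R$ is the open Euclidean ball with center $0$ and radius $R$. For $s\in\mathbb{R}$ and $1\le q\le\infty$ (with $N/q:=0$ if $q=\infty$), $M^{s,q}:=\{u\in L^q_{loc}:\sup_{R\ge 1}R^{-s-N/q}\|u\|_{L^q(B_R)}<\infty\}$ and $M_0^{s,q}:=\{u\in L^q_{loc}:\lim_{R\to\infty}R^{-s-N/q}\|u\|_{L^q(B_R)}=0\}$. *)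

theory Defs
  imports "HOL-Analysis.Analysis" "HOL-Probability.Essential_Supremum"
begin

text \<open>Functions on \<open>\<real>\<^sup>N\<close> are functions on \<^typ>\<open>real ^ 'n\<close> with \<open>N = CARD('n)\<close>, and a
  multi-index is a function \<^typ>\<open>'n \<Rightarrow> nat\<close>.\<close>

definition partial_deriv :: "'n::finite \<Rightarrow> (real ^ 'n \<Rightarrow> complex) \<Rightarrow> real ^ 'n \<Rightarrow> complex"
  where "partial_deriv i f x = vector_derivative (\<lambda>t. f (x + t *\<^sub>R axis i 1)) (at 0)"

definition smooth :: "(real ^ 'n::finite \<Rightarrow> complex) \<Rightarrow> bool"
  where "smooth f \<longleftrightarrow> (\<forall>is x. foldr partial_deriv is f differentiable (at x))"

definition test_functions :: "(real ^ 'n::finite \<Rightarrow> complex) set"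
  where "test_functions = {\<phi>. smooth \<phi> \<and> compact (closure {x. \<phi> x \<noteq> 0})}"

definition mi_order :: "('n::finite \<Rightarrow> nat) \<Rightarrow> nat"
  where "mi_order \<beta> = (\<Sum>i\<in>UNIV. \<beta> i)"

text \<open>The index type carries no order, so an arbitrary order of differentiation is chosen; it is
  immaterial for smooth functions, the only ones to which this is applied.\<close>

definition mi_deriv ::
    "('n::finite \<Rightarrow> nat) \<Rightarrow> (real ^ 'n \<Rightarrow> complex) \<Rightarrow> real ^ 'n \<Rightarrow> complex"
  where "mi_deriv \<beta> f = foldr partial_deriv (SOME is. \<forall>i. count_list is i = \<beta> i) f"

text \<open>A distribution is a functional of which only the values on test functions are relevant: it
  is linear there and, on the test functions supported in any fixed compact set, bounded by
  finitely many of the seminorms \<open>sup\<^sub>x |\<partial>\<^sup>\<alpha> \<phi>(x)|\<close>.\<close>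

definition distribution :: "((real ^ 'n::finite \<Rightarrow> complex) \<Rightarrow> complex) \<Rightarrow> bool"
  where "distribution u \<longleftrightarrow>
    (\<forall>\<phi>\<in>test_functions. \<forall>\<psi>\<in>test_functions. u (\<lambda>x. \<phi> x + \<psi> x) = u \<phi> + u \<psi>) \<and>
    (\<forall>c. \<forall>\<phi>\<in>test_functions. u (\<lambda>x. c * \<phi> x) = c * u \<phi>) \<and>
    (\<forall>K. compact K \<longrightarrow> (\<exists>C m. \<forall>\<phi>\<in>test_functions. closure {x. \<phi> x \<noteq> 0} \<subseteq> K \<longrightarrow>
      norm (u \<phi>) \<le> C * (\<Sum>\<alpha> | mi_order \<alpha> \<le> m. SUP x. norm (mi_deriv \<alpha> \<phi> x))))"

definition distr_deriv :: "('n::finite \<Rightarrow> nat) \<Rightarrow> ((real ^ 'n \<Rightarrow> complex) \<Rightarrow> complex) \<Rightarrow>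
    (real ^ 'n \<Rightarrow> complex) \<Rightarrow> complex"
  where "distr_deriv \<beta> u \<phi> = (- 1) ^ mi_order \<beta> * u (mi_deriv \<beta> \<phi>)"

text \<open>The real-valued norm \<open>Lq_norm\<close> is meaningful for functions in \<open>Lq\<close> only; an infinite
  norm would be mapped to \<open>0\<close>.\<close>

definition Lq :: "ennreal \<Rightarrow> (real ^ 'n::finite) set \<Rightarrow> (real ^ 'n \<Rightarrow> complex) set"
  where "Lq q A = {f. f \<in> borel_measurable (lebesgue_on A) \<and>
    (if q = \<infinity> then esssup (lebesgue_on A) (\<lambda>x. ennreal (norm (f x))) < \<infinity>
     else (\<integral>\<^sup>+x. ennreal (norm (f x) powr enn2real q) \<partial>lebesgue_on A) < \<infinity>)}"

definition Lq_norm :: "ennreal \<Rightarrow> (real ^ 'n::finite) set \<Rightarrow> (real ^ 'n \<Rightarrow> complex) \<Rightarrow> real"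
  where "Lq_norm q A f =
    (if q = \<infinity> then enn2real (esssup (lebesgue_on A) (\<lambda>x. ennreal (norm (f x))))
     else enn2real (\<integral>\<^sup>+x. ennreal (norm (f x) powr enn2real q) \<partial>lebesgue_on A)
            powr (1 / enn2real q))"

definition Lq_loc :: "ennreal \<Rightarrow> (real ^ 'n::finite \<Rightarrow> complex) set"
  where "Lq_loc q = {f \<in> borel_measurable lebesgue. \<forall>K. compact K \<longrightarrow> f \<in> Lq q K}"

definition growth_quot :: "real \<Rightarrow> ennreal \<Rightarrow> (real ^ 'n::finite \<Rightarrow> complex) \<Rightarrow> real \<Rightarrow> real"
  where "growth_quot s q f R =
    R powr (- s - (if q = \<infinity> then 0 else real CARD('n) / enn2real q)) * Lq_norm q (ball 0 R) f"

definition M_space :: "real \<Rightarrow> ennreal \<Rightarrow> (real ^ 'n::finite \<Rightarrow> complex) set"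
  where "M_space s q = {f \<in> Lq_loc q. bdd_above (growth_quot s q f ` {1..})}"

definition M0_space :: "real \<Rightarrow> ennreal \<Rightarrow> (real ^ 'n::finite \<Rightarrow> complex) set"
  where "M0_space s q = {f \<in> Lq_loc q. (growth_quot s q f \<longlongrightarrow> 0) at_top}"

definition represents ::
    "(real ^ 'n::finite \<Rightarrow> complex) \<Rightarrow> ((real ^ 'n \<Rightarrow> complex) \<Rightarrow> complex) \<Rightarrow> bool"
  where "represents f u \<longleftrightarrow>
    f \<in> Lq_loc 1 \<and> (\<forall>\<phi>\<in>test_functions. u \<phi> = integral\<^sup>L lebesgue (\<lambda>x. f x * \<phi> x))"

definition distr_in ::
    "((real ^ 'n::finite \<Rightarrow> complex) \<Rightarrow> complex) \<Rightarrow> (real ^ 'n \<Rightarrow> complex) set \<Rightarrow> bool"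
  where "distr_in u X \<longleftrightarrow> (\<exists>f\<in>X. represents f u)"

text \<open>The Euclidean norm of the \<open>k\<close>-tensor with components \<open>g\<^sub>\<beta>(x)\<close>, where the component with
  index tuple \<open>(i\<^sub>1, \<dots>, i\<^sub>k)\<close> belongs to the multi-index \<open>\<beta>\<close> counting the occurrences of each
  coordinate in the tuple.\<close>

definition tensor_norm ::
    "nat \<Rightarrow> (('n::finite \<Rightarrow> nat) \<Rightarrow> real ^ 'n \<Rightarrow> complex) \<Rightarrow> real ^ 'n \<Rightarrow> real"
  where "tensor_norm k g x = sqrt (\<Sum>is | length is = k. (norm (g (count_list is) x))\<^sup>2)"

text \<open>\<open>|\<nabla>\<^sup>k u(x)| \<rightarrow> 0\<close> as \<open>|x| \<rightarrow> \<infinity>\<close>. Choosing the representatives \<open>g\<^sub>\<beta>\<close> of \<open>\<partial>\<^sup>\<beta> u\<close> amounts to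
  modifying on a null set.\<close>

definition nabla_vanishes_at_infinity ::
    "nat \<Rightarrow> ((real ^ 'n::finite \<Rightarrow> complex) \<Rightarrow> complex) \<Rightarrow> bool"
  where "nabla_vanishes_at_infinity k u \<longleftrightarrow>
    (\<exists>g. (\<forall>\<beta>. mi_order \<beta> = k \<longrightarrow> represents (g \<beta>) (distr_deriv \<beta> u)) \<and>
         (tensor_norm k g \<longlongrightarrow> 0) at_infinity)"

end

theory Submission
  imports Defs
begin

text \<open>Everything reduces to the case \<open>k = 1\<close>: if \<open>v\<close> is linear on test functions and \<open>\<partial>\<^sub>i v = f\<^sub>i\<close>, then
  \<open>v\<close> is a function \<open>g\<close> whose growth exceeds that of the \<open>f\<^sub>i\<close> by one power. For a fixed mollifier
  \<open>w\<close> and a test function \<open>\<phi>\<close>, transporting \<open>\<phi>\<close> along the segments towards the support of \<open>w\<close>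
  exhibits \<open>\<phi> - (\<integral>\<phi>) w\<close> as the divergence of a field of test functions. Hence \<open>v\<close> is determined by
  \<open>v w\<close> and the \<open>f\<^sub>i\<close> -- the continuity of \<open>v\<close> plays no role -- and
  \<open>g(y) = v w + \<integral> w(x) \<integral>\<^sub>0\<^sup>1 f(x + t(y - x)) \<cdot> (y - x) dt dx\<close>.
  On the ball of radius \<open>R\<close> the inner average scales like \<open>t\<^sup>s R\<^sup>s\<close>, which is integrable in \<open>t\<close> exactly
  because \<open>s > -1\<close>. Functions in the space with subscript \<open>0\<close> are those whose growth is bounded by
  \<open>\<epsilon> R\<^sup>s + A R\<^sup>\<sigma>\<close> for every \<open>\<epsilon>\<close> with some \<open>A\<close>, where \<open>\<sigma> < s\<close> is fixed; this form of bound is preserved.\<close>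

section \<open>Smooth functions and test functions\<close>

text \<open>Integrals of f along the segments from one fixed base point may diverge, as f is only
  locally integrable; averaging the base point over a bounded density cures this and leaves only
  Fubini and affine substitutions. For finite q = p, the integral of the p-th power of a component
  scales like t^(sp), which is not integrable for negative s and large p. Jensen's inequality is
  therefore used with the density proportional to t^(-b): it adds b (p - 1) to the exponent, and b =
  -s brings the total back to s. The substitution behind the scaling costs t^(-N), too much once t R
  is below 1; there the base point is substituted instead, and the boundedness of w takes over. For
  q = \<infinity> the argument is pointwise, but a single segment can lie in a null set, hence the
  specially chosen representatives. The last implication cannot start from the subscript-0 space
  with s = 0 and q = \<infinity>, which is trivial; it uses the decay at infinity along each segment
  directly, and the uniqueness of representatives to combine it with the bound.\<close>

lemma partial_deriv_eq:
  assumes "(f has_derivative D) (at x)"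
  shows "partial_deriv i f x = D (axis i 1)"
proof -
  interpret D: bounded_linear D using assms by (rule has_derivative_bounded_linear)
  have "((\<lambda>t. x + t *\<^sub>R axis i (1::real)) has_derivative (\<lambda>t. t *\<^sub>R axis i 1)) (at 0)"
    by (auto intro!: derivative_eq_intros)
  then have "((\<lambda>t. f (x + t *\<^sub>R axis i 1)) has_derivative (\<lambda>t. D (t *\<^sub>R axis i 1))) (at 0)"
    by (rule has_derivative_compose) (use assms in simp)
  then have "((\<lambda>t. f (x + t *\<^sub>R axis i 1)) has_vector_derivative D (axis i 1)) (at 0)"
    by (simp add: has_vector_derivative_def D.scaleR)
  then show ?thesis
    unfolding partial_deriv_def by (rule vector_derivative_at)
qed

lemma has_derivative_partial_deriv:
  assumes "f differentiable (at x)"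
  shows "(f has_derivative (\<lambda>v. \<Sum>i\<in>UNIV. (v $ i) *\<^sub>R partial_deriv i f x)) (at x)"
proof -
  obtain D where D: "(f has_derivative D) (at x)"
    using assms by (auto simp: differentiable_def)
  interpret D: bounded_linear D using D by (rule has_derivative_bounded_linear)
  have "D v = (\<Sum>i\<in>UNIV. (v $ i) *\<^sub>R partial_deriv i f x)" for v
  proof -
    have "v = (\<Sum>i\<in>UNIV. (v $ i) *\<^sub>R axis i 1)"
      using basis_expansion[of v] by (simp add: scalar_mult_eq_scaleR)
    then have "D v = (\<Sum>i\<in>UNIV. (v $ i) *\<^sub>R D (axis i 1))"
      by (metis (mono_tags, lifting) D.scaleR D.sum sum.cong)
    then show ?thesis by (simp add: partial_deriv_eq[OF D])
  qed
  then have "D = (\<lambda>v. \<Sum>i\<in>UNIV. (v $ i) *\<^sub>R partial_deriv i f x)" by blast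
  with D show ?thesis by simp
qed

lemma partial_deriv_add:
  assumes "\<And>x. f differentiable (at x)" "\<And>x. g differentiable (at x)"
  shows "partial_deriv i (\<lambda>x. f x + g x) = (\<lambda>x. partial_deriv i f x + partial_deriv i g x)"
proof
  fix x
  have "((\<lambda>x. f x + g x) has_derivative (\<lambda>v. (\<Sum>i\<in>UNIV. (v $ i) *\<^sub>R partial_deriv i f x)
      + (\<Sum>i\<in>UNIV. (v $ i) *\<^sub>R partial_deriv i g x))) (at x)"
    by (intro has_derivative_add has_derivative_partial_deriv assms)
  from partial_deriv_eq[OF this, of i]
  show "partial_deriv i (\<lambda>x. f x + g x) x = partial_deriv i f x + partial_deriv i g x"
    by (simp add: axis_def if_distrib[of "\<lambda>c. c *\<^sub>R _"] cong: if_cong)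
qed

lemma partial_deriv_mult:
  assumes "\<And>x. f differentiable (at x)" "\<And>x. g differentiable (at x)"
  shows "partial_deriv i (\<lambda>x. f x * g x) = (\<lambda>x. f x * partial_deriv i g x + partial_deriv i f x * g x)"
proof
  fix x
  have "((\<lambda>x. f x * g x) has_derivative (\<lambda>v. f x * (\<Sum>i\<in>UNIV. (v $ i) *\<^sub>R partial_deriv i g x)
      + (\<Sum>i\<in>UNIV. (v $ i) *\<^sub>R partial_deriv i f x) * g x)) (at x)"
    by (intro has_derivative_mult has_derivative_partial_deriv assms)
  from partial_deriv_eq[OF this, of i]
  show "partial_deriv i (\<lambda>x. f x * g x) x = f x * partial_deriv i g x + partial_deriv i f x * g x"
    by (simp add: axis_def if_distrib[of "\<lambda>c. c *\<^sub>R _"] cong: if_cong)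
qed

lemma partial_deriv_const [simp]: "partial_deriv i (\<lambda>x. c) = (\<lambda>x. 0)"
  by (auto simp: partial_deriv_def)

lemma partial_deriv_coord:
  fixes j :: "'n::finite"
  shows "partial_deriv i (\<lambda>x. of_real (x $ j)) = (\<lambda>x. if i = j then 1 else 0)"
proof
  fix x :: "real^'n"
  have "((\<lambda>x::real^'n. of_real (x $ j) :: complex) has_derivative (\<lambda>v. of_real (v $ j))) (at x)"
    by (intro bounded_linear_imp_has_derivative bounded_linear_compose[OF bounded_linear_of_real]
        bounded_linear_vec_nth)
  from partial_deriv_eq[OF this]
  show "partial_deriv i (\<lambda>x. of_real (x $ j)) x = (if i = j then 1 else 0)"
    by (simp add: axis_def)
qed

section \<open>Finite orders of smoothness, sums and products\<close>

primrec differentiable_times :: "nat \<Rightarrow> (real ^ 'n::finite \<Rightarrow> complex) \<Rightarrow> bool" where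
  "differentiable_times 0 f \<longleftrightarrow> (\<forall>x. f differentiable (at x))"
| "differentiable_times (Suc n) f \<longleftrightarrow>
    (\<forall>x. f differentiable (at x)) \<and> (\<forall>i. differentiable_times n (partial_deriv i f))"

lemma differentiable_times_differentiable:
  "differentiable_times n f \<Longrightarrow> f differentiable (at x)"
  by (cases n) auto

text \<open>The recursion differentiates the innermost function first, so a list of directions is
  split at its last element: \<open>foldr\<close> applies that one before all others.\<close>

lemma differentiable_times_iff:
  "differentiable_times n f \<longleftrightarrow>
    (\<forall>is x. length is \<le> n \<longrightarrow> foldr partial_deriv is f differentiable (at x))"
proof (induction n arbitrary: f)
  case (Suc n)
  show ?case (is "_ \<longleftrightarrow> ?R")
  proof
    assume L: "differentiable_times (Suc n) f"
    show ?R
    proof (intro allI impI)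
      fix "is" :: "'a list" and x assume "length is \<le> Suc n"
      then show "foldr partial_deriv is f differentiable (at x)"
        using L Suc.IH by (cases "is" rule: rev_cases) auto
    qed
  next
    assume R: ?R
    then have "foldr partial_deriv is (partial_deriv i f) differentiable (at x)"
      if "length is \<le> n" for "is" i x
      using that R[rule_format, of "is @ [i]"] by simp
    moreover have "f differentiable (at x)" for x
      using R[rule_format, of "[]"] by simp
    ultimately show "differentiable_times (Suc n) f"
      using Suc.IH by auto
  qed
qed auto

lemma smooth_iff_differentiable_times: "smooth f \<longleftrightarrow> (\<forall>n. differentiable_times n f)"
  unfolding smooth_def differentiable_times_iff by blast

lemma smooth_differentiable: "smooth f \<Longrightarrow> f differentiable (at x)"
  using differentiable_times_differentiable smooth_iff_differentiable_times by blast

lemma smooth_partial_deriv: "smooth f \<Longrightarrow> smooth (partial_deriv i f)"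
  unfolding smooth_iff_differentiable_times by (metis differentiable_times.simps(2))

lemma smooth_foldr_partial_deriv: "smooth f \<Longrightarrow> smooth (foldr partial_deriv is f)"
  by (induction "is") (auto simp: smooth_partial_deriv)

text \<open>Smoothness as a greatest fixed point. It suits families such as the constants and the
  parameter integrals below, where a derivative is again a member with other data.\<close>

lemma smooth_coinduct:
  assumes "P f" "\<And>f x. P f \<Longrightarrow> f differentiable (at x)" "\<And>f i. P f \<Longrightarrow> P (partial_deriv i f)"
  shows "smooth f"
proof -
  have "differentiable_times n f" for n
    using assms(1) by (induction n arbitrary: f) (auto intro: assms(2,3))
  then show ?thesis by (simp add: smooth_iff_differentiable_times)
qed

lemma differentiable_times_Suc_D: "differentiable_times (Suc n) f \<Longrightarrow> differentiable_times n f"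
  by (induction n arbitrary: f) auto

lemma differentiable_times_add:
  "differentiable_times n f \<Longrightarrow> differentiable_times n g \<Longrightarrow> differentiable_times n (\<lambda>x. f x + g x)"
  by (induction n arbitrary: f g) (auto simp: partial_deriv_add)

lemma differentiable_times_mult:
  "differentiable_times n f \<Longrightarrow> differentiable_times n g \<Longrightarrow> differentiable_times n (\<lambda>x. f x * g x)"
proof (induction n arbitrary: f g)
  case (Suc n)
  \<comment> \<open>The product rule leaves one factor undifferentiated, known to order
    \<open>Suc n\<close>; the induction hypothesis wants it to order n.\<close>
  then have "differentiable_times n f" "differentiable_times n g"
    using differentiable_times_Suc_D by blast+
  with Suc show ?case
    by (auto simp: partial_deriv_mult intro!: differentiable_times_add)
qed auto

lemma smooth_add: "smooth f \<Longrightarrow> smooth g \<Longrightarrow> smooth (\<lambda>x. f x + g x)"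
  and smooth_mult: "smooth f \<Longrightarrow> smooth g \<Longrightarrow> smooth (\<lambda>x. f x * g x)"
  by (auto simp: smooth_iff_differentiable_times differentiable_times_add differentiable_times_mult)

lemma smooth_const: "smooth (\<lambda>x. c)"
  by (rule smooth_coinduct[where P = "\<lambda>f. \<exists>c. f = (\<lambda>x. c)"]) auto

lemma smooth_coord:
  fixes j :: "'n::finite"
  shows "smooth (\<lambda>x. of_real (x $ j))"
proof -
  have "differentiable_times n (\<lambda>x. of_real (x $ j))" for n
  proof -
    have "(\<lambda>x::real^'n. of_real (x $ j) :: complex) differentiable (at x)" for x
      by (intro bounded_linear_imp_differentiable bounded_linear_compose[OF bounded_linear_of_real]
        bounded_linear_vec_nth)
    moreover have "differentiable_times m (\<lambda>x. c)" for m c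
      using smooth_const smooth_iff_differentiable_times by blast
    ultimately show ?thesis by (cases n) (auto simp: partial_deriv_coord)
  qed
  then show ?thesis by (simp add: smooth_iff_differentiable_times)
qed

lemma smooth_continuous_on: "smooth f \<Longrightarrow> continuous_on A f"
  by (meson continuous_at_imp_continuous_on differentiable_imp_continuous_within smooth_differentiable)

section \<open>Symmetry of mixed derivatives\<close>

lemma has_vector_derivative_partial_deriv:
  assumes "f differentiable (at (x + s *\<^sub>R axis i 1))"
  shows "((\<lambda>s. f (x + s *\<^sub>R axis i 1)) has_vector_derivative
    partial_deriv i f (x + s *\<^sub>R axis i 1)) (at s)"
proof -
  obtain D where D: "(f has_derivative D) (at (x + s *\<^sub>R axis i 1))"
    using assms by (auto simp: differentiable_def)
  interpret D: bounded_linear D using D by (rule has_derivative_bounded_linear)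
  have "((\<lambda>t. x + t *\<^sub>R axis i (1::real)) has_derivative (\<lambda>t. t *\<^sub>R axis i 1)) (at s)"
    by (auto intro!: derivative_eq_intros)
  then have "((\<lambda>t. f (x + t *\<^sub>R axis i 1)) has_derivative (\<lambda>t. D (t *\<^sub>R axis i 1))) (at s)"
    by (rule has_derivative_compose) (use D in simp)
  then show ?thesis
    by (simp add: has_vector_derivative_def D.scaleR partial_deriv_eq[OF D])
qed

text \<open>The mean value theorem is applied twice: to the increment in direction j as a function
  of the position along i, then along j. It holds for real functions only, so a real linear
  functional \<open>L\<close> is applied first, later the real and the imaginary part.\<close>

lemma second_difference_mvt:
  fixes L :: "complex \<Rightarrow> real"
  assumes f: "smooth f" and L: "bounded_linear L" and h: "h > 0"
  obtains a b where "0 < a" "a < h" "0 < b" "b < h"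
    "L (f (x + h *\<^sub>R axis i 1 + h *\<^sub>R axis j 1)) - L (f (x + h *\<^sub>R axis i 1))
       - L (f (x + h *\<^sub>R axis j 1)) + L (f x)
     = h * h * L (partial_deriv j (partial_deriv i f) (x + a *\<^sub>R axis i 1 + b *\<^sub>R axis j 1))"
proof -
  interpret L: bounded_linear L by fact
  have D: "DERIV (\<lambda>s. L (g (y + s *\<^sub>R axis l 1))) s :> L (partial_deriv l g (y + s *\<^sub>R axis l 1))"
    if "smooth g" for g y l s
    using L.has_vector_derivative[OF has_vector_derivative_partial_deriv[OF smooth_differentiable[OF that]]]
    by (simp add: has_real_derivative_iff_has_vector_derivative)
  let ?u = "\<lambda>s. L (f ((x + h *\<^sub>R axis j 1) + s *\<^sub>R axis i 1)) - L (f (x + s *\<^sub>R axis i 1))"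
  have "\<exists>a>0. a < h \<and> ?u h - ?u 0 = (h - 0) * (L (partial_deriv i f ((x + h *\<^sub>R axis j 1) + a *\<^sub>R axis i 1))
      - L (partial_deriv i f (x + a *\<^sub>R axis i 1)))"
    by (rule MVT2[OF h]) (intro DERIV_diff D f)
  then obtain a where a: "0 < a" "a < h" "?u h - ?u 0 = (h - 0) * (L (partial_deriv i f ((x + h *\<^sub>R axis j 1) + a *\<^sub>R axis i 1))
      - L (partial_deriv i f (x + a *\<^sub>R axis i 1)))" by blast
  let ?w = "\<lambda>s. L (partial_deriv i f ((x + a *\<^sub>R axis i 1) + s *\<^sub>R axis j 1))"
  have "\<exists>b>0. b < h \<and> ?w h - ?w 0 = (h - 0) * L (partial_deriv j (partial_deriv i f)
      ((x + a *\<^sub>R axis i 1) + b *\<^sub>R axis j 1))"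
    by (rule MVT2[OF h]) (intro D smooth_partial_deriv f)
  then obtain b where b: "0 < b" "b < h" "?w h - ?w 0 = (h - 0) * L (partial_deriv j (partial_deriv i f)
      ((x + a *\<^sub>R axis i 1) + b *\<^sub>R axis j 1))" by blast
  have v: "x + h *\<^sub>R axis k 1 + c *\<^sub>R axis l 1 = x + c *\<^sub>R axis l 1 + h *\<^sub>R axis k 1" for k l and c :: real
    by (simp add: ac_simps)
  have "L (f (x + h *\<^sub>R axis i 1 + h *\<^sub>R axis j 1)) - L (f (x + h *\<^sub>R axis i 1))
       - L (f (x + h *\<^sub>R axis j 1)) + L (f x) = ?u h - ?u 0"
    by (subst v[of i h j]) simp
  also have "\<dots> = h * (?w h - ?w 0)"
    unfolding a(3) by (simp add: v[of j a i])
  also have "\<dots> = h * h * L (partial_deriv j (partial_deriv i f) (x + a *\<^sub>R axis i 1 + b *\<^sub>R axis j 1))"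
    unfolding b(3) by simp
  finally show ?thesis
    by (rule that[OF a(1,2) b(1,2)])
qed

text \<open>Schwarz's theorem. The second difference does not change when i and j are exchanged, and
  it is h^2 times either mixed derivative at a point that tends to x with h; continuity of both
  gives equality.\<close>

lemma partial_deriv_commute:
  assumes f: "smooth f"
  shows "partial_deriv i (partial_deriv j f) = partial_deriv j (partial_deriv i f)"
proof
  fix x
  have *: "L (partial_deriv i (partial_deriv j f) x) = L (partial_deriv j (partial_deriv i f) x)"
    if L: "bounded_linear L" for L :: "complex \<Rightarrow> real"
  proof -
    have ex: "\<exists>y. norm (y - x) \<le> 2 * h \<and>
        L (f (x + h *\<^sub>R axis i 1 + h *\<^sub>R axis j 1)) - L (f (x + h *\<^sub>R axis i 1))
       - L (f (x + h *\<^sub>R axis j 1)) + L (f x) = h * h * L (partial_deriv j (partial_deriv i f) y)"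
      if h: "h > 0" for h i j
    proof -
      obtain a b where ab: "0 < a" "a < h" "0 < b" "b < h"
        "L (f (x + h *\<^sub>R axis i 1 + h *\<^sub>R axis j 1)) - L (f (x + h *\<^sub>R axis i 1))
         - L (f (x + h *\<^sub>R axis j 1)) + L (f x)
        = h * h * L (partial_deriv j (partial_deriv i f) (x + a *\<^sub>R axis i 1 + b *\<^sub>R axis j 1))"
        by (rule second_difference_mvt[OF f L h])
      have "norm (a *\<^sub>R axis i 1 + b *\<^sub>R axis j (1::real)) \<le> \<bar>a\<bar> + \<bar>b\<bar>"
        by (rule order_trans[OF norm_triangle_ineq]) (simp add: norm_axis_1)
      then show ?thesis
        using ab by (intro exI[of _ "x + a *\<^sub>R axis i 1 + b *\<^sub>R axis j 1"]) (auto simp: algebra_simps)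
    qed
    define h where "h n = inverse (real (Suc n))" for n
    have h0: "h n > 0" for n by (simp add: h_def)
    have hl: "h \<longlonglongrightarrow> 0" unfolding h_def by (rule LIMSEQ_inverse_real_of_nat)
    obtain y where y: "\<And>n. norm (y n - x) \<le> 2 * h n"
      "\<And>n. L (f (x + h n *\<^sub>R axis i 1 + h n *\<^sub>R axis j 1)) - L (f (x + h n *\<^sub>R axis i 1))
       - L (f (x + h n *\<^sub>R axis j 1)) + L (f x) = h n * h n * L (partial_deriv j (partial_deriv i f) (y n))"
      using ex[OF h0, of _ i j] by metis
    obtain z where z: "\<And>n. norm (z n - x) \<le> 2 * h n"
      "\<And>n. L (f (x + h n *\<^sub>R axis j 1 + h n *\<^sub>R axis i 1)) - L (f (x + h n *\<^sub>R axis j 1))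
       - L (f (x + h n *\<^sub>R axis i 1)) + L (f x) = h n * h n * L (partial_deriv i (partial_deriv j f) (z n))"
      using ex[OF h0, of _ j i] by metis
    have eq: "L (partial_deriv j (partial_deriv i f) (y n)) = L (partial_deriv i (partial_deriv j f) (z n))" for n
    proof -
      have "h n * h n * L (partial_deriv j (partial_deriv i f) (y n)) = h n * h n * L (partial_deriv i (partial_deriv j f) (z n))"
        using y(2)[of n] z(2)[of n] by (simp add: algebra_simps)
      then show ?thesis using h0[of n] by simp
    qed
    have h2: "(\<lambda>n. 2 * h n) \<longlonglongrightarrow> 0" using tendsto_mult_right_zero[OF hl] .
    have "y \<longlonglongrightarrow> x" "z \<longlonglongrightarrow> x"
      using y(1) z(1) by (auto intro!: LIM_zero_cancel[of y] LIM_zero_cancel[of z] Lim_null_comparison[OF _ h2])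
    moreover have "isCont (\<lambda>w. L (partial_deriv k (partial_deriv l f) w)) x" for k l
      by (intro bounded_linear.isCont[OF L] differentiable_imp_continuous_within
          smooth_differentiable smooth_partial_deriv f)
    ultimately have "(\<lambda>n. L (partial_deriv j (partial_deriv i f) (y n))) \<longlonglongrightarrow> L (partial_deriv j (partial_deriv i f) x)"
        "(\<lambda>n. L (partial_deriv i (partial_deriv j f) (z n))) \<longlonglongrightarrow> L (partial_deriv i (partial_deriv j f) x)"
      by (auto intro!: isCont_tendsto_compose[where g = "\<lambda>w. L (partial_deriv _ (partial_deriv _ f) w)"])
    then show ?thesis using LIMSEQ_unique eq by auto
  qed
  show "partial_deriv i (partial_deriv j f) x = partial_deriv j (partial_deriv i f) x"
    using *[OF bounded_linear_Re] *[OF bounded_linear_Im] by (rule complex_eqI)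
qed

lemma foldr_partial_deriv_shift:
  assumes "smooth f"
  shows "foldr partial_deriv is (partial_deriv i f) = partial_deriv i (foldr partial_deriv is f)"
  by (induction "is") (auto simp: partial_deriv_commute smooth_foldr_partial_deriv assms)

lemma foldr_partial_deriv_permute:
  assumes "smooth f" "mset is = mset js"
  shows "foldr partial_deriv is f = foldr partial_deriv js f"
  using assms(2)
proof (induction "is" arbitrary: js)
  case (Cons i "is")
  then obtain us vs where js: "js = us @ i # vs"
    by (metis list.set_intros(1) set_mset_mset split_list)
  with Cons.prems have "mset is = mset (us @ vs)" by simp
  from Cons.IH[OF this] show ?case
    by (simp add: js foldr_partial_deriv_shift smooth_foldr_partial_deriv assms)
qed auto

text \<open>This removes the arbitrary choice in \<open>mi_deriv\<close>: lists with equal counts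
  are permutations of each other, and derivatives of smooth functions commute.\<close>

lemma mi_deriv_eq:
  assumes "smooth f" "\<And>i. count_list is i = \<beta> i"
  shows "mi_deriv \<beta> f = foldr partial_deriv is f"
proof -
  have "\<forall>i. count_list (SOME is. \<forall>i. count_list is i = \<beta> i) i = \<beta> i"
    by (rule someI[of _ "is"]) (use assms in auto)
  then have "mset (SOME is. \<forall>i. count_list is i = \<beta> i) = mset is"
    using assms by (auto intro!: multiset_eqI simp: count_mset)
  then show ?thesis
    unfolding mi_deriv_def by (rule foldr_partial_deriv_permute[OF assms(1)])
qed

lemma ex_count_list: "\<exists>is. \<forall>i. count_list is i = (\<beta> i :: nat)" for \<beta> :: "'n::finite \<Rightarrow> nat"
proof -
  obtain "is" where "mset is = Abs_multiset \<beta>" using ex_mset by blast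
  then have "count_list is i = \<beta> i" for i by (metis count_Abs_multiset count_mset finite)
  then show ?thesis by blast
qed

section \<open>Test functions\<close>

lemma test_functions_iff:
  "\<phi> \<in> test_functions \<longleftrightarrow> smooth \<phi> \<and> (\<exists>r>0. \<forall>x. r \<le> norm x \<longrightarrow> \<phi> x = 0)"
proof -
  \<comment> \<open>By Heine-Borel only boundedness of the support matters. Vanishing outside a ball
    is the form that passes to products, derivatives and averages without mention of
    closures.\<close>
  have "compact (closure {x. \<phi> x \<noteq> 0}) \<longleftrightarrow> (\<exists>r>0. \<forall>x. r \<le> norm x \<longrightarrow> \<phi> x = 0)"
  proof
    assume "compact (closure {x. \<phi> x \<noteq> 0})"
    then obtain b where b: "\<And>x. \<phi> x \<noteq> 0 \<Longrightarrow> norm x \<le> b"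
      by (force dest!: compact_imp_bounded simp: bounded_iff closure_def)
    then have "\<forall>x. \<bar>b\<bar> + 1 \<le> norm x \<longrightarrow> \<phi> x = 0"
      by (metis abs_ge_self add_increasing2 less_add_one linorder_not_less order_less_le_trans order_trans)
    then show "\<exists>r>0. \<forall>x. r \<le> norm x \<longrightarrow> \<phi> x = 0"
      by (intro exI[of _ "\<bar>b\<bar> + 1"]) auto
  next
    assume "\<exists>r>0. \<forall>x. r \<le> norm x \<longrightarrow> \<phi> x = 0"
    then obtain r where "\<forall>x. r \<le> norm x \<longrightarrow> \<phi> x = 0" by blast
    then have "bounded {x. \<phi> x \<noteq> 0}"
      unfolding bounded_iff by (intro exI[of _ r]) (metis linorder_not_less mem_Collect_eq order_less_imp_le)
    then show "compact (closure {x. \<phi> x \<noteq> 0})" by (rule compact_closure[THEN iffD2])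
  qed
  then show ?thesis by (simp add: test_functions_def)
qed

lemma test_smooth: "\<phi> \<in> test_functions \<Longrightarrow> smooth \<phi>"
  by (simp add: test_functions_iff)

lemma test_support:
  assumes "\<phi> \<in> test_functions"
  obtains r where "r > 0" "\<And>x. r \<le> norm x \<Longrightarrow> \<phi> x = 0"
  using assms by (auto simp: test_functions_iff)

lemma test_mult: "smooth g \<Longrightarrow> \<phi> \<in> test_functions \<Longrightarrow> (\<lambda>x. g x * \<phi> x) \<in> test_functions"
  unfolding test_functions_iff by (auto intro: smooth_mult)

lemma test_cmult: "\<phi> \<in> test_functions \<Longrightarrow> (\<lambda>x. c * \<phi> x) \<in> test_functions"
  using test_mult[OF smooth_const] .

lemma test_coord_mult: "\<phi> \<in> test_functions \<Longrightarrow> (\<lambda>x. of_real (x $ i) * \<phi> x) \<in> test_functions"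
  using test_mult[OF smooth_coord] .

lemma test_add:
  assumes "\<phi> \<in> test_functions" "\<psi> \<in> test_functions"
  shows "(\<lambda>x. \<phi> x + \<psi> x) \<in> test_functions"
proof -
  obtain r where "r > 0" "\<And>x. r \<le> norm x \<Longrightarrow> \<phi> x = 0" using test_support[OF assms(1)] by blast
  moreover obtain r' where "r' > 0" "\<And>x. r' \<le> norm x \<Longrightarrow> \<psi> x = 0" using test_support[OF assms(2)] by blast
  ultimately have "\<exists>r>0. \<forall>x. r \<le> norm x \<longrightarrow> \<phi> x + \<psi> x = 0"
    by (intro exI[of _ "max r r'"]) auto
  with assms show ?thesis by (auto simp: test_functions_iff intro: smooth_add)
qed

lemma test_zero: "(\<lambda>x. 0) \<in> test_functions"
  by (auto simp: test_functions_iff smooth_const intro: exI[of _ 1])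

lemma test_sum: "(\<And>i. i \<in> I \<Longrightarrow> f i \<in> test_functions) \<Longrightarrow> (\<lambda>x. \<Sum>i\<in>I. f i x) \<in> test_functions"
  by (induction I rule: infinite_finite_induct) (auto intro: test_zero test_add)

lemma partial_deriv_test_support:
  assumes "\<And>x. r \<le> norm x \<Longrightarrow> \<phi> x = 0" "r < norm x"
  shows "partial_deriv i \<phi> x = 0"
proof -
  have "eventually (\<lambda>y. r < norm y) (nhds x)"
    using open_Collect_less[of "\<lambda>_. r" norm] assms(2) by (auto simp: eventually_nhds continuous_intros)
  then have ev: "eventually (\<lambda>y. 0 = \<phi> y) (at x)"
    unfolding eventually_at_filter by (rule eventually_mono) (simp add: assms(1))
  have "((\<lambda>y. 0::complex) has_derivative (\<lambda>y. 0)) (at x)" by simp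
  then have "(\<phi> has_derivative (\<lambda>y. 0)) (at x)"
    using has_derivative_transform_eventually[OF _ ev] assms by simp
  then show ?thesis by (rule partial_deriv_eq)
qed

lemma test_partial_deriv:
  assumes "\<phi> \<in> test_functions"
  shows "partial_deriv i \<phi> \<in> test_functions"
proof -
  obtain r where r: "r > 0" "\<And>x. r \<le> norm x \<Longrightarrow> \<phi> x = 0" using test_support[OF assms] by blast
  \<comment> \<open>Where \<open>norm x = r\<close>, the function need not vanish in a
    neighbourhood, so the preceding lemma covers points strictly beyond r; the radius r + 1 is
    safe.\<close>
  then have "\<forall>x. r + 1 \<le> norm x \<longrightarrow> partial_deriv i \<phi> x = 0"
    using partial_deriv_test_support[of r \<phi>] by force
  then show ?thesis
    using r(1) assms by (auto simp: test_functions_iff smooth_partial_deriv intro!: exI[of _ "r + 1"])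
qed

lemma test_foldr_partial_deriv: "\<phi> \<in> test_functions \<Longrightarrow> foldr partial_deriv is \<phi> \<in> test_functions"
  by (induction "is") (auto intro: test_partial_deriv)

lemma test_bounded:
  assumes "\<phi> \<in> test_functions"
  obtains B where "B \<ge> 0" "\<And>x. norm (\<phi> x) \<le> B"
proof -
  obtain r where r: "r > 0" "\<And>x. r \<le> norm x \<Longrightarrow> \<phi> x = 0" using test_support[OF assms] by blast
  have "compact (\<phi> ` cball 0 r)"
    using assms by (intro compact_continuous_image smooth_continuous_on test_smooth) auto
  then obtain B where B: "\<And>x. x \<in> cball 0 r \<Longrightarrow> norm (\<phi> x) \<le> B"
    by (metis bounded_iff compact_imp_bounded image_eqI)
  have "norm (\<phi> x) \<le> \<bar>B\<bar>" for x
    using B[of x] r(2)[of x] by (cases "r \<le> norm x") (auto intro: order_trans)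
  then show ?thesis by (intro that[of "\<bar>B\<bar>"]) auto
qed

lemma test_borel [measurable]: "\<phi> \<in> test_functions \<Longrightarrow> \<phi> \<in> borel_measurable borel"
  by (intro borel_measurable_continuous_onI smooth_continuous_on test_smooth)

lemma test_integrable:
  assumes "\<phi> \<in> test_functions"
  shows "integrable lborel \<phi>"
proof -
  obtain r where r: "r > 0" "\<And>x. r \<le> norm x \<Longrightarrow> \<phi> x = 0" using test_support[OF assms] by blast
  have "integrable lborel (\<lambda>x. indicator (cball 0 r) x *\<^sub>R \<phi> x)"
    by (intro borel_integrable_compact smooth_continuous_on test_smooth assms) auto
  also have "(\<lambda>x. indicator (cball 0 r) x *\<^sub>R \<phi> x) = \<phi>"
    using r(2) by (force simp: indicator_def)
  finally show ?thesis .
qed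

lemma onorm_linear_form_le:
  fixes c :: "'n::finite \<Rightarrow> complex"
  assumes "\<And>i. norm (c i) \<le> B"
  shows "onorm (\<lambda>v::real^'n. \<Sum>i\<in>UNIV. (v $ i) *\<^sub>R c i) \<le> real CARD('n) * B"
proof (rule onorm_le)
  fix v :: "real^'n"
  have "norm (\<Sum>i\<in>UNIV. (v $ i) *\<^sub>R c i) \<le> (\<Sum>i\<in>(UNIV::'n set). norm v * B)"
  proof (rule sum_norm_le)
    fix i
    show "norm ((v $ i) *\<^sub>R c i) \<le> norm v * B"
      using assms[of i] component_le_norm_cart[of v i] by (auto intro!: mult_mono)
  qed
  then show "norm (\<Sum>i\<in>UNIV. (v $ i) *\<^sub>R c i) \<le> real CARD('n) * B * norm v"
    by (simp add: ac_simps)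
qed

lemma test_lipschitz:
  assumes "\<phi> \<in> test_functions"
  obtains K where "K \<ge> 0" "\<And>x y. norm (\<phi> x - \<phi> y) \<le> K * norm (x - y)"
proof -
  have "\<exists>B\<ge>0. \<forall>x. norm (partial_deriv i \<phi> x) \<le> B" for i
    by (rule test_bounded[OF test_partial_deriv[OF assms, of i]]) blast
  then obtain B where B: "\<And>i. B i \<ge> 0" "\<And>i x. norm (partial_deriv i \<phi> x) \<le> B i"
    by metis
  let ?B = "\<Sum>i\<in>UNIV. B i"
  have "norm (partial_deriv i \<phi> x) \<le> ?B" for i x
    using B by (intro order_trans[OF B(2)] member_le_sum) auto
  then have "norm (\<phi> x - \<phi> y) \<le> (real CARD('a) * ?B) * norm (x - y)" for x y
    by (intro differentiable_bound[OF convex_UNIV _ onorm_linear_form_le])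
       (auto intro!: has_derivative_partial_deriv smooth_differentiable test_smooth assms)
  moreover have "0 \<le> real CARD('a) * ?B" by (intro mult_nonneg_nonneg sum_nonneg B) auto
  ultimately show ?thesis using that by blast
qed

text \<open>By the Lipschitz bound of the partial derivatives, the derivative of the remainder is of
  order norm v on the ball of radius norm v; the mean value inequality yields the square. K is
  uniform in the base point w, which makes differentiation under the integral sign possible
  later.\<close>

lemma test_taylor:
  assumes "\<phi> \<in> test_functions"
  obtains K where "K \<ge> 0"
    "\<And>w v. norm (\<phi> (w + v) - \<phi> w - (\<Sum>i\<in>UNIV. (v $ i) *\<^sub>R partial_deriv i \<phi> w)) \<le> K * (norm v)\<^sup>2"
proof -
  have "\<exists>K\<ge>0. \<forall>x y. norm (partial_deriv i \<phi> x - partial_deriv i \<phi> y) \<le> K * norm (x - y)" for i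
    by (rule test_lipschitz[OF test_partial_deriv[OF assms, of i]]) blast
  then obtain k where k: "\<And>i. k i \<ge> 0"
      "\<And>i x y. norm (partial_deriv i \<phi> x - partial_deriv i \<phi> y) \<le> k i * norm (x - y)"
    by metis
  let ?K = "\<Sum>i\<in>UNIV. k i"
  have K: "norm (partial_deriv i \<phi> x - partial_deriv i \<phi> y) \<le> ?K * norm (x - y)" for i x y
    using k by (intro order_trans[OF k(2)] mult_right_mono member_le_sum) auto
  have K0: "?K \<ge> 0" by (intro sum_nonneg k)
  have "norm (\<phi> (w + v) - \<phi> w - (\<Sum>i\<in>UNIV. (v $ i) *\<^sub>R partial_deriv i \<phi> w))
      \<le> (real CARD('a) * ?K) * (norm v)\<^sup>2" for w v
  proof -
    let ?r = "\<lambda>u. \<phi> (w + u) - (\<Sum>i\<in>UNIV. (u $ i) *\<^sub>R partial_deriv i \<phi> w)"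
    let ?D = "\<lambda>u v. \<Sum>i\<in>UNIV. (v $ i) *\<^sub>R (partial_deriv i \<phi> (w + u) - partial_deriv i \<phi> w)"
    have "norm (?r v - ?r 0) \<le> (real CARD('a) * (?K * norm v)) * norm (v - 0)"
    proof (rule differentiable_bound[where S = "cball 0 (norm v)" and f' = ?D])
      fix u :: "real^'a" assume u: "u \<in> cball 0 (norm v)"
      have "((\<lambda>u. \<phi> (w + u)) has_derivative (\<lambda>v. \<Sum>i\<in>UNIV. (v $ i) *\<^sub>R partial_deriv i \<phi> (w + u))) (at u)"
        by (rule has_derivative_compose[where f = "\<lambda>u. w + u" and f' = "\<lambda>v. v"])
           (auto intro!: derivative_eq_intros has_derivative_partial_deriv smooth_differentiable test_smooth assms)
      moreover have "((\<lambda>u. \<Sum>i\<in>UNIV. (u $ i) *\<^sub>R partial_deriv i \<phi> w) has_derivative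
          (\<lambda>u. \<Sum>i\<in>UNIV. (u $ i) *\<^sub>R partial_deriv i \<phi> w)) (at u)"
        by (intro bounded_linear_imp_has_derivative bounded_linear_sum bounded_linear_scaleR_const bounded_linear_vec_nth)
      ultimately have "(?r has_derivative ?D u) (at u)"
        by (auto dest: has_derivative_diff simp: scaleR_diff_right sum_subtractf)
      then show "(?r has_derivative ?D u) (at u within cball 0 (norm v))"
        by (rule has_derivative_at_withinI)
      show "onorm (?D u) \<le> real CARD('a) * (?K * norm v)"
        using u by (intro onorm_linear_form_le order_trans[OF K] mult_left_mono K0) auto
    qed auto
    then show ?thesis by (simp add: power2_eq_square algebra_simps)
  qed
  moreover have "0 \<le> real CARD('a) * ?K" using K0 by simp
  ultimately show ?thesis using that by blast
qed

section \<open>Parameter integrals of dilated and translated test functions\<close>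

lemma integrable_mult_bounded:
  fixes a g :: "'a \<Rightarrow> complex"
  assumes "integrable M a" "g \<in> borel_measurable M" "\<And>p. norm (g p) \<le> B"
  shows "integrable M (\<lambda>p. a p * g p)"
proof (rule Bochner_Integration.integrable_bound[where f = "\<lambda>p. B *\<^sub>R a p"])
  show "AE p in M. norm (a p * g p) \<le> norm (B *\<^sub>R a p)"
    using assms(3) by (intro AE_I2) (simp add: norm_mult mult.commute[of "norm (a _)"] mult_mono
        order_trans[OF norm_ge_zero assms(3)] abs_of_nonneg)
qed (use assms in \<open>auto intro!: borel_measurable_times\<close>)

text \<open>Differentiation in z multiplies the density a by the bounded factor \<open>\<mu>\<close>
  and replaces h by one of its derivatives, so the class of these integrals is closed under partial
  derivatives. The fluxes below are built from them.\<close>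

context
  fixes M :: "'p measure" and \<mu> :: "'p \<Rightarrow> real" and c :: "'p \<Rightarrow> real^'n::finite" and L :: real
  assumes lam [measurable]: "\<mu> \<in> borel_measurable M" and lam_bound: "\<And>p. \<bar>\<mu> p\<bar> \<le> L"
    and c [measurable]: "c \<in> borel_measurable M"
begin

lemma integrable_average:
  assumes "integrable M a" "h \<in> test_functions"
  shows "integrable M (\<lambda>p. a p * h (\<mu> p *\<^sub>R z + c p))"
proof -
  note [measurable] = test_borel[OF assms(2)]
  obtain B where "\<And>x. norm (h x) \<le> B" using test_bounded[OF assms(2)] by blast
  then show ?thesis by (intro integrable_mult_bounded assms(1)) auto
qed

lemma integrable_weight:
  fixes a :: "'p \<Rightarrow> complex"
  assumes "integrable M a"
  shows "integrable M (\<lambda>p. a p * of_real (\<mu> p))"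
  using lam_bound by (intro integrable_mult_bounded assms(1)) (auto intro!: borel_measurable_of_real)

text \<open>The Taylor remainder of h is at most K (L norm v)^2 for every p at once; integrated
  against a it stays quadratic in y - z, so the difference quotient converges.\<close>

lemma has_derivative_average:
  assumes a: "integrable M a" and h: "h \<in> test_functions"
  shows "((\<lambda>z. \<integral>p. a p * h (\<mu> p *\<^sub>R z + c p) \<partial>M) has_derivative
    (\<lambda>v. \<Sum>i\<in>UNIV. (v $ i) *\<^sub>R (\<integral>p. (a p * of_real (\<mu> p)) * partial_deriv i h (\<mu> p *\<^sub>R z + c p) \<partial>M))) (at z)"
    (is "(?F has_derivative ?D) _")
proof -
  note [measurable] = test_borel[OF h] test_borel[OF test_partial_deriv[OF h]]
  obtain K where K: "K \<ge> 0"
    "\<And>w v. norm (h (w + v) - h w - (\<Sum>i\<in>UNIV. (v $ i) *\<^sub>R partial_deriv i h w)) \<le> K * (norm v)\<^sup>2"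
    using test_taylor[OF h] by metis
  have int: "integrable M (\<lambda>p. a p * h (\<mu> p *\<^sub>R z + c p))" for z
    by (intro integrable_average a h)
  have int': "integrable M (\<lambda>p. (a p * of_real (\<mu> p)) * partial_deriv i h (\<mu> p *\<^sub>R z + c p))" for z i
    by (intro integrable_average integrable_weight test_partial_deriv a h)
  let ?C = "K * L\<^sup>2 * (\<integral>p. norm (a p) \<partial>M)"
  have est: "norm (?F y - ?F z - ?D (y - z)) \<le> ?C * (norm (y - z))\<^sup>2" for y
  proof -
    let ?v = "y - z"
    let ?R = "\<lambda>p. a p * (h (\<mu> p *\<^sub>R y + c p) - h (\<mu> p *\<^sub>R z + c p)
        - (\<Sum>i\<in>UNIV. ((\<mu> p *\<^sub>R ?v) $ i) *\<^sub>R partial_deriv i h (\<mu> p *\<^sub>R z + c p)))"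
    have R: "?R p = a p * h (\<mu> p *\<^sub>R y + c p) - a p * h (\<mu> p *\<^sub>R z + c p)
        - (\<Sum>i\<in>UNIV. (?v $ i) *\<^sub>R ((a p * of_real (\<mu> p)) * partial_deriv i h (\<mu> p *\<^sub>R z + c p)))" for p
      by (simp add: right_diff_distrib left_diff_distrib sum_distrib_left scaleR_conv_of_real[where 'a = complex] mult_ac)
    have intR: "integrable M ?R"
      unfolding R by (intro Bochner_Integration.integrable_diff Bochner_Integration.integrable_sum
          integrable_scaleR_right int int')
    have "?F y - ?F z - ?D ?v = (\<integral>p. ?R p \<partial>M)"
      unfolding R using int int' by simp
    also have "norm \<dots> \<le> (\<integral>p. norm (a p) * (K * L\<^sup>2 * (norm ?v)\<^sup>2) \<partial>M)"
    proof (rule order_trans[OF integral_norm_bound integral_mono[OF integrable_norm[OF intR]]])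
      fix p
      have "norm (h (\<mu> p *\<^sub>R z + c p + \<mu> p *\<^sub>R ?v) - h (\<mu> p *\<^sub>R z + c p)
        - (\<Sum>i\<in>UNIV. ((\<mu> p *\<^sub>R ?v) $ i) *\<^sub>R partial_deriv i h (\<mu> p *\<^sub>R z + c p))) \<le> K * (norm (\<mu> p *\<^sub>R ?v))\<^sup>2"
        by (rule K)
      also have "\<mu> p *\<^sub>R z + c p + \<mu> p *\<^sub>R ?v = \<mu> p *\<^sub>R y + c p"
        by (simp add: algebra_simps)
      also have "K * (norm (\<mu> p *\<^sub>R ?v))\<^sup>2 \<le> K * (L\<^sup>2 * (norm ?v)\<^sup>2)"
        using power_mono[OF lam_bound[of p], of 2]
        by (intro mult_left_mono K(1)) (simp add: power_mult_distrib mult_right_mono)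
      finally show "norm (?R p) \<le> norm (a p) * (K * L\<^sup>2 * (norm ?v)\<^sup>2)"
        by (simp add: norm_mult mult_left_mono mult.assoc)
    qed (use a in simp)
    also have "\<dots> = ?C * (norm ?v)\<^sup>2" by simp
    finally show ?thesis .
  qed
  show ?thesis
  proof (rule has_derivativeI_sandwich[where e = 1 and H = "\<lambda>y. ?C * norm (y - z)"])
    show "bounded_linear ?D"
      by (intro bounded_linear_sum bounded_linear_scaleR_const bounded_linear_vec_nth)
    show "norm (?F y - ?F z - ?D (y - z)) / norm (y - z) \<le> ?C * norm (y - z)" if "y \<noteq> z" for y
      using est[of y] that by (simp add: divide_simps power2_eq_square mult.assoc)
    show "((\<lambda>y. ?C * norm (y - z)) \<longlongrightarrow> 0) (at z)"
      by (rule tendsto_eq_intros refl)+ simp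
  qed simp
qed

lemma partial_deriv_average:
  assumes "integrable M a" "h \<in> test_functions"
  shows "partial_deriv i (\<lambda>z. \<integral>p. a p * h (\<mu> p *\<^sub>R z + c p) \<partial>M)
    = (\<lambda>z. \<integral>p. (a p * of_real (\<mu> p)) * partial_deriv i h (\<mu> p *\<^sub>R z + c p) \<partial>M)"
proof
  fix z
  show "partial_deriv i (\<lambda>z. \<integral>p. a p * h (\<mu> p *\<^sub>R z + c p) \<partial>M) z
    = (\<integral>p. (a p * of_real (\<mu> p)) * partial_deriv i h (\<mu> p *\<^sub>R z + c p) \<partial>M)"
    using partial_deriv_eq[OF has_derivative_average[OF assms], of i z]
    by (simp add: axis_def if_distrib[of "\<lambda>c. c *\<^sub>R _"] cong: if_cong)
qed

lemma smooth_average: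
  assumes "integrable M a" "h \<in> test_functions"
  shows "smooth (\<lambda>z. \<integral>p. a p * h (\<mu> p *\<^sub>R z + c p) \<partial>M)"
proof (rule smooth_coinduct[where P = "\<lambda>f. \<exists>a h. integrable M a \<and> h \<in> test_functions \<and>
    f = (\<lambda>z. \<integral>p. a p * h (\<mu> p *\<^sub>R z + c p) \<partial>M)"])
  fix f x i assume "\<exists>a h. integrable M a \<and> h \<in> test_functions \<and> f = (\<lambda>z. \<integral>p. a p * h (\<mu> p *\<^sub>R z + c p) \<partial>M)"
  then obtain a h where ah: "integrable M a" "h \<in> test_functions" "f = (\<lambda>z. \<integral>p. a p * h (\<mu> p *\<^sub>R z + c p) \<partial>M)"
    by blast
  show "f differentiable (at x)"
    unfolding ah(3) differentiable_def using has_derivative_average[OF ah(1,2)] by blast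
  show "\<exists>a h. integrable M a \<and> h \<in> test_functions \<and> partial_deriv i f = (\<lambda>z. \<integral>p. a p * h (\<mu> p *\<^sub>R z + c p) \<partial>M)"
    unfolding ah(3) partial_deriv_average[OF ah(1,2)]
    using integrable_weight[OF ah(1)] test_partial_deriv[OF ah(2)] by blast
qed (use assms in blast)

end

section \<open>Bump functions and a mollifier\<close>

text \<open>This class contains the derivatives of its members.\<close>

definition flat :: "real poly \<Rightarrow> real \<Rightarrow> real" where
  "flat p t = (if 0 < t then poly p (1 / t) / exp (1 / t) else 0)"

lemma tendsto_poly_div_exp: "((\<lambda>x. poly p x / exp x) \<longlongrightarrow> (0::real)) at_top"
proof -
  have "((\<lambda>x. \<Sum>i\<le>degree p. coeff p i * (x ^ i / exp x)) \<longlongrightarrow> (\<Sum>i\<le>degree p. coeff p i * 0)) at_top"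
    by (intro tendsto_intros tendsto_power_div_exp_0)
  then show ?thesis by (simp add: poly_altdef sum_divide_distrib)
qed

text \<open>In terms of x = 1/t the function is p(x) e^(-x), and d/dt = -x^2 d/dx produces the
  polynomial x^2 (p - p'). At 0 the right difference quotient is x p(x) e^(-x) with x tending to
  infinity; it tends to 0 because x p(x) is again a polynomial.\<close>

lemma DERIV_flat: "(flat p has_real_derivative flat ([:0, 0, 1:] * (p - pderiv p)) t) (at t)"
proof (cases t "0::real" rule: linorder_cases)
  case less
  have "eventually (\<lambda>s. flat p s = 0) (nhds t)"
    using less order_tendstoD(2)[OF tendsto_ident_at] eventually_nhds_in_open[of "{..<0}" t]
    by (auto elim!: eventually_mono simp: flat_def)
  then show ?thesis
    using less by (subst DERIV_cong_ev[OF refl _ refl, where g = "\<lambda>_. 0"]) (auto simp: flat_def)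
next
  case greater
  have "eventually (\<lambda>s. flat p s = poly p (1 / s) / exp (1 / s)) (nhds t)"
    using greater eventually_nhds_in_open[of "{0<..}" t]
    by (auto elim!: eventually_mono simp: flat_def)
  moreover have "((\<lambda>s. poly p (1 / s) / exp (1 / s)) has_real_derivative flat ([:0, 0, 1:] * (p - pderiv p)) t) (at t)"
    using greater
    by (auto intro!: derivative_eq_intros DERIV_chain2[OF poly_DERIV] simp: flat_def field_simps power2_eq_square)
  ultimately show ?thesis
    by (subst DERIV_cong_ev[OF refl _ refl]) auto
next
  case equal
  have "((\<lambda>s. flat p s / s) \<longlongrightarrow> 0) (at_right 0)"
  proof (rule Lim_transform_eventually)
    show "((\<lambda>s. poly ([:0, 1:] * p) (inverse s) / exp (inverse s)) \<longlongrightarrow> 0) (at_right 0)"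
      by (rule filterlim_compose[OF tendsto_poly_div_exp filterlim_inverse_at_top_right])
    show "\<forall>\<^sub>F s in at_right 0. poly ([:0, 1:] * p) (inverse s) / exp (inverse s) = flat p s / s"
      by (rule eventually_mono[OF eventually_at_right_less[of 0]]) (auto simp: flat_def field_simps)
  qed
  moreover have "((\<lambda>s. flat p s / s) \<longlongrightarrow> 0) (at_left 0)"
    by (rule Lim_transform_eventually[of "\<lambda>_. 0"])
       (auto simp: flat_def eventually_at_left_field intro!: exI[of _ "-1"])
  ultimately have "((\<lambda>s. flat p s / s) \<longlongrightarrow> 0) (at 0)"
    by (simp add: filterlim_split_at)
  then show ?thesis
    using equal by (simp add: has_field_derivative_iff flat_def)
qed

text \<open>A partial derivative is either 0 or c times a function of the same kind for another
  polynomial; hence the induction over the order runs with p arbitrary.\<close>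

lemma smooth_flat_affine:
  fixes j :: "'n::finite"
  shows "smooth (\<lambda>x. of_real (flat p (c * x $ j + d)))"
proof -
  have D: "((\<lambda>x::real^'n. complex_of_real (flat p (c * x $ j + d))) has_derivative
      (\<lambda>v. of_real (flat ([:0, 0, 1:] * (p - pderiv p)) (c * x $ j + d) * (c * v $ j)))) (at x)" for p x
  proof -
    have "((\<lambda>x::real^'n. c * x $ j + d) has_derivative (\<lambda>v. c * v $ j)) (at x)"
      by (auto intro!: derivative_eq_intros bounded_linear_imp_has_derivative bounded_linear_vec_nth)
    from has_derivative_compose[OF this DERIV_flat[THEN has_field_derivative_imp_has_derivative]]
    show ?thesis by (intro has_derivative_of_real)
  qed
  have P: "partial_deriv i (\<lambda>x. complex_of_real (flat p (c * x $ j + d)))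
      = (\<lambda>x. (if i = j then of_real c else 0) * of_real (flat ([:0, 0, 1:] * (p - pderiv p)) (c * x $ j + d)))" for p i
    by (rule ext, subst partial_deriv_eq[OF D]) (simp add: axis_def)
  have "differentiable_times n (\<lambda>x. complex_of_real (flat p (c * x $ j + d)))" for n p
  proof (induction n arbitrary: p)
    case 0
    show ?case using D by (auto simp: differentiable_def)
  next
    case (Suc n)
    have "differentiable_times n (\<lambda>x::real^'n. c)" for c
      using smooth_const smooth_iff_differentiable_times by blast
    with Suc have "differentiable_times n (\<lambda>x. (if i = j then of_real c else 0) *
        complex_of_real (flat ([:0, 0, 1:] * (p - pderiv p)) (c * x $ j + d)))" for i
      by (intro differentiable_times_mult)
    moreover have "(\<lambda>x. complex_of_real (flat p (c * x $ j + d))) differentiable (at x)" for x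
      using D by (auto simp: differentiable_def)
    ultimately show ?case by (simp only: differentiable_times.simps P) blast
  qed
  then show ?thesis by (simp add: smooth_iff_differentiable_times)
qed

lemma smooth_prod: "(\<And>i. i \<in> I \<Longrightarrow> smooth (f i)) \<Longrightarrow> smooth (\<lambda>x. \<Prod>i\<in>I. f i x)"
  by (induction I rule: infinite_finite_induct) (auto intro: smooth_const smooth_mult)

lemma smooth_power: "smooth f \<Longrightarrow> smooth (\<lambda>x. f x ^ n)"
  by (induction n) (auto intro: smooth_const smooth_mult)

text \<open>A product over the coordinates is positive exactly on an open box. Boxes generate the
  Borel sets, so the same functions yield the mollifier and later the uniqueness of
  representatives.\<close>

definition box_bump :: "real ^ 'n \<Rightarrow> real ^ 'n \<Rightarrow> real ^ 'n::finite \<Rightarrow> real" where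
  "box_bump l u x = (\<Prod>i\<in>UNIV. flat 1 (x $ i - l $ i) * flat 1 (u $ i - x $ i))"

lemma flat_1_bounds: "0 \<le> flat 1 t" "flat 1 t \<le> 1" "flat 1 t > 0 \<longleftrightarrow> t > 0"
  by (auto simp: flat_def divide_simps)

lemma box_bump_bounds: "0 \<le> box_bump l u x" "box_bump l u x \<le> 1"
  unfolding box_bump_def
  by (intro prod_nonneg prod_le_1 ballI conjI mult_nonneg_nonneg mult_le_one flat_1_bounds)+

lemma box_bump_pos: "box_bump l u x > 0 \<longleftrightarrow> x \<in> box l u"
proof
  assume "box_bump l u x > 0"
  then have "(\<Prod>i\<in>UNIV. flat 1 (x $ i - l $ i) * flat 1 (u $ i - x $ i)) \<noteq> 0"
    unfolding box_bump_def by (rule less_imp_neq[symmetric])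
  then have "flat 1 (x $ i - l $ i) * flat 1 (u $ i - x $ i) \<noteq> 0" for i
    by (simp add: prod_zero_iff)
  then have "l $ i < x $ i \<and> x $ i < u $ i" for i
    by (metis diff_gt_0_iff_gt flat_def mult_zero_left mult_zero_right)
  then show "x \<in> box l u" by (simp add: mem_box_cart)
next
  assume "x \<in> box l u"
  then show "box_bump l u x > 0"
    unfolding box_bump_def by (intro prod_pos) (auto simp: flat_1_bounds mem_box_cart)
qed

lemma box_bump_smooth: "smooth (\<lambda>x. of_real (box_bump l u x))"
proof -
  have "smooth (\<lambda>x. \<Prod>i\<in>UNIV. of_real (flat 1 (1 * x $ i + (- l $ i))) * of_real (flat 1 ((- 1) * x $ i + u $ i)))"
    by (intro smooth_prod smooth_mult smooth_flat_affine)
  then show ?thesis by (simp add: box_bump_def)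
qed

lemma test_functions_boxI:
  assumes "smooth \<phi>" "\<And>x. x \<notin> box l u \<Longrightarrow> \<phi> x = 0"
  shows "\<phi> \<in> test_functions"
proof -
  obtain r where r: "box l u \<subseteq> ball 0 r" "r > 0"
    using bounded_subset_ballD[OF bounded_box] by blast
  then have "\<forall>x. r \<le> norm x \<longrightarrow> \<phi> x = 0" using assms(2) by (force simp: subset_iff)
  with assms(1) r(2) show ?thesis by (auto simp: test_functions_iff)
qed

lemma box_bump_test: "(\<lambda>x. of_real (box_bump l u x)) \<in> test_functions"
proof (rule test_functions_boxI)
  show "of_real (box_bump l u x) = 0" if "x \<notin> box l u" for x
    using that box_bump_pos[of l u x] box_bump_bounds(1)[of l u x] by simp
qed (rule box_bump_smooth)

lemma ex_mollifier:
  obtains w :: "real ^ 'n::finite \<Rightarrow> real" where "(\<lambda>x. complex_of_real (w x)) \<in> test_functions"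
    "\<And>x. w x \<ge> 0" "\<And>x. 1 \<le> norm x \<Longrightarrow> w x = 0" "(\<integral>x. w x \<partial>lborel) = 1" "integrable lborel w"
proof -
  \<comment> \<open>With half-width 1/N the box lies in the unit ball of the sum norm, hence in the
    Euclidean unit ball, where the mollifier has to be supported.\<close>
  define l :: "real^'n" where "l = (\<chi> i. - 1 / real CARD('n))"
  define u :: "real^'n" where "u = (\<chi> i. 1 / real CARD('n))"
  let ?b = "box_bump l u"
  have int: "integrable lborel ?b"
    using integrable_Re[OF test_integrable[OF box_bump_test]] by simp
  have "(\<integral>x. ?b x \<partial>lborel) \<noteq> 0"
  proof
    assume "(\<integral>x. ?b x \<partial>lborel) = 0"
    then have "AE x in lborel. ?b x = 0"
      using integral_nonneg_eq_0_iff_AE[OF int AE_I2[OF box_bump_bounds(1)]] by simp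
    then have "AE x in lborel. x \<notin> box l u"
      by eventually_elim (use box_bump_pos[of l u] in force)
    then have "emeasure lborel (box l u) = 0"
      by (subst (asm) AE_iff_measurable[OF _ refl]) auto
    moreover have "emeasure lborel (box l u) = ennreal (\<Prod>b\<in>Basis. (u - l) \<bullet> b)"
      by (rule emeasure_lborel_box) (auto simp: l_def u_def Basis_vec_def inner_axis)
    moreover have "(\<Prod>b\<in>Basis. (u - l) \<bullet> b) > 0"
      by (rule prod_pos) (auto simp: l_def u_def Basis_vec_def inner_axis)
    ultimately show False by (metis ennreal_0 ennreal_eq_0_iff less_irrefl linorder_not_less)
  qed
  moreover have "(\<integral>x. ?b x \<partial>lborel) \<ge> 0" by (rule Bochner_Integration.integral_nonneg) (simp add: box_bump_bounds)
  ultimately have I: "(\<integral>x. ?b x \<partial>lborel) > 0" by linarith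
  let ?c = "1 / (\<integral>x. ?b x \<partial>lborel)"
  show ?thesis
  proof (rule that[of "\<lambda>x. ?c * ?b x"])
    show "(\<lambda>x. complex_of_real (?c * ?b x)) \<in> test_functions"
      using test_cmult[OF box_bump_test, of "of_real ?c"] by simp
    show "?c * ?b x = 0" if "1 \<le> norm x" for x
    proof -
      have "x \<notin> box l u"
      proof
        assume "x \<in> box l u"
        then have "\<bar>x $ i\<bar> < 1 / real CARD('n)" for i
          by (auto simp: mem_box_cart l_def u_def abs_less_iff) (metis minus_divide_left minus_less_iff)
        then have "(\<Sum>i\<in>UNIV. \<bar>x $ i\<bar>) < (\<Sum>i\<in>(UNIV::'n set). 1 / real CARD('n))"
          by (intro sum_strict_mono) auto
        then show False using norm_le_l1_cart[of x] that by simp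
      qed
      then show ?thesis using box_bump_pos[of l u x] box_bump_bounds(1)[of l u x] by simp
    qed
  qed (use I int box_bump_bounds(1) in \<open>auto intro: divide_nonneg_pos\<close>)
qed

section \<open>Transport along segments\<close>

lemma lborel_prod_eq: "(lborel :: ('a::euclidean_space \<times> 'b::euclidean_space) measure) = lborel \<Otimes>\<^sub>M lborel"
  by (rule lborel_prod[symmetric])

lemma lborel_integral_affine:
  fixes g :: "'a::euclidean_space \<Rightarrow> 'b::{banach, second_countable_topology}"
  assumes [measurable]: "g \<in> borel_measurable borel" and "c \<noteq> 0"
  shows "(\<integral>z. g z \<partial>lborel) = \<bar>c\<bar> ^ DIM('a) *\<^sub>R (\<integral>y. g (T + c *\<^sub>R y) \<partial>lborel)"
  by (subst lborel_affine[OF assms(2), of T])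
     (simp add: integral_density integral_distr)

lemma lborel_nn_integral_affine:
  fixes g :: "'a::euclidean_space \<Rightarrow> ennreal"
  assumes [measurable]: "g \<in> borel_measurable borel" and "c \<noteq> 0"
  shows "(\<integral>\<^sup>+z. g z \<partial>lborel) = ennreal (\<bar>c\<bar> ^ DIM('a)) * (\<integral>\<^sup>+y. g (T + c *\<^sub>R y) \<partial>lborel)"
  by (subst lborel_affine[OF assms(2), of T])
     (simp add: nn_integral_density nn_integral_distr nn_integral_cmult)

lemma (in pair_sigma_finite) integrable_product:
  fixes f :: "'a \<Rightarrow> 'c::{banach, second_countable_topology, real_normed_field}"
  assumes "integrable M1 f" "integrable M2 g"
  shows "integrable (M1 \<Otimes>\<^sub>M M2) (\<lambda>(x, y). f x * g y)"
proof -
  have [measurable]: "f \<in> borel_measurable M1" "g \<in> borel_measurable M2"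
    using assms by auto
  show ?thesis
    using assms by (intro Fubini_integrable) (auto simp: norm_mult split_beta)
qed

section \<open>The flux and its divergence\<close>

definition half_ind :: "real \<Rightarrow> real" where
  "half_ind t = indicator {1/2..1} t"

lemma half_ind_measurable [measurable]: "half_ind \<in> borel_measurable borel"
  unfolding half_ind_def by measurable

text \<open>Here p = (t, x). The factor t^(-N) compensates the Jacobian of z = x + t (y - x) as a
  function of y when an integral over z is rewritten in y.\<close>

definition weight :: "(real ^ 'n \<Rightarrow> complex) \<Rightarrow> real \<times> (real ^ 'n::finite) \<Rightarrow> complex" where
  "weight w p = of_real (half_ind (fst p) / fst p ^ CARD('n)) * w (snd p)"

text \<open>The value outside \<open>[1/2, 1]\<close> is irrelevant, since \<open>weight\<close> vanishes there; it only keeps the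
  factor bounded.\<close>

definition dil :: "real \<times> (real ^ 'n::finite) \<Rightarrow> real" where
  "dil p = (if fst p \<in> {1/2..1} then 1 / fst p else 1)"

definition shift :: "real \<times> (real ^ 'n::finite) \<Rightarrow> real ^ 'n" where
  "shift p = (1 - dil p) *\<^sub>R snd p"

lemma dil_measurable [measurable]: "dil \<in> borel_measurable borel"
  unfolding dil_def borel_prod[symmetric] by measurable

lemma shift_measurable [measurable]: "shift \<in> borel_measurable borel"
  unfolding shift_def[abs_def] dil_def borel_prod[symmetric] by measurable

lemma dil_bound: "\<bar>dil p\<bar> \<le> 2"
  by (auto simp: dil_def divide_simps)

lemma weight_measurable:
  assumes [measurable]: "w \<in> borel_measurable borel"
  shows "weight w \<in> borel_measurable borel"
  unfolding weight_def[abs_def] borel_prod[symmetric] by measurable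

lemma integrable_weight_fun:
  fixes w :: "real ^ 'n::finite \<Rightarrow> complex"
  assumes w: "w \<in> test_functions"
  shows "integrable lborel (weight w)"
proof -
  have "integrable lborel (\<lambda>t. complex_of_real (half_ind t))"
    unfolding half_ind_def
    by (intro integrable_of_real integrable_real_indicator emeasure_bounded_finite) auto
  from lborel_pair.integrable_product[OF this test_integrable[OF w]]
  have "integrable lborel (\<lambda>(t, x). complex_of_real (half_ind t) * w x)"
    by (simp add: lborel_prod)
  moreover have "(\<lambda>p::real \<times> (real^'n). complex_of_real (half_ind (fst p) / fst p ^ CARD('n))) \<in> borel_measurable lborel"
    by (simp add: lborel_prod[symmetric])
  moreover have "norm (complex_of_real (half_ind (fst p) / fst p ^ CARD('n))) \<le> 2 ^ CARD('n)" for p :: "real \<times> (real^'n)"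
  proof (cases "fst p \<in> {1/2..1}")
    case True
    then have "(1 / fst p) ^ CARD('n) \<le> 2 ^ CARD('n)"
      by (intro power_mono) (auto simp: divide_simps)
    with True show ?thesis by (simp add: half_ind_def power_one_over norm_divide norm_power)
  qed (simp add: half_ind_def)
  ultimately have "integrable lborel (\<lambda>p. (case p of (t, x) \<Rightarrow> complex_of_real (half_ind t) * w x) *
      complex_of_real (half_ind (fst p) / fst p ^ CARD('n)))"
    by (rule integrable_mult_bounded)
  also have "(\<lambda>p. (case p of (t, x) \<Rightarrow> complex_of_real (half_ind t) * w x) *
      complex_of_real (half_ind (fst p) / fst p ^ CARD('n))) = weight w"
    by (auto simp: weight_def half_ind_def indicator_def)
  finally show ?thesis .
qed

abbreviation coord_mult :: "'n::finite \<Rightarrow> (real ^ 'n \<Rightarrow> complex) \<Rightarrow> real ^ 'n \<Rightarrow> complex" where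
  "coord_mult i h \<equiv> (\<lambda>x. of_real (x $ i) * h x)"

text \<open>With \<open>y = (z - (1 - t) x) / t\<close>, so that \<open>z\<close> divides the segment from \<open>x\<close> to \<open>y\<close>, the flux is the
  integral of \<open>w(x) t\<^sup>-\<^sup>N \<phi>(y) (y\<^sub>i - x\<^sub>i)\<close> over \<open>1/2 \<le> t \<le> 1\<close>. Using only half of the segment keeps the
  dilation factor \<open>1/t\<close> bounded, so no singular kernel arises; the other half is the flux with \<open>\<phi>\<close>
  and \<open>w\<close> exchanged. It is written as a difference of two terms because each of them is an average
  of dilated and translated test functions.\<close>

definition flux :: "'n::finite \<Rightarrow> (real ^ 'n \<Rightarrow> complex) \<Rightarrow> (real ^ 'n \<Rightarrow> complex) \<Rightarrow> real ^ 'n \<Rightarrow> complex" where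
  "flux i \<phi> w z = (\<integral>p. weight w p * coord_mult i \<phi> (dil p *\<^sub>R z + shift p) \<partial>lborel)
     - (\<integral>p. weight (coord_mult i w) p * \<phi> (dil p *\<^sub>R z + shift p) \<partial>lborel)"

lemma dil_shift_eq:
  "dil p *\<^sub>R z + shift p = snd p + dil p *\<^sub>R (z - snd p)"
  by (simp add: shift_def algebra_simps)

text \<open>If the product did not vanish, z would be the convex combination t y + (1 - t) x of a
  point x where w and a point y where \<phi> is nonzero. Both lie in the open ball of radius r,
  hence so would z.\<close>

lemma weight_support:
  assumes "\<And>x. r \<le> norm x \<Longrightarrow> \<phi> x = 0" "\<And>x. r \<le> norm x \<Longrightarrow> w x = 0" "r \<le> norm z"
  shows "weight w p * \<phi> (dil p *\<^sub>R z + shift p) = 0"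
proof (rule ccontr)
  assume nz: "\<not> ?thesis"
  let ?t = "fst p" and ?x = "snd p" and ?y = "dil p *\<^sub>R z + shift p"
  from nz have t: "?t \<in> {1/2..1}"
    by (auto simp: weight_def half_ind_def indicator_def split: if_splits)
  have "w ?x \<noteq> 0" "\<phi> ?y \<noteq> 0" using nz by (auto simp: weight_def)
  then have x: "norm ?x < r" and y: "norm ?y < r"
    using assms(1,2) linorder_not_less by blast+
  have "?t *\<^sub>R ?y = z + (?t - 1) *\<^sub>R ?x"
    using t by (simp add: shift_def dil_def algebra_simps)
  then have z: "z = ?t *\<^sub>R ?y + (1 - ?t) *\<^sub>R ?x" by (simp add: algebra_simps)
  have "norm z \<le> norm (?t *\<^sub>R ?y) + norm ((1 - ?t) *\<^sub>R ?x)"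
    by (subst z) (rule norm_triangle_ineq)
  also have "\<dots> = ?t * norm ?y + (1 - ?t) * norm ?x"
    using t by simp
  also have "\<dots> < ?t * r + (1 - ?t) * r"
    using t x y by (intro add_less_le_mono mult_strict_left_mono mult_left_mono) auto
  finally show False using assms(3) by (simp add: algebra_simps)
qed

lemma test_common_support:
  assumes "\<phi> \<in> test_functions" "w \<in> test_functions"
  obtains r where "r > 0" "\<And>x. r \<le> norm x \<Longrightarrow> \<phi> x = 0" "\<And>x. r \<le> norm x \<Longrightarrow> w x = 0"
proof -
  obtain r where "r > 0" "\<And>x. r \<le> norm x \<Longrightarrow> \<phi> x = 0" using test_support[OF assms(1)] by blast
  moreover obtain r' where "r' > 0" "\<And>x. r' \<le> norm x \<Longrightarrow> w x = 0" using test_support[OF assms(2)] by blast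
  ultimately show ?thesis by (intro that[of "max r r'"]) auto
qed

lemma flux_test:
  assumes "\<phi> \<in> test_functions" "w \<in> test_functions"
  shows "flux i \<phi> w \<in> test_functions"
proof -
  have sm: "smooth (\<lambda>z. \<integral>p. weight w p * h (dil p *\<^sub>R z + shift p) \<partial>lborel)"
    if "w \<in> test_functions" "h \<in> test_functions" for h w :: "real^'a \<Rightarrow> complex"
    by (rule smooth_average[where L = 2])
       (auto intro!: integrable_weight_fun that simp: dil_bound)
  have "smooth (\<lambda>z. (\<integral>p. weight w p * coord_mult i \<phi> (dil p *\<^sub>R z + shift p) \<partial>lborel)
     + - 1 * (\<integral>p. weight (coord_mult i w) p * \<phi> (dil p *\<^sub>R z + shift p) \<partial>lborel))"
    by (intro smooth_add smooth_mult smooth_const sm test_coord_mult assms)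
  then have "smooth (flux i \<phi> w)" by (simp add: flux_def[abs_def])
  moreover obtain r where r: "r > 0" "\<And>x. r \<le> norm x \<Longrightarrow> \<phi> x = 0" "\<And>x. r \<le> norm x \<Longrightarrow> w x = 0"
    using test_common_support[OF assms] by blast
  have "flux i \<phi> w z = 0" if "r \<le> norm z" for z
  proof -
    have "weight w p * coord_mult i \<phi> (dil p *\<^sub>R z + shift p) = 0"
      "weight (coord_mult i w) p * \<phi> (dil p *\<^sub>R z + shift p) = 0" for p
      by (rule weight_support[OF _ _ that]; simp add: r)+
    then show ?thesis unfolding flux_def by (simp only: integral_zero diff_self)
  qed
  ultimately show ?thesis using r(1) by (auto simp: test_functions_iff)
qed

text \<open>The sum is the divergence in y of (y - x) \<phi>(y): the scaling t^(-N) contributes N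
  copies of \<phi>, the motion of y the radial derivative. Thus the divergence of the flux is a
  derivative in t and can be integrated explicitly.\<close>

lemma DERIV_dilation:
  fixes \<phi> :: "real ^ 'n::finite \<Rightarrow> complex"
  assumes \<phi>: "smooth \<phi>" and t: "t > 0"
  shows "((\<lambda>t. of_real (1 / t ^ CARD('n)) * \<phi> (x + (1 / t) *\<^sub>R (z - x))) has_vector_derivative
    - (of_real (1 / t ^ Suc CARD('n)) * (\<Sum>i\<in>UNIV. \<phi> (x + (1 / t) *\<^sub>R (z - x)) +
        of_real ((x + (1 / t) *\<^sub>R (z - x)) $ i - x $ i) * partial_deriv i \<phi> (x + (1 / t) *\<^sub>R (z - x))))) (at t)"
proof -
  let ?y = "x + (1 / t) *\<^sub>R (z - x)"
  let ?D = "\<lambda>v. \<Sum>i\<in>UNIV. (v $ i) *\<^sub>R partial_deriv i \<phi> ?y"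
  have "((\<lambda>t. x + (1 / t) *\<^sub>R (z - x)) has_derivative (\<lambda>h. (- (h / t\<^sup>2)) *\<^sub>R (z - x))) (at t)"
    using t by (auto intro!: derivative_eq_intros simp: power2_eq_square)
  from has_derivative_compose[OF this has_derivative_partial_deriv[OF smooth_differentiable[OF \<phi>]]]
  have 1: "((\<lambda>t. \<phi> (x + (1 / t) *\<^sub>R (z - x))) has_vector_derivative (\<Sum>i\<in>UNIV. (- (1 / t\<^sup>2) * (z - x) $ i) *\<^sub>R partial_deriv i \<phi> ?y)) (at t)"
    by (simp add: has_vector_derivative_def scaleR_sum_right)
  have "((\<lambda>t. 1 / t ^ CARD('n)) has_real_derivative - (real CARD('n) / t ^ Suc CARD('n))) (at t)"
  proof -
    have "CARD('n) = Suc (CARD('n) - 1)" by simp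
    then obtain m where m: "CARD('n) = Suc m" by blast
    have "((\<lambda>t. 1 / t) has_real_derivative - (1 / t\<^sup>2)) (at t)"
      using t by (auto intro!: derivative_eq_intros simp: power2_eq_square)
    from DERIV_power_Suc[OF this, of m] show ?thesis
      unfolding m using t by (simp add: power_one_over field_simps power2_eq_square)
  qed
  then have 2: "((\<lambda>t. complex_of_real (1 / t ^ CARD('n))) has_vector_derivative of_real (- (real CARD('n) / t ^ Suc CARD('n)))) (at t)"
    by (intro has_vector_derivative_of_real) (simp add: has_real_derivative_iff_has_vector_derivative)
  have 3: "of_real (1 / t ^ CARD('n)) * (\<Sum>i\<in>UNIV. (- (1 / t\<^sup>2) * (z - x) $ i) *\<^sub>R partial_deriv i \<phi> ?y)
      + of_real (- (real CARD('n) / t ^ Suc CARD('n))) * \<phi> ?y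
      = - (of_real (1 / t ^ Suc CARD('n)) * (\<Sum>i\<in>UNIV. \<phi> ?y + of_real (?y $ i - x $ i) * partial_deriv i \<phi> ?y))"
  proof -
    define a where "a = complex_of_real (1 / t)"
    have a: "complex_of_real (1 / t ^ n) = a ^ n" "complex_of_real (- (1 / t\<^sup>2) * r) = - a\<^sup>2 * of_real r"
      "complex_of_real (- (r / t ^ n)) = - (of_real r * a ^ n)"
      "complex_of_real (1 / t * r) = a * of_real r" for n r
      by (simp_all add: a_def power_one_over)
    have y: "?y $ i - x $ i = 1 / t * (z - x) $ i" for i
      by simp
    have "a ^ n * (\<Sum>i\<in>(UNIV::'n set). - a\<^sup>2 * d i * P i) + - (of_real (real CARD('n)) * a ^ Suc n) * Y
        = - (a ^ Suc n * (\<Sum>i\<in>(UNIV::'n set). Y + a * d i * P i))" for n d P Y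
      by (simp add: sum.distrib sum_distrib_left sum_negf power2_eq_square distrib_left mult_ac)
    then show ?thesis
      unfolding y scaleR_conv_of_real[where 'a = complex] a .
  qed
  show ?thesis
    using has_vector_derivative_mult[OF 2 1] unfolding 3 .
qed

lemma partial_deriv_diff:
  assumes "\<And>x. f differentiable (at x)" "\<And>x. g differentiable (at x)"
  shows "partial_deriv i (\<lambda>x. f x - g x) = (\<lambda>x. partial_deriv i f x - partial_deriv i g x)"
proof
  fix x
  have "((\<lambda>x. f x - g x) has_derivative (\<lambda>v. (\<Sum>i\<in>UNIV. (v $ i) *\<^sub>R partial_deriv i f x)
      - (\<Sum>i\<in>UNIV. (v $ i) *\<^sub>R partial_deriv i g x))) (at x)"
    by (intro has_derivative_diff has_derivative_partial_deriv assms)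
  from partial_deriv_eq[OF this, of i]
  show "partial_deriv i (\<lambda>x. f x - g x) x = partial_deriv i f x - partial_deriv i g x"
    by (simp add: axis_def if_distrib[of "\<lambda>c. c *\<^sub>R _"] cong: if_cong)
qed

lemma weight_coord_mult: "weight (coord_mult i w) p = weight w p * of_real (snd p $ i)"
  by (simp add: weight_def mult_ac)

lemma integrable_weight_average:
  assumes "\<phi> \<in> test_functions" "w \<in> test_functions"
  shows "integrable lborel (\<lambda>p. (weight w p * of_real (dil p)) * \<phi> (dil p *\<^sub>R z + shift p))"
  by (rule integrable_average[where L = 2])
     (auto intro!: integrable_weight[where L = 2 and c = shift] integrable_weight_fun assms simp: dil_bound)

text \<open>The integrand of the i-th derivative of the flux. The two averages combine to the i-th
  derivative of (y_i - x_i) \<phi>(y) at y = \<open>dil p *\<^sub>R z + shift p\<close>; the factor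
  \<open>dil p\<close> comes from the chain rule.\<close>

definition flux_kernel :: "'n::finite \<Rightarrow> (real ^ 'n \<Rightarrow> complex) \<Rightarrow> (real ^ 'n \<Rightarrow> complex) \<Rightarrow>
    real ^ 'n \<Rightarrow> real \<times> (real ^ 'n) \<Rightarrow> complex" where
  "flux_kernel i \<phi> w z p = (weight w p * of_real (dil p)) * (\<phi> (dil p *\<^sub>R z + shift p) +
      of_real ((dil p *\<^sub>R z + shift p) $ i - snd p $ i) * partial_deriv i \<phi> (dil p *\<^sub>R z + shift p))"

lemma partial_deriv_flux:
  assumes \<phi>: "\<phi> \<in> test_functions" and w: "w \<in> test_functions"
  shows "integrable lborel (\<lambda>p. flux_kernel i \<phi> w z p)" "partial_deriv i (flux i \<phi> w) z = (\<integral>p. flux_kernel i \<phi> w z p \<partial>lborel)"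
proof -
  note pd = partial_deriv_average[where \<mu> = dil and c = shift and L = 2 and M = lborel, simplified, OF dil_bound]
  note hd = has_derivative_average[where \<mu> = dil and c = shift and L = 2 and M = lborel, simplified, OF dil_bound]
  let ?A = "\<lambda>p. (weight w p * of_real (dil p)) * partial_deriv i (coord_mult i \<phi>) (dil p *\<^sub>R z + shift p)"
  let ?B = "\<lambda>p. (weight (coord_mult i w) p * of_real (dil p)) * partial_deriv i \<phi> (dil p *\<^sub>R z + shift p)"
  have AB: "integrable lborel ?A" "integrable lborel ?B"
    by (intro integrable_weight_average test_partial_deriv test_coord_mult \<phi> w)+
  have *: "partial_deriv i (coord_mult i \<phi>) y = of_real (y $ i) * partial_deriv i \<phi> y + \<phi> y" for y
    by (subst partial_deriv_mult) (auto simp: partial_deriv_coord intro!: smooth_differentiable smooth_coord test_smooth \<phi>)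
  have K: "flux_kernel i \<phi> w z p = ?A p - ?B p" for p
    unfolding flux_kernel_def weight_coord_mult * by (simp add: algebra_simps)
  show "integrable lborel (\<lambda>p. flux_kernel i \<phi> w z p)"
    unfolding K by (intro Bochner_Integration.integrable_diff AB)
  have "partial_deriv i (flux i \<phi> w) z = (\<integral>p. ?A p \<partial>lborel) - (\<integral>p. ?B p \<partial>lborel)"
    unfolding flux_def[abs_def]
    apply (subst partial_deriv_diff)
    subgoal unfolding differentiable_def using hd[OF integrable_weight_fun[OF w] test_coord_mult[OF \<phi>]] by blast
    subgoal unfolding differentiable_def using hd[OF integrable_weight_fun[OF test_coord_mult[OF w]] \<phi>] by blast
    by (simp only: pd[OF integrable_weight_fun[OF w] test_coord_mult[OF \<phi>]]
        pd[OF integrable_weight_fun[OF test_coord_mult[OF w]] \<phi>])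
  also have "\<dots> = (\<integral>p. flux_kernel i \<phi> w z p \<partial>lborel)"
    unfolding K using AB by (rule Bochner_Integration.integral_diff[symmetric])
  finally show "partial_deriv i (flux i \<phi> w) z = (\<integral>p. flux_kernel i \<phi> w z p \<partial>lborel)" .
qed

text \<open>The kernels sum to the t-derivative of -w(x) t^(-N) \<phi>(x + (z - x)/t) on [1/2, 1].
  At t = 1 the argument of \<phi> is z, at t = 1/2 it is 2 z - x.\<close>

lemma integral_dilation_FTC:
  fixes \<phi> :: "real ^ 'n::finite \<Rightarrow> complex"
  assumes \<phi>: "smooth \<phi>"
  shows "(\<integral>t. (\<Sum>i\<in>UNIV. flux_kernel i \<phi> w z (t, x)) \<partial>lborel) = w x * (2 ^ CARD('n) * \<phi> (2 *\<^sub>R z - x)) - w x * \<phi> z"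
proof -
  let ?y = "\<lambda>t. x + (1 / t) *\<^sub>R (z - x)"
  let ?F = "\<lambda>t. - w x * (of_real (1 / t ^ CARD('n)) * \<phi> (?y t))"
  let ?G = "\<lambda>t. - w x * (- (of_real (1 / t ^ Suc CARD('n)) * (\<Sum>i\<in>UNIV. \<phi> (?y t) +
        of_real (?y t $ i - x $ i) * partial_deriv i \<phi> (?y t))))"
  have "(\<Sum>i\<in>UNIV. flux_kernel i \<phi> w z (t, x)) = indicator {1/2..1} t *\<^sub>R ?G t" for t
  proof (cases "t \<in> {1/2..1}")
    case True
    then have "dil (t, x) *\<^sub>R z + shift (t, x) = ?y t"
      unfolding dil_shift_eq by (simp add: dil_def)
    then have "flux_kernel i \<phi> w z (t, x) = w x * (of_real (1 / t ^ Suc CARD('n)) * (\<phi> (?y t) +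
        of_real (?y t $ i - x $ i) * partial_deriv i \<phi> (?y t)))" for i
      using True by (simp only: flux_kernel_def) (simp add: weight_def half_ind_def dil_def)
    with True show ?thesis
      by (simp only: sum_distrib_left[symmetric]) simp
  qed (simp add: flux_kernel_def weight_def half_ind_def)
  then have "(\<integral>t. (\<Sum>i\<in>UNIV. flux_kernel i \<phi> w z (t, x)) \<partial>lborel) = (\<integral>t. indicator {1/2..1} t *\<^sub>R ?G t \<partial>lborel)"
    by simp
  also have "\<dots> = ?F 1 - ?F (1/2)"
  proof (rule integral_FTC_atLeastAtMost)
    show "(?F has_vector_derivative ?G t) (at t within {1/2..1})" if "1/2 \<le> t" "t \<le> 1" for t
      by (rule has_vector_derivative_mult_right[OF has_vector_derivative_at_within[OF DERIV_dilation[OF \<phi>]]])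
         (use that in linarith)
    have cont: "continuous_on {1/2..1} (\<lambda>t. h (?y t))" if "smooth h" for h
      by (intro continuous_on_compose2[OF smooth_continuous_on[OF that, of UNIV]] continuous_intros) auto
    show "continuous_on {1/2..1} ?G"
      by (intro continuous_intros cont smooth_partial_deriv \<phi>) auto
  qed simp
  also have "\<dots> = w x * (2 ^ CARD('n) * \<phi> (2 *\<^sub>R z - x)) - w x * \<phi> z"
  proof -
    have "?y 1 = z" "?y (1/2) = 2 *\<^sub>R z - x" by (simp_all add: scaleR_2)
    then show ?thesis by (simp only:) (simp add: power_one_over)
  qed
  finally show ?thesis .
qed

text \<open>Fubini, with t integrated first, reduces the divergence to boundary terms. The one at t
  = 1 reproduces \<phi>; the one at t = 1/2 is a convolution, whose symmetry in \<phi> and w lets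
  the two half-fluxes fit together.\<close>

lemma sum_partial_deriv_flux:
  fixes \<phi> :: "real ^ 'n::finite \<Rightarrow> complex"
  assumes \<phi>: "\<phi> \<in> test_functions" and w: "w \<in> test_functions"
  shows "(\<Sum>i\<in>UNIV. partial_deriv i (flux i \<phi> w) z)
    = 2 ^ CARD('n) * (\<integral>x. w x * \<phi> (2 *\<^sub>R z - x) \<partial>lborel) - (\<integral>x. w x \<partial>lborel) * \<phi> z"
proof -
  note [measurable] = test_borel[OF \<phi>]
  note pd = partial_deriv_flux[OF \<phi> w]
  have "(\<Sum>i\<in>UNIV. partial_deriv i (flux i \<phi> w) z) = (\<integral>p. (\<Sum>i\<in>UNIV. flux_kernel i \<phi> w z p) \<partial>lborel)"
    using pd(1) by (simp add: pd(2))
  also have "\<dots> = (\<integral>(t, x). (\<Sum>i\<in>UNIV. flux_kernel i \<phi> w z (t, x)) \<partial>(lborel \<Otimes>\<^sub>M lborel))"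
    by (simp only: lborel_prod case_prod_beta' prod.collapse)
  also have "\<dots> = (\<integral>x. (\<integral>t. (\<Sum>i\<in>UNIV. flux_kernel i \<phi> w z (t, x)) \<partial>lborel) \<partial>lborel)"
    using pd(1) by (intro lborel_pair.integral_snd[symmetric]) (simp add: lborel_prod case_prod_beta')
  also have "\<dots> = (\<integral>x. w x * (2 ^ CARD('n) * \<phi> (2 *\<^sub>R z - x)) - w x * \<phi> z \<partial>lborel)"
    by (simp only: integral_dilation_FTC[OF test_smooth[OF \<phi>]])
  also have "\<dots> = (\<integral>x. 2 ^ CARD('n) * (w x * \<phi> (2 *\<^sub>R z - x)) - w x * \<phi> z \<partial>lborel)"
    by (intro Bochner_Integration.integral_cong) simp_all
  also have "\<dots> = (\<integral>x. 2 ^ CARD('n) * (w x * \<phi> (2 *\<^sub>R z - x)) \<partial>lborel) - (\<integral>x. w x * \<phi> z \<partial>lborel)"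
  proof (rule Bochner_Integration.integral_diff)
    obtain B where "\<And>x. norm (\<phi> x) \<le> B" using test_bounded[OF \<phi>] by blast
    then have "integrable lborel (\<lambda>x. w x * \<phi> (2 *\<^sub>R z - x))"
      by (intro integrable_mult_bounded test_integrable w) auto
    then show "integrable lborel (\<lambda>x. 2 ^ CARD('n) * (w x * \<phi> (2 *\<^sub>R z - x)))"
      by (rule integrable_mult_right)
  qed (use test_integrable[OF w] in simp)
  also have "\<dots> = 2 ^ CARD('n) * (\<integral>x. w x * \<phi> (2 *\<^sub>R z - x) \<partial>lborel) - (\<integral>x. w x \<partial>lborel) * \<phi> z"
    by simp
  finally show ?thesis .
qed

text \<open>Both sides equal \<open>2\<^sup>N\<close> times the value of \<open>\<phi> * w\<close> at \<open>2z\<close>.\<close>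

lemma flux_symmetric:
  fixes \<phi> :: "real ^ 'n::finite \<Rightarrow> complex"
  assumes \<phi>: "\<phi> \<in> test_functions" and w: "w \<in> test_functions"
  shows "(\<integral>x. w x \<partial>lborel) * \<phi> z + (\<Sum>i\<in>UNIV. partial_deriv i (flux i \<phi> w) z)
    = (\<integral>x. \<phi> x \<partial>lborel) * w z + (\<Sum>i\<in>UNIV. partial_deriv i (flux i w \<phi>) z)"
proof -
  note [measurable] = test_borel[OF \<phi>] test_borel[OF w]
  have "(\<integral>x. w x * \<phi> (2 *\<^sub>R z - x) \<partial>lborel) = (\<integral>x. \<phi> x * w (2 *\<^sub>R z - x) \<partial>lborel)"
    by (subst lborel_integral_affine[where c = "-1" and T = "2 *\<^sub>R z"]) (simp_all add: mult.commute)
  then show ?thesis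
    by (simp add: sum_partial_deriv_flux[OF \<phi> w] sum_partial_deriv_flux[OF w \<phi>])
qed

section \<open>Duality with segment averages, and the representation\<close>

definition locally_integrable :: "(real ^ 'n::finite \<Rightarrow> complex) \<Rightarrow> bool" where
  "locally_integrable f \<longleftrightarrow> f \<in> borel_measurable borel \<and>
     (\<forall>r. integrable lborel (\<lambda>z. of_real (indicator (ball 0 r) z) * f z))"

text \<open>What remains of f z times the integrand of the flux after z = x + t (y - x) is
  substituted: the Jacobian has cancelled, \<phi> is taken at the integration variable y and f at
  the moving point.\<close>

definition seg_kernel :: "'n::finite \<Rightarrow> (real ^ 'n \<Rightarrow> complex) \<Rightarrow> (real ^ 'n \<Rightarrow> complex) \<Rightarrow>
    (real ^ 'n \<Rightarrow> complex) \<Rightarrow> real \<times> (real ^ 'n) \<Rightarrow> real ^ 'n \<Rightarrow> complex" where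
  "seg_kernel i \<phi> w f p y = of_real (half_ind (fst p)) * w (snd p) *
     f (snd p + fst p *\<^sub>R (y - snd p)) * of_real (y $ i - snd p $ i) * \<phi> y"

lemma fst_snd_measurable_borel [measurable]:
  "fst \<in> borel_measurable (borel :: ('a::second_countable_topology \<times> 'b::second_countable_topology) measure)"
  "snd \<in> borel_measurable (borel :: ('a::second_countable_topology \<times> 'b::second_countable_topology) measure)"
  by (simp_all add: borel_prod[symmetric])

lemma vec_nth_measurable_borel [measurable]:
  "(\<lambda>x::real^'n::finite. x $ i) \<in> borel_measurable borel"
  by (intro borel_measurable_continuous_onI continuous_intros)

text \<open>For fixed p = (t, x) the substitution z = x + t (y - x) turns the integral over z into
  one over y; Fubini puts the integrals in the right order. Joint integrability is proved in the
  variable z, where f can be cut off, and carried over by the same substitution applied to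
  norms.\<close>

lemma flux_duality:
  fixes \<phi> :: "real ^ 'n::finite \<Rightarrow> complex"
  assumes \<phi>: "\<phi> \<in> test_functions" and w: "w \<in> test_functions" and f: "locally_integrable f"
  shows integrable_seg_kernel: "integrable (lborel \<Otimes>\<^sub>M lborel) (\<lambda>(p, y). seg_kernel i \<phi> w f p y)"
    and integral_flux: "(\<integral>z. f z * flux i \<phi> w z \<partial>lborel) = (\<integral>p. (\<integral>y. seg_kernel i \<phi> w f p y \<partial>lborel) \<partial>lborel)"
proof -
  have [measurable]: "f \<in> borel_measurable borel" using f by (simp add: locally_integrable_def)
  note [measurable] = test_borel[OF \<phi>] test_borel[OF w] test_borel[OF test_coord_mult[OF \<phi>]]
    weight_measurable[OF test_borel[OF w]] weight_measurable[OF test_borel[OF test_coord_mult[OF w]]]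
  define K where "K p z = weight w p * coord_mult i \<phi> (dil p *\<^sub>R z + shift p)
     - weight (coord_mult i w) p * \<phi> (dil p *\<^sub>R z + shift p)" for p z
  have Kint: "integrable lborel (\<lambda>p. weight w p * h (dil p *\<^sub>R z + shift p))"
    if "w \<in> test_functions" "h \<in> test_functions" for w h :: "real ^ 'n \<Rightarrow> complex" and z
    by (rule integrable_average[where L = 2]) (auto intro!: integrable_weight_fun that simp: dil_bound)
  have flux: "flux i \<phi> w z = (\<integral>p. K p z \<partial>lborel)" for z
    unfolding flux_def K_def
    by (rule Bochner_Integration.integral_diff[symmetric]) (intro Kint \<phi> w test_coord_mult)+
  obtain r where r: "r > 0" "\<And>x. r \<le> norm x \<Longrightarrow> \<phi> x = 0" "\<And>x. r \<le> norm x \<Longrightarrow> w x = 0"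
    using test_common_support[OF \<phi> w] by blast
  have K0: "K p z = 0" if "r \<le> norm z" for p z
  proof -
    have "weight w p * coord_mult i \<phi> (dil p *\<^sub>R z + shift p) = 0"
      "weight (coord_mult i w) p * \<phi> (dil p *\<^sub>R z + shift p) = 0"
      by (rule weight_support[OF _ _ that]; simp add: r)+
    then show ?thesis by (simp only: K_def diff_self)
  qed
  have prod: "integrable (lborel \<Otimes>\<^sub>M lborel) (\<lambda>q. (weight w (fst q) * (of_real (indicator (ball 0 r) (snd q)) * f (snd q)))
        * h (dil (fst q) *\<^sub>R snd q + shift (fst q)))"
    if wh: "w \<in> test_functions" "h \<in> test_functions" for w h :: "real ^ 'n \<Rightarrow> complex"
  proof -
    note [measurable] = test_borel[OF wh(2)]
    obtain B where B: "\<And>x. norm (h x) \<le> B" using test_bounded[OF wh(2)] by blast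
    have "integrable (lborel \<Otimes>\<^sub>M lborel) (\<lambda>(p, z). weight w p * (of_real (indicator (ball 0 r) z) * f z))"
      using f by (intro lborel_pair.integrable_product integrable_weight_fun wh) (simp add: locally_integrable_def)
    then show ?thesis
      by (intro integrable_mult_bounded[OF _ _ B]) (auto simp: case_prod_beta')
  qed
  \<comment> \<open>As K vanishes outside the common ball, f may be multiplied by its indicator;
    local integrability then becomes integrability on the product space.\<close>
  have fK: "f (snd q) * K (fst q) (snd q) =
      (weight w (fst q) * (of_real (indicator (ball 0 r) (snd q)) * f (snd q)))
        * coord_mult i \<phi> (dil (fst q) *\<^sub>R snd q + shift (fst q))
      - (weight (coord_mult i w) (fst q) * (of_real (indicator (ball 0 r) (snd q)) * f (snd q)))
        * \<phi> (dil (fst q) *\<^sub>R snd q + shift (fst q))" for q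
  proof (cases "r \<le> norm (snd q)")
    case False
    then have "indicator (ball 0 r) (snd q) = (1::real)" by simp
    then show ?thesis unfolding K_def by (simp only: of_real_1 mult_1_left right_diff_distrib mult_ac)
  next
    case True
    then have "indicator (ball 0 r) (snd q) = (0::real)" by simp
    then show ?thesis using K0[OF True] by simp
  qed
  have joint: "integrable (lborel \<Otimes>\<^sub>M lborel) (\<lambda>q. f (snd q) * K (fst q) (snd q))"
    unfolding fK by (intro Bochner_Integration.integrable_diff prod \<phi> w test_coord_mult)
  have [measurable]: "(\<lambda>z. f z * K p z) \<in> borel_measurable borel" for p
    unfolding K_def by measurable
  have subst: "f ((1 - fst p) *\<^sub>R snd p + fst p *\<^sub>R y) * K p ((1 - fst p) *\<^sub>R snd p + fst p *\<^sub>R y)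
      = of_real (1 / fst p ^ CARD('n)) * seg_kernel i \<phi> w f p y" if "fst p \<in> {1/2..1}" for p y
  proof -
    let ?z = "(1 - fst p) *\<^sub>R snd p + fst p *\<^sub>R y"
    have z: "?z = snd p + fst p *\<^sub>R (y - snd p)" by (simp add: algebra_simps)
    have Y: "dil p *\<^sub>R ?z + shift p = y"
      unfolding dil_shift_eq z using that by (simp add: dil_def)
    have "K p ?z = weight w p * (of_real (y $ i - snd p $ i) * \<phi> y)"
      unfolding K_def weight_coord_mult Y by (simp add: algebra_simps)
    then show ?thesis
      unfolding seg_kernel_def z[symmetric] using that by (simp add: weight_def)
  qed
  have nz: "K p z = 0" "seg_kernel i \<phi> w f p z = 0" if "fst p \<notin> {1/2..1}" for p z
    using that by (simp_all add: K_def weight_def seg_kernel_def half_ind_def)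
  have c: "(\<integral>z. f z * K p z \<partial>lborel) = (\<integral>y. seg_kernel i \<phi> w f p y \<partial>lborel)" for p
  proof (cases "fst p \<in> {1/2..1}")
    case True
    then have "fst p \<noteq> 0" by auto
    then have "(\<integral>z. f z * K p z \<partial>lborel) = \<bar>fst p\<bar> ^ CARD('n) *\<^sub>R
        (\<integral>y. of_real (1 / fst p ^ CARD('n)) * seg_kernel i \<phi> w f p y \<partial>lborel)"
      using lborel_integral_affine[of "\<lambda>z. f z * K p z" "fst p" "(1 - fst p) *\<^sub>R snd p", unfolded subst[OF True]]
      by simp
    with True show ?thesis by (simp add: scaleR_conv_of_real[where 'a = complex])
  qed (simp add: nz)
  have cn: "(\<integral>\<^sup>+z. norm (f z * K p z) \<partial>lborel) = (\<integral>\<^sup>+y. norm (seg_kernel i \<phi> w f p y) \<partial>lborel)" for p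
  proof (cases "fst p \<in> {1/2..1}")
    case True
    then have "fst p \<noteq> 0" by auto
    then have "(\<integral>\<^sup>+z. norm (f z * K p z) \<partial>lborel) = ennreal (\<bar>fst p\<bar> ^ CARD('n)) *
        (\<integral>\<^sup>+y. norm (of_real (1 / fst p ^ CARD('n)) * seg_kernel i \<phi> w f p y) \<partial>lborel)"
      using lborel_nn_integral_affine[of "\<lambda>z. norm (f z * K p z)" "fst p" "(1 - fst p) *\<^sub>R snd p", unfolded subst[OF True]]
      by simp
    also have "\<dots> = (\<integral>\<^sup>+y. ennreal (\<bar>fst p\<bar> ^ CARD('n)) * norm (of_real (1 / fst p ^ CARD('n)) * seg_kernel i \<phi> w f p y) \<partial>lborel)"
      by (rule nn_integral_cmult[symmetric]) (simp add: seg_kernel_def)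
    also have "\<dots> = (\<integral>\<^sup>+y. norm (seg_kernel i \<phi> w f p y) \<partial>lborel)"
      using True by (intro nn_integral_cong) (simp add: norm_mult norm_divide norm_power ennreal_mult[symmetric])
    finally show ?thesis .
  qed (simp add: nz)
  have meas: "(\<lambda>(p, y). seg_kernel i \<phi> w f p y) \<in> borel_measurable (lborel \<Otimes>\<^sub>M lborel)"
    unfolding seg_kernel_def by measurable
  show "integrable (lborel \<Otimes>\<^sub>M lborel) (\<lambda>(p, y). seg_kernel i \<phi> w f p y)"
  proof (rule integrableI_bounded[OF meas])
    have "(\<integral>\<^sup>+q. norm (case q of (p, y) \<Rightarrow> seg_kernel i \<phi> w f p y) \<partial>(lborel \<Otimes>\<^sub>M lborel))
        = (\<integral>\<^sup>+p. \<integral>\<^sup>+y. norm (seg_kernel i \<phi> w f p y) \<partial>lborel \<partial>lborel)"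
      using meas by (subst lborel.nn_integral_fst[symmetric]) (simp_all add: case_prod_beta')
    also have "\<dots> = (\<integral>\<^sup>+p. \<integral>\<^sup>+z. norm (f z * K p z) \<partial>lborel \<partial>lborel)"
      by (simp only: cn)
    also have "\<dots> = (\<integral>\<^sup>+q. norm (f (snd q) * K (fst q) (snd q)) \<partial>(lborel \<Otimes>\<^sub>M lborel))"
      using borel_measurable_integrable[OF joint] by (subst lborel.nn_integral_fst[symmetric]) simp_all
    also have "\<dots> < \<infinity>" using joint by (simp add: integrable_iff_bounded)
    finally show "(\<integral>\<^sup>+q. norm (case q of (p, y) \<Rightarrow> seg_kernel i \<phi> w f p y) \<partial>(lborel \<Otimes>\<^sub>M lborel)) < \<infinity>" .
  qed
  have "(\<integral>z. f z * flux i \<phi> w z \<partial>lborel) = (\<integral>z. (\<integral>p. f z * K p z \<partial>lborel) \<partial>lborel)"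
    unfolding flux by simp
  also have "\<dots> = (\<integral>p. (\<integral>z. f z * K p z \<partial>lborel) \<partial>lborel)"
    using joint by (intro lborel_pair.Fubini_integral) (simp add: case_prod_beta')
  also have "\<dots> = (\<integral>p. (\<integral>y. seg_kernel i \<phi> w f p y \<partial>lborel) \<partial>lborel)"
    by (simp only: c)
  finally show "(\<integral>z. f z * flux i \<phi> w z \<partial>lborel) = (\<integral>p. (\<integral>y. seg_kernel i \<phi> w f p y \<partial>lborel) \<partial>lborel)" .
qed


lemma norm_integral_le_nn_integral:
  fixes f :: "'a \<Rightarrow> 'b::{banach, second_countable_topology}"
  shows "ennreal (norm (\<integral>x. f x \<partial>M)) \<le> (\<integral>\<^sup>+x. norm (f x) \<partial>M)"
  by (cases "integrable M f") (auto intro: integral_norm_bound_ennreal simp: not_integrable_integral_eq)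

text \<open>Taking values in \<open>ennreal\<close>, it makes sense for every y, whether or not f is
  integrable along the segments. It covers the full segment and so dominates both
  half-fluxes.\<close>

definition seg_avg :: "(real ^ 'n \<Rightarrow> complex) \<Rightarrow> (real ^ 'n \<Rightarrow> complex) \<Rightarrow> real ^ 'n::finite \<Rightarrow> ennreal" where
  "seg_avg w f y = (\<integral>\<^sup>+t. (\<integral>\<^sup>+x. indicator {0<..1::real} t *
     ennreal (norm (w x) * norm (f (x + t *\<^sub>R (y - x))) * norm (y - x)) \<partial>lborel) \<partial>lborel)"

text \<open>At t = 0 the second inequality would fail, since \<open>half_ind 1\<close> is 1; later
  this point is removed as a null set.\<close>

lemma half_ind_le:
  "half_ind t \<le> indicator {0<..1} t" "t \<noteq> 0 \<Longrightarrow> half_ind (1 - t) \<le> indicator {0<..1} t" "0 \<le> half_ind t"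
  by (auto simp: half_ind_def indicator_def)

lemma linear_functional_sum:
  assumes add: "\<And>\<phi> \<psi>. \<phi> \<in> test_functions \<Longrightarrow> \<psi> \<in> test_functions \<Longrightarrow> v (\<lambda>x. \<phi> x + \<psi> x) = v \<phi> + v \<psi>"
    and scale: "\<And>c \<phi>. \<phi> \<in> test_functions \<Longrightarrow> v (\<lambda>x. c * \<phi> x) = c * v \<phi>"
    and h: "\<And>i. h i \<in> test_functions"
  shows "v (\<lambda>x. \<Sum>i\<in>I. h i x) = (\<Sum>i\<in>I. v (h i :: real ^ 'n::finite \<Rightarrow> complex) :: complex)"
proof -
  have "v (\<lambda>x. 0) = 0" using scale[OF test_zero, of 0] by simp
  then show ?thesis
    by (induction I rule: infinite_finite_induct) (simp_all add: add h test_sum)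
qed

text \<open>Applying v to \<open>flux_symmetric\<close>, with \<integral>w = 1, expresses v \<phi>
  as (\<integral>\<phi>) v w plus the fluxes of (\<phi>, w) minus those of (w, \<phi>), each paired
  with the f i. Duality rewrites the pairings as integrals of \<open>G1\<close> and
  \<open>G2\<close> against \<phi>, and C is the norm of v w.\<close>

lemma representation:
  fixes v :: "(real ^ 'n::finite \<Rightarrow> complex) \<Rightarrow> complex" and f :: "'n \<Rightarrow> real ^ 'n \<Rightarrow> complex"
  assumes w: "w \<in> test_functions" "(\<integral>x. w x \<partial>lborel) = 1"
    and f: "\<And>i. locally_integrable (f i)"
    and add: "\<And>\<phi> \<psi>. \<phi> \<in> test_functions \<Longrightarrow> \<psi> \<in> test_functions \<Longrightarrow> v (\<lambda>x. \<phi> x + \<psi> x) = v \<phi> + v \<psi>"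
    and scale: "\<And>c \<phi>. \<phi> \<in> test_functions \<Longrightarrow> v (\<lambda>x. c * \<phi> x) = c * v \<phi>"
    and deriv: "\<And>i \<phi>. \<phi> \<in> test_functions \<Longrightarrow> v (partial_deriv i \<phi>) = - (\<integral>z. f i z * \<phi> z \<partial>lborel)"
  obtains g C where "g \<in> borel_measurable borel" "C \<ge> 0"
    "\<And>y. ennreal (norm (g y)) \<le> ennreal C + 2 * (\<Sum>i\<in>UNIV. seg_avg w (f i) y)"
    "\<And>\<phi>. \<phi> \<in> test_functions \<Longrightarrow> v \<phi> = (\<integral>y. g y * \<phi> y \<partial>lborel)"
proof -
  have [measurable]: "f i \<in> borel_measurable borel" for i using f by (simp add: locally_integrable_def)
  note [measurable] = test_borel[OF w(1)]
  \<comment> \<open>In \<open>S1\<close> the segment starts at x, weighted by w, and y is its end.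
    In \<open>S2\<close>, where \<phi> and w are exchanged, it starts at y, and x is integrated
    before t.\<close>
  define S1 where "S1 i p y = of_real (half_ind (fst p)) * w (snd p) *
     f i (snd p + fst p *\<^sub>R (y - snd p)) * of_real (y $ i - snd p $ i)" for i p y
  define S2 where "S2 i t y x = of_real (half_ind t) * f i (y + t *\<^sub>R (x - y)) * of_real (x $ i - y $ i) * w x" for i t y x
  define G1 where "G1 i y = (\<integral>p. S1 i p y \<partial>lborel)" for i y
  define G2 where "G2 i y = (\<integral>t. (\<integral>x. S2 i t y x \<partial>lborel) \<partial>lborel)" for i y
  have [measurable]: "G1 i \<in> borel_measurable borel" "G2 i \<in> borel_measurable borel" for i
    unfolding G1_def[abs_def] G2_def[abs_def] S1_def S2_def by measurable
  let ?g = "\<lambda>y. v w + (\<Sum>i\<in>UNIV. G1 i y - G2 i y)"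
  have G1: "ennreal (norm (G1 i y)) \<le> seg_avg w (f i) y" for i y
  proof -
    have "ennreal (norm (G1 i y)) \<le> (\<integral>\<^sup>+p. norm (S1 i p y) \<partial>lborel)"
      unfolding G1_def by (rule norm_integral_le_nn_integral)
    also have "\<dots> = (\<integral>\<^sup>+t. (\<integral>\<^sup>+x. norm (S1 i (t, x) y) \<partial>lborel) \<partial>lborel)"
      unfolding lborel_prod_eq by (rule lborel.nn_integral_fst[symmetric]) (simp add: S1_def)
    also have "\<dots> \<le> seg_avg w (f i) y"
      unfolding seg_avg_def
    proof (intro nn_integral_mono)
      fix t :: real and x :: "real^'n"
      have "norm (S1 i (t, x) y) = half_ind t * (norm (w x) * norm (f i (x + t *\<^sub>R (y - x))) * \<bar>(y - x) $ i\<bar>)"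
        using half_ind_le(3)[of t] by (simp add: S1_def norm_mult flip: of_real_diff)
      also have "\<dots> \<le> indicator {0<..1} t * (norm (w x) * norm (f i (x + t *\<^sub>R (y - x))) * norm (y - x))"
        using half_ind_le[of t] component_le_norm_cart[of "y - x" i] by (intro mult_mono mult_left_mono) auto
      finally show "ennreal (norm (S1 i (t, x) y)) \<le> indicator {0<..1} t * ennreal (norm (w x) * norm (f i (x + t *\<^sub>R (y - x))) * norm (y - x))"
        by (auto simp: indicator_def intro: ennreal_leI split: if_splits)
    qed
    finally show ?thesis .
  qed
  have G2: "ennreal (norm (G2 i y)) \<le> seg_avg w (f i) y" for i y
  proof -
    have "ennreal (norm (G2 i y)) \<le> (\<integral>\<^sup>+t. norm (\<integral>x. S2 i t y x \<partial>lborel) \<partial>lborel)"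
      unfolding G2_def by (rule norm_integral_le_nn_integral)
    also have "\<dots> \<le> (\<integral>\<^sup>+t. (\<integral>\<^sup>+x. norm (S2 i t y x) \<partial>lborel) \<partial>lborel)"
      by (intro nn_integral_mono norm_integral_le_nn_integral)
    \<comment> \<open>Reversing t makes this segment run from x to y as well;
      \<open>half_ind (1 - t)\<close> then covers the part t \<le> 1/2 of
      \<open>seg_avg\<close>.\<close>
    also have "\<dots> = (\<integral>\<^sup>+t. (\<integral>\<^sup>+x. norm (S2 i (1 - t) y x) \<partial>lborel) \<partial>lborel)"
      by (subst nn_integral_real_affine[where c = "-1" and t = 1]) (simp_all add: S2_def)
    also have "\<dots> \<le> seg_avg w (f i) y"
      unfolding seg_avg_def
    proof (rule nn_integral_mono_AE, rule AE_mp[OF AE_lborel_singleton[of 0]], intro AE_I2 impI nn_integral_mono)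
      fix t :: real and x :: "real^'n"
      assume t: "t \<noteq> 0"
      have *: "y + (1 - t) *\<^sub>R (x - y) = x + t *\<^sub>R (y - x)" by (simp add: algebra_simps)
      have "norm (S2 i (1 - t) y x) = half_ind (1 - t) * (norm (w x) * norm (f i (x + t *\<^sub>R (y - x))) * \<bar>(x - y) $ i\<bar>)"
        using half_ind_le(3)[of "1 - t"] by (simp add: S2_def * norm_mult flip: of_real_diff)
      also have "\<dots> \<le> indicator {0<..1} t * (norm (w x) * norm (f i (x + t *\<^sub>R (y - x))) * norm (x - y))"
        using half_ind_le(2)[OF t] half_ind_le(3)[of "1 - t"] component_le_norm_cart[of "x - y" i] by (intro mult_mono mult_left_mono) auto
      finally show "ennreal (norm (S2 i (1 - t) y x)) \<le> indicator {0<..1} t * ennreal (norm (w x) * norm (f i (x + t *\<^sub>R (y - x))) * norm (y - x))"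
        by (auto simp: indicator_def norm_minus_commute intro: ennreal_leI split: if_splits)
    qed
    finally show ?thesis .
  qed
  show ?thesis
  proof (rule that[of ?g "norm (v w)"])
    fix y
    have "ennreal (norm (?g y)) \<le> ennreal (norm (v w) + (\<Sum>i\<in>UNIV. norm (G1 i y) + norm (G2 i y)))"
      by (intro ennreal_leI order_trans[OF norm_triangle_ineq] add_left_mono order_trans[OF norm_sum] sum_mono norm_triangle_ineq4)
    also have "\<dots> = ennreal (norm (v w)) + (\<Sum>i\<in>UNIV. ennreal (norm (G1 i y)) + ennreal (norm (G2 i y)))"
      by (simp add: ennreal_plus sum_nonneg sum_ennreal[symmetric] del: sum_ennreal)
    also have "\<dots> \<le> ennreal (norm (v w)) + (\<Sum>i\<in>UNIV. seg_avg w (f i) y + seg_avg w (f i) y)"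
      by (intro add_left_mono sum_mono add_mono G1 G2)
    finally show "ennreal (norm (?g y)) \<le> ennreal (norm (v w)) + 2 * (\<Sum>i\<in>UNIV. seg_avg w (f i) y)"
      by (simp add: sum.distrib mult_2)
  next
    fix \<phi> :: "real^'n \<Rightarrow> complex" assume \<phi>: "\<phi> \<in> test_functions"
    have D: "(\<lambda>z. \<Sum>i\<in>UNIV. partial_deriv i (flux i \<phi>' w') z) \<in> test_functions"
      "v (\<lambda>z. \<Sum>i\<in>UNIV. partial_deriv i (flux i \<phi>' w') z) = - (\<Sum>i\<in>UNIV. (\<integral>z. f i z * flux i \<phi>' w' z \<partial>lborel))"
      if "\<phi>' \<in> test_functions" "w' \<in> test_functions" for \<phi>' w'
    proof -
      have T: "flux i \<phi>' w' \<in> test_functions" for i using that by (rule flux_test)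
      show "(\<lambda>z. \<Sum>i\<in>UNIV. partial_deriv i (flux i \<phi>' w') z) \<in> test_functions"
        by (intro test_sum test_partial_deriv T)
      show "v (\<lambda>z. \<Sum>i\<in>UNIV. partial_deriv i (flux i \<phi>' w') z) = - (\<Sum>i\<in>UNIV. (\<integral>z. f i z * flux i \<phi>' w' z \<partial>lborel))"
        unfolding sum_negf[symmetric] deriv[OF T, symmetric]
        by (rule linear_functional_sum) (rule add scale test_partial_deriv[OF T] | assumption)+
    qed
    have "v (\<lambda>z. (\<integral>x. w x \<partial>lborel) * \<phi> z + (\<Sum>i\<in>UNIV. partial_deriv i (flux i \<phi> w) z))
      = v (\<lambda>z. (\<integral>x. \<phi> x \<partial>lborel) * w z + (\<Sum>i\<in>UNIV. partial_deriv i (flux i w \<phi>) z))"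
      by (simp only: flux_symmetric[OF \<phi> w(1)])
    then have "v \<phi> - (\<Sum>i\<in>UNIV. (\<integral>z. f i z * flux i \<phi> w z \<partial>lborel))
       = (\<integral>x. \<phi> x \<partial>lborel) * v w - (\<Sum>i\<in>UNIV. (\<integral>z. f i z * flux i w \<phi> z \<partial>lborel))"
      unfolding add[OF test_cmult[OF \<phi>] D(1)[OF \<phi> w(1)]] add[OF test_cmult[OF w(1)] D(1)[OF w(1) \<phi>]]
        scale[OF \<phi>] scale[OF w(1)] D(2)[OF \<phi> w(1)] D(2)[OF w(1) \<phi>] w(2)
      by simp
    then have v: "v \<phi> = (\<integral>y. v w * \<phi> y \<partial>lborel) +
        (\<Sum>i\<in>UNIV. (\<integral>z. f i z * flux i \<phi> w z \<partial>lborel) - (\<integral>z. f i z * flux i w \<phi> z \<partial>lborel))"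
      by (simp add: sum_subtractf algebra_simps)
    have F1: "integrable lborel (\<lambda>y. G1 i y * \<phi> y)"
      "(\<integral>z. f i z * flux i \<phi> w z \<partial>lborel) = (\<integral>y. G1 i y * \<phi> y \<partial>lborel)" for i
    proof -
      have eq: "seg_kernel i \<phi> w (f i) p y = S1 i p y * \<phi> y" for p y
        by (simp add: seg_kernel_def S1_def)
      note int = integrable_seg_kernel[OF \<phi> w(1) f[of i], where i = i, unfolded eq]
      show "integrable lborel (\<lambda>y. G1 i y * \<phi> y)"
        using lborel_pair.integrable_snd[OF int] by (simp add: G1_def)
      show "(\<integral>z. f i z * flux i \<phi> w z \<partial>lborel) = (\<integral>y. G1 i y * \<phi> y \<partial>lborel)"
        unfolding integral_flux[OF \<phi> w(1) f] eq
        using lborel_pair.Fubini_integral[OF int] by (simp add: G1_def)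
    qed
    have F2: "integrable lborel (\<lambda>y. G2 i y * \<phi> y)"
      "(\<integral>z. f i z * flux i w \<phi> z \<partial>lborel) = (\<integral>y. G2 i y * \<phi> y \<partial>lborel)" for i
    proof -
      have eq: "seg_kernel i w \<phi> (f i) p x = S2 i (fst p) (snd p) x * \<phi> (snd p)" for p x
        by (simp add: seg_kernel_def S2_def)
      note int = integrable_seg_kernel[OF w(1) \<phi> f[of i], where i = i, unfolded eq]
      \<comment> \<open>The joint integral runs over ((t, y), x). Once x is integrated out, t and y
        can be separated, and t is integrated for fixed y.\<close>
      have "integrable lborel (\<lambda>p. (\<integral>x. S2 i (fst p) (snd p) x \<partial>lborel) * \<phi> (snd p))"
        using lborel_pair.integrable_fst[OF int] by simp
      then have int2: "integrable (lborel \<Otimes>\<^sub>M lborel) (\<lambda>(t, y). (\<integral>x. S2 i t y x \<partial>lborel) * \<phi> y)"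
        by (simp add: lborel_prod case_prod_beta')
      show "integrable lborel (\<lambda>y. G2 i y * \<phi> y)"
        using lborel_pair.integrable_snd[OF int2] by (simp add: G2_def)
      have "(\<integral>z. f i z * flux i w \<phi> z \<partial>lborel) = (\<integral>p. (\<integral>x. S2 i (fst p) (snd p) x \<partial>lborel) * \<phi> (snd p) \<partial>lborel)"
        unfolding integral_flux[OF w(1) \<phi> f] eq by simp
      also have "\<dots> = (\<integral>(t, y). (\<integral>x. S2 i t y x \<partial>lborel) * \<phi> y \<partial>(lborel \<Otimes>\<^sub>M lborel))"
        by (simp add: lborel_prod case_prod_beta')
      also have "\<dots> = (\<integral>y. G2 i y * \<phi> y \<partial>lborel)"
        using lborel_pair.integral_snd[OF int2] by (simp add: G2_def)
      finally show "(\<integral>z. f i z * flux i w \<phi> z \<partial>lborel) = (\<integral>y. G2 i y * \<phi> y \<partial>lborel)" .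
    qed
    have "v \<phi> = (\<integral>y. v w * \<phi> y + (\<Sum>i\<in>UNIV. G1 i y * \<phi> y - G2 i y * \<phi> y) \<partial>lborel)"
      unfolding v using test_integrable[OF \<phi>] F1(1) F2(1)
      by (simp add: F1(2) F2(2))
    then show "v \<phi> = (\<integral>y. ?g y * \<phi> y \<partial>lborel)"
      by (simp add: distrib_right left_diff_distrib sum_distrib_right)
  qed simp_all
qed

section \<open>Growth estimates\<close>

text \<open>The graph of x^p lies above its tangent at a. The terms are arranged so that none is
  negative and the inequality can be read in \<open>ennreal\<close>.\<close>

lemma powr_tangent:
  fixes a x p :: real
  assumes "1 \<le> p" "0 \<le> a" "0 \<le> x"
  shows "a powr p + p * a powr (p - 1) * x \<le> x powr p + p * a powr p"
proof (cases "p = 1 \<or> a = 0")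
  case False
  then have p: "p > 1" and a: "a > 0" using assms by auto
  have q: "p / (p - 1) > 1" "1 / p + 1 / (p / (p - 1)) = 1"
    using p by (auto simp: field_simps)
  have "x * a powr (p - 1) \<le> x powr p / p + (a powr (p - 1)) powr (p / (p - 1)) / (p / (p - 1))"
    by (rule Youngs_inequality[OF p q assms(3)]) simp
  also have "(a powr (p - 1)) powr (p / (p - 1)) = a powr p"
    using p by (simp add: powr_powr)
  finally show ?thesis using p by (simp add: field_simps)
qed (use assms in auto)

text \<open>Jensen's inequality in a form that needs neither integrability nor powers of \<^typ>\<open>ennreal\<close>.\<close>

lemma nn_integral_jensen:
  fixes X :: "'a \<Rightarrow> real"
  assumes prob: "emeasure M (space M) = 1" and [measurable]: "X \<in> borel_measurable M" and X: "\<And>x. X x \<ge> 0"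
    and p: "1 \<le> p" and a: "0 \<le> a" and le: "ennreal a \<le> (\<integral>\<^sup>+x. ennreal (X x) \<partial>M)"
  shows "ennreal (a powr p) \<le> (\<integral>\<^sup>+x. ennreal (X x powr p) \<partial>M)"
proof -
  have aa: "a powr (p - 1) * a = a powr p"
    using a p by (cases "a = 0") (simp_all add: powr_diff)
  \<comment> \<open>The finite term p a^p is carried on both sides and cancelled at the end, which
    avoids subtraction in \<open>ennreal\<close>.\<close>
  have "ennreal (a powr p) + ennreal (p * a powr p) = ennreal (a powr p) + ennreal (p * a powr (p - 1)) * ennreal a"
    using a p by (simp add: aa[symmetric] ennreal_mult[symmetric] mult.assoc)
  also have "\<dots> \<le> ennreal (a powr p) + ennreal (p * a powr (p - 1)) * (\<integral>\<^sup>+x. ennreal (X x) \<partial>M)"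
    by (intro add_left_mono mult_left_mono le) simp
  also have "\<dots> = (\<integral>\<^sup>+x. ennreal (a powr p) + ennreal (p * a powr (p - 1)) * ennreal (X x) \<partial>M)"
    by (simp add: nn_integral_add nn_integral_cmult prob)
  also have "\<dots> \<le> (\<integral>\<^sup>+x. ennreal (X x powr p) + ennreal (p * a powr p) \<partial>M)"
  proof (rule nn_integral_mono)
    fix x
    show "ennreal (a powr p) + ennreal (p * a powr (p - 1)) * ennreal (X x) \<le> ennreal (X x powr p) + ennreal (p * a powr p)"
      using powr_tangent[OF p a X[of x]] p X[of x]
      by (simp add: ennreal_mult[symmetric] ennreal_plus[symmetric] del: ennreal_plus)
  qed
  also have "\<dots> = (\<integral>\<^sup>+x. ennreal (X x powr p) \<partial>M) + ennreal (p * a powr p)"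
    by (simp add: nn_integral_add prob)
  finally show ?thesis by (metis add.commute ennreal_add_left_cancel_le ennreal_neq_top infinity_ennreal_def)
qed

lemma nn_integral_powr_unit:
  assumes "c > -1"
  shows "(\<integral>\<^sup>+t. indicator {0<..1} t * ennreal (t powr c) \<partial>lborel) = ennreal (1 / (c + 1))"
proof -
  have "(\<integral>\<^sup>+t. indicator {0<..1} t * ennreal (t powr c) \<partial>lborel) = (\<integral>\<^sup>+t. ennreal (t powr c) * indicator {0..1} t \<partial>lborel)"
    by (rule nn_integral_cong_AE, rule AE_mp[OF AE_lborel_singleton[of 0]], rule AE_I2)
       (auto simp: indicator_def)
  also have "\<dots> = ennreal (1 powr (c + 1) / (c + 1))"
    by (rule nn_integral_has_integral_lebesgue'[OF _ has_integral_powr_from_0]) (use assms in auto)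
  finally show ?thesis by simp
qed

text \<open>Jensen's inequality for the probability density \<open>(1 - b) t\<^sup>-\<^sup>b W(x)\<close>. The weight in \<open>t\<close> is what makes
  all exponents \<open>s > -1\<close> accessible.\<close>

lemma seg_jensen:
  fixes f W :: "real ^ 'n::finite \<Rightarrow> real"
  assumes [measurable]: "f \<in> borel_measurable borel" "W \<in> borel_measurable borel"
    and f: "\<And>x. f x \<ge> 0" and W: "\<And>x. W x \<ge> 0" "(\<integral>\<^sup>+x. ennreal (W x) \<partial>lborel) = 1"
    and b: "0 \<le> b" "b < 1" and p: "1 \<le> p" and a: "0 \<le> a"
    and le: "ennreal a \<le> (\<integral>\<^sup>+t. (\<integral>\<^sup>+x. indicator {0<..1} t * ennreal (W x * f (x + t *\<^sub>R (y - x))) \<partial>lborel) \<partial>lborel)"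
  shows "ennreal (a powr p) \<le> ennreal ((1 - b) powr (1 - p)) *
    (\<integral>\<^sup>+t. indicator {0<..1} t * ennreal (t powr (b * (p - 1))) *
      (\<integral>\<^sup>+x. ennreal (W x) * ennreal (f (x + t *\<^sub>R (y - x)) powr p) \<partial>lborel) \<partial>lborel)"
proof -
  define d where "d q = indicator {0<..1} (fst q) * ennreal ((1 - b) * fst q powr (- b)) * ennreal (W (snd q))" for q
  define M where "M = density (lborel \<Otimes>\<^sub>M lborel) d"
  have [measurable]: "d \<in> borel_measurable (lborel \<Otimes>\<^sub>M lborel)" unfolding d_def by measurable
  \<comment> \<open>X is the integrand divided by the density in t, so its mean under M is the given
    average. Its p-th power carries t^(bp) (1 - b)^(-p), and the density reduces these exponents to
    b (p - 1) and 1 - p.\<close>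
  define X where "X q = fst q powr b / (1 - b) * f (snd q + fst q *\<^sub>R (y - snd q))" for q
  have [measurable]: "X \<in> borel_measurable (lborel \<Otimes>\<^sub>M lborel)" unfolding X_def by measurable
  have "emeasure M (space M) = (\<integral>\<^sup>+q. d q \<partial>(lborel \<Otimes>\<^sub>M lborel))"
    unfolding M_def space_density by (subst emeasure_density[OF _ sets.top]) (auto intro!: nn_integral_cong)
  also have "\<dots> = (\<integral>\<^sup>+t. (\<integral>\<^sup>+x. d (t, x) \<partial>lborel) \<partial>lborel)"
    by (rule lborel.nn_integral_fst[symmetric]) simp
  also have "\<dots> = ennreal (1 - b) * (\<integral>\<^sup>+t. indicator {0<..1} t * ennreal (t powr (- b)) \<partial>lborel)"
    using b by (simp add: d_def nn_integral_cmult W(2) ennreal_mult) (simp add: mult.left_commute nn_integral_cmult)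
  also have "\<dots> = ennreal (1 - b) * ennreal (1 / (- b + 1))"
    using b by (simp add: nn_integral_powr_unit)
  also have "\<dots> = 1" using b by (simp add: ennreal_mult[symmetric])
  finally have prob: "emeasure M (space M) = 1" .
  have XM: "(\<integral>\<^sup>+q. ennreal (X q powr r) \<partial>M) = (\<integral>\<^sup>+t. (\<integral>\<^sup>+x. d (t, x) * ennreal (X (t, x) powr r) \<partial>lborel) \<partial>lborel)" for r
    unfolding M_def by (subst nn_integral_density) (simp_all add: lborel.nn_integral_fst[symmetric])
  have X0: "X q \<ge> 0" for q using b f by (simp add: X_def)
  have "ennreal a \<le> (\<integral>\<^sup>+q. ennreal (X q powr 1) \<partial>M)"
    unfolding XM
  proof (rule order_trans[OF le], intro nn_integral_mono)
    fix t :: real and x :: "real ^ 'n"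
    show "indicator {0<..1} t * ennreal (W x * f (x + t *\<^sub>R (y - x))) \<le> d (t, x) * ennreal (X (t, x) powr 1)"
    proof (cases "t \<in> {0<..1}")
      case True
      then have "(1 - b) * t powr (- b) * W x * (t powr b / (1 - b) * f (x + t *\<^sub>R (y - x))) = W x * f (x + t *\<^sub>R (y - x))"
        using b by (simp add: powr_minus field_simps)
      moreover have "d (t, x) * ennreal (X (t, x) powr 1) = ennreal ((1 - b) * t powr (- b) * W x * (t powr b / (1 - b) * f (x + t *\<^sub>R (y - x))))"
        using True b W(1)[of x] f[of "x + t *\<^sub>R (y - x)"]
        by (simp add: d_def X_def ennreal_mult[symmetric] mult_ac)
      ultimately show ?thesis using True by simp
    qed simp
  qed
  also have "\<dots> = (\<integral>\<^sup>+q. ennreal (X q) \<partial>M)" using X0 by simp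
  finally have "ennreal (a powr p) \<le> (\<integral>\<^sup>+q. ennreal (X q powr p) \<partial>M)"
    by (intro nn_integral_jensen[OF prob _ X0 p a]) (simp_all add: M_def)
  also have "\<dots> = (\<integral>\<^sup>+t. (\<integral>\<^sup>+x. ennreal ((1 - b) powr (1 - p)) * (indicator {0<..1} t * ennreal (t powr (b * (p - 1))) *
      (ennreal (W x) * ennreal (f (x + t *\<^sub>R (y - x)) powr p))) \<partial>lborel) \<partial>lborel)"
    unfolding XM
  proof (intro nn_integral_cong)
    fix t :: real and x :: "real ^ 'n"
    show "d (t, x) * ennreal (X (t, x) powr p) = ennreal ((1 - b) powr (1 - p)) * (indicator {0<..1} t * ennreal (t powr (b * (p - 1))) *
      (ennreal (W x) * ennreal (f (x + t *\<^sub>R (y - x)) powr p)))"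
    proof (cases "t \<in> {0<..1}")
      case True
      have "(1 - b) * t powr (- b) * W x * (t powr b / (1 - b) * f (x + t *\<^sub>R (y - x))) powr p
          = ((1 - b) * (1 - b) powr (- p)) * (t powr (- b) * t powr (b * p)) * (W x * f (x + t *\<^sub>R (y - x)) powr p)"
        using b f True by (simp add: powr_mult powr_divide powr_powr powr_minus field_simps)
      also have "(1 - b) * (1 - b) powr (- p) = (1 - b) powr (1 - p)"
        using b by (simp add: powr_diff powr_minus field_simps)
      also have "t powr (- b) * t powr (b * p) = t powr (b * (p - 1))"
        by (simp add: powr_add[symmetric] algebra_simps)
      finally show ?thesis
        using True b W(1)[of x] by (simp add: d_def X_def ennreal_mult[symmetric] mult_ac)
    qed (simp add: d_def)
  qed
  also have "\<dots> = (\<integral>\<^sup>+t. ennreal ((1 - b) powr (1 - p)) * (indicator {0<..1} t * ennreal (t powr (b * (p - 1))) *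
      (\<integral>\<^sup>+x. ennreal (W x) * ennreal (f (x + t *\<^sub>R (y - x)) powr p) \<partial>lborel)) \<partial>lborel)"
    by (simp add: nn_integral_cmult)
  also have "\<dots> = ennreal ((1 - b) powr (1 - p)) *
    (\<integral>\<^sup>+t. indicator {0<..1} t * ennreal (t powr (b * (p - 1))) *
      (\<integral>\<^sup>+x. ennreal (W x) * ennreal (f (x + t *\<^sub>R (y - x)) powr p) \<partial>lborel) \<partial>lborel)"
    by (rule nn_integral_cmult) measurable
  finally show ?thesis .
qed

section \<open>Scaling of averages over balls\<close>

lemma ball_borel [measurable]: "ball a r \<in> sets borel"
  by simp

definition ball_int :: "(real ^ 'n::finite \<Rightarrow> ennreal) \<Rightarrow> real \<Rightarrow> ennreal" where
  "ball_int F r = (\<integral>\<^sup>+x. indicator (ball 0 r) x * F x \<partial>lborel)"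

lemma ball_int_affine:
  fixes F :: "real ^ 'n::finite \<Rightarrow> ennreal"
  assumes [measurable]: "F \<in> borel_measurable borel" and t: "t > 0"
  shows "(\<integral>\<^sup>+y. indicator (ball 0 r) (T + t *\<^sub>R y) * F (T + t *\<^sub>R y) \<partial>lborel) = ennreal (t powr (- real CARD('n))) * ball_int F r"
proof -
  have "ball_int F r = ennreal (t ^ CARD('n)) * (\<integral>\<^sup>+y. indicator (ball 0 r) (T + t *\<^sub>R y) * F (T + t *\<^sub>R y) \<partial>lborel)"
    unfolding ball_int_def using t by (subst lborel_nn_integral_affine[where c = t and T = T]) auto
  then show ?thesis
    using t by (simp add: mult.assoc[symmetric] ennreal_mult[symmetric] powr_minus powr_realpow)
qed

text \<open>For fixed x, the substitution in y maps the ball of radius R into the ball of radius 1 +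
  t (R + 1) and costs t^(-N). If t R is not small, this radius is comparable with t R, and t^(-N) is
  balanced by the volume of the smaller ball.\<close>

lemma seg_ball_far:
  fixes F :: "real ^ 'n::finite \<Rightarrow> ennreal"
  assumes [measurable]: "F \<in> borel_measurable borel" "W \<in> borel_measurable borel"
    and W: "\<And>x. 1 \<le> norm x \<Longrightarrow> W x = 0" "(\<integral>\<^sup>+x. W x \<partial>lborel) = 1"
    and t: "0 < t" "t \<le> 1"
  shows "(\<integral>\<^sup>+y. indicator (ball 0 R) y * (\<integral>\<^sup>+x. W x * F (x + t *\<^sub>R (y - x)) \<partial>lborel) \<partial>lborel)
    \<le> ennreal (t powr (- real CARD('n))) * ball_int F (1 + t * (R + 1))"
proof -
  have "(\<integral>\<^sup>+y. indicator (ball 0 R) y * (\<integral>\<^sup>+x. W x * F (x + t *\<^sub>R (y - x)) \<partial>lborel) \<partial>lborel)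
      = (\<integral>\<^sup>+y. (\<integral>\<^sup>+x. indicator (ball 0 R) y * (W x * F (x + t *\<^sub>R (y - x))) \<partial>lborel) \<partial>lborel)"
    by (simp add: nn_integral_cmult)
  also have "\<dots> = (\<integral>\<^sup>+x. (\<integral>\<^sup>+y. indicator (ball 0 R) y * (W x * F (x + t *\<^sub>R (y - x))) \<partial>lborel) \<partial>lborel)"
    by (rule lborel_pair.Fubini') measurable
  also have "\<dots> \<le> (\<integral>\<^sup>+x. W x * (ennreal (t powr (- real CARD('n))) * ball_int F (1 + t * (R + 1))) \<partial>lborel)"
  proof (rule nn_integral_mono)
    fix x :: "real ^ 'n"
    show "(\<integral>\<^sup>+y. indicator (ball 0 R) y * (W x * F (x + t *\<^sub>R (y - x))) \<partial>lborel)
        \<le> W x * (ennreal (t powr (- real CARD('n))) * ball_int F (1 + t * (R + 1)))"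
    proof (cases "1 \<le> norm x")
      case False
      have "(\<integral>\<^sup>+y. indicator (ball 0 R) y * (W x * F (x + t *\<^sub>R (y - x))) \<partial>lborel)
          \<le> (\<integral>\<^sup>+y. W x * (indicator (ball 0 (1 + t * (R + 1))) ((x - t *\<^sub>R x) + t *\<^sub>R y) * F ((x - t *\<^sub>R x) + t *\<^sub>R y)) \<partial>lborel)"
      proof (rule nn_integral_mono)
        fix y :: "real ^ 'n"
        have z: "x + t *\<^sub>R (y - x) = (x - t *\<^sub>R x) + t *\<^sub>R y" by (simp add: algebra_simps)
        have "norm (x + t *\<^sub>R (y - x)) < 1 + t * (R + 1)" if "norm y < R"
        proof -
          have "norm (x + t *\<^sub>R (y - x)) \<le> norm x + t * norm (y - x)"
            using t by (intro order_trans[OF norm_triangle_ineq]) simp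
          also have "\<dots> \<le> norm x + t * (norm y + norm x)"
            using t by (intro add_left_mono mult_left_mono norm_triangle_ineq4) auto
          also have "\<dots> < 1 + t * (R + 1)"
            using t that False by (intro add_strict_mono mult_strict_left_mono) auto
          finally show ?thesis .
        qed
        then show "indicator (ball 0 R) y * (W x * F (x + t *\<^sub>R (y - x))) \<le>
          W x * (indicator (ball 0 (1 + t * (R + 1))) ((x - t *\<^sub>R x) + t *\<^sub>R y) * F ((x - t *\<^sub>R x) + t *\<^sub>R y))"
          unfolding z by (auto simp: indicator_def)
      qed
      also have "\<dots> = W x * (ennreal (t powr (- real CARD('n))) * ball_int F (1 + t * (R + 1)))"
        by (simp add: nn_integral_cmult ball_int_affine[OF _ t(1)])
      finally show ?thesis .
    qed (simp add: W)
  qed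
  also have "\<dots> = ennreal (t powr (- real CARD('n))) * ball_int F (1 + t * (R + 1))"
    by (simp add: nn_integral_multc W)
  finally show ?thesis .
qed

text \<open>For small t the factor t^(-N) of the substitution in y is too large. Here y is fixed and
  x is substituted, with Jacobian (1 - t)^N at least 2^(-N); the price is the bound B for W and the
  whole volume of the ball of radius R.\<close>

lemma seg_ball_near:
  fixes F :: "real ^ 'n::finite \<Rightarrow> ennreal"
  assumes [measurable]: "F \<in> borel_measurable borel" "W \<in> borel_measurable borel"
    and W: "\<And>x. 1 \<le> norm x \<Longrightarrow> W x = 0" "\<And>x. W x \<le> ennreal B"
    and t: "0 < t" "t \<le> 1/2" "t * (R + 1) \<le> 1"
  shows "(\<integral>\<^sup>+y. indicator (ball 0 R) y * (\<integral>\<^sup>+x. W x * F (x + t *\<^sub>R (y - x)) \<partial>lborel) \<partial>lborel)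
    \<le> emeasure lborel (ball (0 :: real ^ 'n) R) * (ennreal B * (ennreal (2 ^ CARD('n)) * ball_int F 2))"
proof -
  have "(\<integral>\<^sup>+y. indicator (ball 0 R) y * (\<integral>\<^sup>+x. W x * F (x + t *\<^sub>R (y - x)) \<partial>lborel) \<partial>lborel)
     \<le> (\<integral>\<^sup>+y. indicator (ball (0 :: real ^ 'n) R) y * (ennreal B * (ennreal (2 ^ CARD('n)) * ball_int F 2)) \<partial>lborel)"
  proof (rule nn_integral_mono)
    fix y :: "real ^ 'n"
    show "indicator (ball 0 R) y * (\<integral>\<^sup>+x. W x * F (x + t *\<^sub>R (y - x)) \<partial>lborel)
       \<le> indicator (ball 0 R) y * (ennreal B * (ennreal (2 ^ CARD('n)) * ball_int F 2))"
    proof (cases "norm y < R")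
      case True
      have "(\<integral>\<^sup>+x. W x * F (x + t *\<^sub>R (y - x)) \<partial>lborel)
          \<le> (\<integral>\<^sup>+x. ennreal B * (indicator (ball 0 2) (t *\<^sub>R y + (1 - t) *\<^sub>R x) * F (t *\<^sub>R y + (1 - t) *\<^sub>R x)) \<partial>lborel)"
      proof (rule nn_integral_mono)
        fix x :: "real ^ 'n"
        have z: "x + t *\<^sub>R (y - x) = t *\<^sub>R y + (1 - t) *\<^sub>R x" by (simp add: algebra_simps)
        show "W x * F (x + t *\<^sub>R (y - x)) \<le> ennreal B * (indicator (ball 0 2) (t *\<^sub>R y + (1 - t) *\<^sub>R x) * F (t *\<^sub>R y + (1 - t) *\<^sub>R x))"
        proof (cases "1 \<le> norm x")
          case False
          have "norm (t *\<^sub>R y + (1 - t) *\<^sub>R x) \<le> t * norm y + (1 - t) * norm x"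
            using t by (intro order_trans[OF norm_triangle_ineq]) simp
          also have "\<dots> \<le> t * (R + 1) + 1 * norm x"
            using t True by (intro add_mono mult_left_mono mult_right_mono) auto
          also have "\<dots> < 2" using t False by simp
          finally show ?thesis
            unfolding z by (simp add: mult_right_mono W)
        qed (simp add: W)
      qed
      also have "\<dots> = ennreal B * (ennreal ((1 - t) powr (- real CARD('n))) * ball_int F 2)"
        using t by (simp add: nn_integral_cmult ball_int_affine)
      also have "\<dots> \<le> ennreal B * (ennreal (2 ^ CARD('n)) * ball_int F 2)"
      proof (intro mult_left_mono mult_right_mono ennreal_leI)
        have "(1 / (1 - t)) powr real CARD('n) \<le> 2 powr real CARD('n)"
          using t by (intro powr_mono2) (auto simp: field_simps)
        then show "(1 - t) powr (- real CARD('n)) \<le> 2 ^ CARD('n)"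
          using t by (simp add: powr_minus powr_divide powr_realpow field_simps)
      qed auto
      finally show ?thesis using True by simp
    qed simp
  qed
  also have "\<dots> = emeasure lborel (ball (0 :: real ^ 'n) R) * (ennreal B * (ennreal (2 ^ CARD('n)) * ball_int F 2))"
    by (simp add: nn_integral_multc)
  finally show ?thesis .
qed


lemma powr_doubling:
  fixes R \<rho> a :: real
  assumes "1 \<le> R" "R \<le> \<rho>" "\<rho> \<le> 2 * R"
  shows "\<rho> powr a \<le> 2 powr \<bar>a\<bar> * R powr a"
proof (cases "a \<ge> 0")
  case True
  have "\<rho> powr a \<le> (2 * R) powr a" using assms True by (intro powr_mono2) auto
  also have "\<dots> = 2 powr \<bar>a\<bar> * R powr a" using assms True by (simp add: powr_mult)
  finally show ?thesis .
next
  case False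
  have "\<rho> powr a \<le> R powr a" using assms False by (intro powr_mono2') auto
  also have "\<dots> \<le> 2 powr \<bar>a\<bar> * R powr a"
    using ge_one_powr_ge_zero[of 2 "\<bar>a\<bar>"] by (simp add: mult_le_cancel_right1)
  finally show ?thesis .
qed

text \<open>Both regimes end in R^(\<alpha> + d) (t^\<alpha> + 1). For t (R + 1) \<le> 1 the left
  side lacks the power R^\<alpha>; it is supplied by the summand 1 if \<alpha> \<ge> 0, and by (R
  t)^\<alpha> \<ge> 1 if \<alpha> is negative.\<close>

lemma seg_ball_scaling:
  fixes R t \<alpha> d :: real
  assumes R: "1 \<le> R" and t: "0 < t" "t \<le> 1"
  shows "1 \<le> t * (R + 1) \<Longrightarrow> t powr (- d) * (2 * (t * (R + 1))) powr (\<alpha> + d) \<le> 4 powr \<bar>\<alpha> + d\<bar> * (R powr (\<alpha> + d) * (t powr \<alpha> + 1))"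
    and "t * (R + 1) \<le> 1 \<Longrightarrow> R powr d * 2 powr (\<alpha> + d) \<le> 4 powr \<bar>\<alpha> + d\<bar> * (R powr (\<alpha> + d) * (t powr \<alpha> + 1))"
proof -
  have two: "2 powr (\<alpha> + d) \<le> 2 powr \<bar>\<alpha> + d\<bar>" by (intro powr_mono) auto
  have one: "1 \<le> 2 powr \<bar>\<alpha> + d\<bar>" by (intro ge_one_powr_ge_zero) auto
  have four: "4 powr \<bar>\<alpha> + d\<bar> = 2 powr \<bar>\<alpha> + d\<bar> * 2 powr \<bar>\<alpha> + d\<bar>" by (simp add: powr_mult[symmetric])
  {
    have "t powr (- d) * (2 * (t * (R + 1))) powr (\<alpha> + d) = 2 powr (\<alpha> + d) * (R + 1) powr (\<alpha> + d) * t powr \<alpha>"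
    proof -
      define \<rho> where "\<rho> = R + 1"
      have "\<rho> > 0" using R by (simp add: \<rho>_def)
      then show ?thesis
        unfolding \<rho>_def[symmetric] using t by (simp add: powr_mult powr_add powr_minus field_simps)
    qed
    also have "\<dots> \<le> 2 powr \<bar>\<alpha> + d\<bar> * (2 powr \<bar>\<alpha> + d\<bar> * R powr (\<alpha> + d)) * t powr \<alpha>"
      using R by (intro mult_right_mono mult_mono two powr_doubling) auto
    also have "\<dots> = 4 powr \<bar>\<alpha> + d\<bar> * (R powr (\<alpha> + d) * t powr \<alpha>)"
      by (simp add: four mult_ac)
    also have "\<dots> \<le> 4 powr \<bar>\<alpha> + d\<bar> * (R powr (\<alpha> + d) * (t powr \<alpha> + 1))"
      by (intro mult_left_mono) auto
    finally show "t powr (- d) * (2 * (t * (R + 1))) powr (\<alpha> + d) \<le> 4 powr \<bar>\<alpha> + d\<bar> * (R powr (\<alpha> + d) * (t powr \<alpha> + 1))" .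
  }
  assume le: "t * (R + 1) \<le> 1"
  have "1 \<le> R powr \<alpha> * (t powr \<alpha> + 1)"
  proof (cases "\<alpha> \<ge> 0")
    case True
    have "1 * 1 \<le> R powr \<alpha> * (t powr \<alpha> + 1)"
      using R True by (intro mult_mono ge_one_powr_ge_zero) auto
    then show ?thesis by simp
  next
    case False
    have "R * t \<le> 1" using le t R by (simp add: algebra_simps)
    then have "1 powr \<alpha> \<le> (R * t) powr \<alpha>" using False R t by (intro powr_mono2') auto
    then have "1 \<le> R powr \<alpha> * t powr \<alpha>" using R t by (simp add: powr_mult)
    also have "\<dots> \<le> R powr \<alpha> * (t powr \<alpha> + 1)" by (intro mult_left_mono) auto
    finally show ?thesis .
  qed
  then have "R powr d * 2 powr (\<alpha> + d) * 1 \<le> R powr d * 4 powr \<bar>\<alpha> + d\<bar> * (R powr \<alpha> * (t powr \<alpha> + 1))"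
    using mult_mono[OF two one] by (intro mult_mono mult_left_mono) (auto simp: four)
  then show "R powr d * 2 powr (\<alpha> + d) \<le> 4 powr \<bar>\<alpha> + d\<bar> * (R powr (\<alpha> + d) * (t powr \<alpha> + 1))"
    using R by (simp add: powr_add mult_ac)
qed

lemma ball_int_mono: "r \<le> r' \<Longrightarrow> ball_int F r \<le> ball_int F r'"
  unfolding ball_int_def by (intro nn_integral_mono) (auto simp: indicator_def)

text \<open>The bound carries two powers, so that a small leading coefficient c1 stays separate from
  a large lower-order one c2. K depends on neither of them, nor on R and t.\<close>

lemma seg_ball_bound:
  fixes F W :: "real ^ 'n::finite \<Rightarrow> ennreal" and \<alpha>1 \<alpha>2 B c1 c2 R t :: real
  assumes [measurable]: "F \<in> borel_measurable borel" "W \<in> borel_measurable borel"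
    and W: "\<And>x. 1 \<le> norm x \<Longrightarrow> W x = 0" "\<And>x. W x \<le> ennreal B" "(\<integral>\<^sup>+x. W x \<partial>lborel) = 1" and B: "B \<ge> 0"
    and c: "c1 \<ge> 0" "c2 \<ge> 0"
    and F: "\<And>r. 1 \<le> r \<Longrightarrow> ball_int F r \<le> ennreal (c1 * r powr (\<alpha>1 + CARD('n)) + c2 * r powr (\<alpha>2 + CARD('n)))"
    and R: "1 \<le> R" and t: "0 < t" "t \<le> 1"
  defines "K \<equiv> (1 + unit_ball_vol (real CARD('n)) * B * 2 ^ CARD('n)) * (4 powr \<bar>\<alpha>1 + CARD('n)\<bar> + 4 powr \<bar>\<alpha>2 + CARD('n)\<bar>)"
  shows "(\<integral>\<^sup>+y. indicator (ball 0 R) y * (\<integral>\<^sup>+x. W x * F (x + t *\<^sub>R (y - x)) \<partial>lborel) \<partial>lborel)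
    \<le> ennreal (K * (c1 * R powr (\<alpha>1 + CARD('n)) * (t powr \<alpha>1 + 1) + c2 * R powr (\<alpha>2 + CARD('n)) * (t powr \<alpha>2 + 1)))"
    (is "?L \<le> _")
proof -
  let ?N = "real CARD('n)"
  let ?V = "unit_ball_vol (real CARD('n))"
  let ?k1 = "4 powr \<bar>\<alpha>1 + ?N\<bar>" and ?k2 = "4 powr \<bar>\<alpha>2 + ?N\<bar>"
  let ?T1 = "R powr (\<alpha>1 + ?N) * (t powr \<alpha>1 + 1)" and ?T2 = "R powr (\<alpha>2 + ?N) * (t powr \<alpha>2 + 1)"
  let ?D = "?V * B * 2 ^ CARD('n)"
  have D: "0 \<le> ?D" using B by simp
  have sum: "c1 * x1 + c2 * x2 \<le> (?k1 + ?k2) * (c1 * ?T1 + c2 * ?T2)" if "x1 \<le> ?k1 * ?T1" "x2 \<le> ?k2 * ?T2" for x1 x2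
  proof -
    have "c1 * x1 + c2 * x2 \<le> c1 * (?k1 * ?T1) + c2 * (?k2 * ?T2)"
      by (intro add_mono mult_left_mono that c)
    also have "\<dots> \<le> c1 * ((?k1 + ?k2) * ?T1) + c2 * ((?k1 + ?k2) * ?T2)"
      by (intro add_mono mult_left_mono mult_right_mono c) auto
    finally show ?thesis by (simp add: algebra_simps)
  qed
  have nn: "0 \<le> (?k1 + ?k2) * (c1 * ?T1 + c2 * ?T2)"
    using c by (intro mult_nonneg_nonneg add_nonneg_nonneg) auto
  have fin: "K * (c1 * R powr (\<alpha>1 + ?N) * (t powr \<alpha>1 + 1) + c2 * R powr (\<alpha>2 + ?N) * (t powr \<alpha>2 + 1))
      = (?k1 + ?k2) * (c1 * ?T1 + c2 * ?T2) + ?D * ((?k1 + ?k2) * (c1 * ?T1 + c2 * ?T2))"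
    by (simp add: K_def algebra_simps)
  show ?thesis
  proof (cases "1 \<le> t * (R + 1)")
    case True
    have "?L \<le> ennreal (t powr (- ?N)) * ball_int F (1 + t * (R + 1))"
      by (intro seg_ball_far W t) measurable
    also have "\<dots> \<le> ennreal (t powr (- ?N)) * ball_int F (2 * (t * (R + 1)))"
      using True by (intro mult_left_mono ball_int_mono) auto
    also have "\<dots> \<le> ennreal (t powr (- ?N)) * ennreal (c1 * (2 * (t * (R + 1))) powr (\<alpha>1 + ?N) + c2 * (2 * (t * (R + 1))) powr (\<alpha>2 + ?N))"
      using True by (intro mult_left_mono F) auto
    also have "\<dots> = ennreal (c1 * (t powr (- ?N) * (2 * (t * (R + 1))) powr (\<alpha>1 + ?N)) + c2 * (t powr (- ?N) * (2 * (t * (R + 1))) powr (\<alpha>2 + ?N)))"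
      using c by (simp add: ennreal_mult[symmetric] algebra_simps)
    also have "\<dots> \<le> ennreal (K * (c1 * R powr (\<alpha>1 + ?N) * (t powr \<alpha>1 + 1) + c2 * R powr (\<alpha>2 + ?N) * (t powr \<alpha>2 + 1)))"
      unfolding fin
      by (intro ennreal_leI order_trans[OF sum] seg_ball_scaling(1) R t True) (use D nn in simp)
    finally show ?thesis .
  next
    case False
    \<comment> \<open>Since R \<ge> 1, below the threshold t is at most 1/2, as the substitution in
      x requires.\<close>
    have "t * 2 \<le> t * (R + 1)" using t R by (intro mult_left_mono) auto
    with False have "t \<le> 1/2" by simp
    have "emeasure lborel (ball (0 :: real ^ 'n) R) = ennreal (?V * R powr ?N)"
      using R by (simp add: emeasure_ball powr_realpow)
    moreover have "?L \<le> emeasure lborel (ball (0 :: real ^ 'n) R) * (ennreal B * (ennreal (2 ^ CARD('n)) * ball_int F 2))"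
      using False t \<open>t \<le> 1/2\<close> by (intro seg_ball_near W) auto
    ultimately have "?L \<le> ennreal (?V * R powr ?N) * (ennreal B * (ennreal (2 ^ CARD('n)) * ball_int F 2))"
      by simp
    also have "\<dots> \<le> ennreal (?V * R powr ?N) * (ennreal B * (ennreal (2 ^ CARD('n)) * ennreal (c1 * 2 powr (\<alpha>1 + ?N) + c2 * 2 powr (\<alpha>2 + ?N))))"
      by (intro mult_left_mono F) auto
    also have "\<dots> = ennreal (?D * (c1 * (R powr ?N * 2 powr (\<alpha>1 + ?N)) + c2 * (R powr ?N * 2 powr (\<alpha>2 + ?N))))"
      using B c by (simp add: ennreal_mult[symmetric] algebra_simps)
    also have "\<dots> \<le> ennreal (?D * ((?k1 + ?k2) * (c1 * ?T1 + c2 * ?T2)))"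
      using False t R by (intro ennreal_leI mult_left_mono D sum seg_ball_scaling(2)) auto
    also have "\<dots> \<le> ennreal (K * (c1 * R powr (\<alpha>1 + ?N) * (t powr \<alpha>1 + 1) + c2 * R powr (\<alpha>2 + ?N) * (t powr \<alpha>2 + 1)))"
      unfolding fin using nn by (intro ennreal_leI) simp
    finally show ?thesis .
  qed
qed


text \<open>The weight t^\<beta>, which Jensen's inequality supplies, makes the powers of t
  integrable at 0. L collects the integrals of t^(\<beta> + \<alpha>1), t^(\<beta> + \<alpha>2) and
  t^\<beta>, the last one from the summands 1 in \<open>seg_ball_bound\<close>.\<close>

lemma seg_energy_bound:
  fixes F W :: "real ^ 'n::finite \<Rightarrow> ennreal" and \<alpha>1 \<alpha>2 \<beta> B c1 c2 R :: real
  assumes [measurable]: "F \<in> borel_measurable borel" "W \<in> borel_measurable borel"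
    and W: "\<And>x. 1 \<le> norm x \<Longrightarrow> W x = 0" "\<And>x. W x \<le> ennreal B" "(\<integral>\<^sup>+x. W x \<partial>lborel) = 1" and B: "B \<ge> 0"
    and c: "c1 \<ge> 0" "c2 \<ge> 0"
    and F: "\<And>r. 1 \<le> r \<Longrightarrow> ball_int F r \<le> ennreal (c1 * r powr (\<alpha>1 + CARD('n)) + c2 * r powr (\<alpha>2 + CARD('n)))"
    and R: "1 \<le> R" and \<beta>: "0 \<le> \<beta>" "-1 < \<beta> + \<alpha>1" "-1 < \<beta> + \<alpha>2"
  defines "K \<equiv> (1 + unit_ball_vol (real CARD('n)) * B * 2 ^ CARD('n)) * (4 powr \<bar>\<alpha>1 + CARD('n)\<bar> + 4 powr \<bar>\<alpha>2 + CARD('n)\<bar>)"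
  defines "L \<equiv> 1 / (\<beta> + \<alpha>1 + 1) + 1 / (\<beta> + \<alpha>2 + 1) + 1 / (\<beta> + 1)"
  shows "(\<integral>\<^sup>+y. indicator (ball 0 R) y * (\<integral>\<^sup>+t. indicator {0<..1} t * ennreal (t powr \<beta>) *
      (\<integral>\<^sup>+x. W x * F (x + t *\<^sub>R (y - x)) \<partial>lborel) \<partial>lborel) \<partial>lborel)
    \<le> ennreal (K * L * (c1 * R powr (\<alpha>1 + CARD('n)) + c2 * R powr (\<alpha>2 + CARD('n))))" (is "?L \<le> _")
proof -
  have K: "K \<ge> 0" unfolding K_def using B by (intro mult_nonneg_nonneg add_nonneg_nonneg) auto
  define a1 where "a1 = K * c1 * R powr (\<alpha>1 + CARD('n))"
  define a2 where "a2 = K * c2 * R powr (\<alpha>2 + CARD('n))"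
  have a: "a1 \<ge> 0" "a2 \<ge> 0" using K c by (auto simp: a1_def a2_def)
  let ?i = "\<lambda>t::real. indicator {0<..1} t :: ennreal"
  have "?L = (\<integral>\<^sup>+y. (\<integral>\<^sup>+t. indicator (ball 0 R) y * (?i t * ennreal (t powr \<beta>) *
      (\<integral>\<^sup>+x. W x * F (x + t *\<^sub>R (y - x)) \<partial>lborel)) \<partial>lborel) \<partial>lborel)"
    by (intro nn_integral_cong nn_integral_cmult[symmetric]) measurable
  also have "\<dots> = (\<integral>\<^sup>+t. (\<integral>\<^sup>+y. indicator (ball 0 R) y * (?i t * ennreal (t powr \<beta>) *
      (\<integral>\<^sup>+x. W x * F (x + t *\<^sub>R (y - x)) \<partial>lborel)) \<partial>lborel) \<partial>lborel)"
    by (rule lborel_pair.Fubini') measurable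
  also have "\<dots> = (\<integral>\<^sup>+t. ?i t * ennreal (t powr \<beta>) * (\<integral>\<^sup>+y. indicator (ball 0 R) y *
      (\<integral>\<^sup>+x. W x * F (x + t *\<^sub>R (y - x)) \<partial>lborel) \<partial>lborel) \<partial>lborel)"
  proof (rule nn_integral_cong)
    fix t :: real
    have "(\<integral>\<^sup>+y. indicator (ball 0 R) y * (?i t * ennreal (t powr \<beta>) * (\<integral>\<^sup>+x. W x * F (x + t *\<^sub>R (y - x)) \<partial>lborel)) \<partial>lborel)
      = (\<integral>\<^sup>+y. (?i t * ennreal (t powr \<beta>)) * (indicator (ball 0 R) y * (\<integral>\<^sup>+x. W x * F (x + t *\<^sub>R (y - x)) \<partial>lborel)) \<partial>lborel)"
      by (intro nn_integral_cong) (simp add: mult_ac)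
    also have "\<dots> = ?i t * ennreal (t powr \<beta>) * (\<integral>\<^sup>+y. indicator (ball 0 R) y * (\<integral>\<^sup>+x. W x * F (x + t *\<^sub>R (y - x)) \<partial>lborel) \<partial>lborel)"
      by (rule nn_integral_cmult) measurable
    finally show "(\<integral>\<^sup>+y. indicator (ball 0 R) y * (?i t * ennreal (t powr \<beta>) * (\<integral>\<^sup>+x. W x * F (x + t *\<^sub>R (y - x)) \<partial>lborel)) \<partial>lborel)
      = ?i t * ennreal (t powr \<beta>) * (\<integral>\<^sup>+y. indicator (ball 0 R) y * (\<integral>\<^sup>+x. W x * F (x + t *\<^sub>R (y - x)) \<partial>lborel) \<partial>lborel)" .
  qed
  also have "\<dots> \<le> (\<integral>\<^sup>+t. ennreal a1 * (?i t * ennreal (t powr (\<beta> + \<alpha>1))) + ennreal a2 * (?i t * ennreal (t powr (\<beta> + \<alpha>2)))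
      + ennreal (a1 + a2) * (?i t * ennreal (t powr \<beta>)) \<partial>lborel)"
  proof (rule nn_integral_mono)
    fix t :: real
    show "?i t * ennreal (t powr \<beta>) * (\<integral>\<^sup>+y. indicator (ball 0 R) y * (\<integral>\<^sup>+x. W x * F (x + t *\<^sub>R (y - x)) \<partial>lborel) \<partial>lborel)
      \<le> ennreal a1 * (?i t * ennreal (t powr (\<beta> + \<alpha>1))) + ennreal a2 * (?i t * ennreal (t powr (\<beta> + \<alpha>2)))
      + ennreal (a1 + a2) * (?i t * ennreal (t powr \<beta>))"
    proof (cases "t \<in> {0<..1}")
      case True
      then have "?i t * ennreal (t powr \<beta>) * (\<integral>\<^sup>+y. indicator (ball 0 R) y * (\<integral>\<^sup>+x. W x * F (x + t *\<^sub>R (y - x)) \<partial>lborel) \<partial>lborel)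
        \<le> ?i t * ennreal (t powr \<beta>) * ennreal (K * (c1 * R powr (\<alpha>1 + CARD('n)) * (t powr \<alpha>1 + 1) + c2 * R powr (\<alpha>2 + CARD('n)) * (t powr \<alpha>2 + 1)))"
        unfolding K_def by (intro mult_left_mono seg_ball_bound W B c F R) auto
      also have "\<dots> = ennreal (t powr \<beta> * (K * (c1 * R powr (\<alpha>1 + CARD('n)) * (t powr \<alpha>1 + 1) + c2 * R powr (\<alpha>2 + CARD('n)) * (t powr \<alpha>2 + 1))))"
        using True by (simp add: ennreal_mult')
      also have "t powr \<beta> * (K * (c1 * R powr (\<alpha>1 + CARD('n)) * (t powr \<alpha>1 + 1) + c2 * R powr (\<alpha>2 + CARD('n)) * (t powr \<alpha>2 + 1)))
        = a1 * t powr (\<beta> + \<alpha>1) + a2 * t powr (\<beta> + \<alpha>2) + (a1 + a2) * t powr \<beta>"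
        unfolding a1_def a2_def powr_add[of t \<beta>] by (simp add: algebra_simps)
      also have "ennreal \<dots> = ennreal a1 * (?i t * ennreal (t powr (\<beta> + \<alpha>1))) + ennreal a2 * (?i t * ennreal (t powr (\<beta> + \<alpha>2)))
        + ennreal (a1 + a2) * (?i t * ennreal (t powr \<beta>))"
        using True a by (simp add: ennreal_plus ennreal_mult del: ennreal_plus[symmetric])
      finally show ?thesis .
    qed simp
  qed
  also have "\<dots> = ennreal a1 * ennreal (1 / (\<beta> + \<alpha>1 + 1)) + ennreal a2 * ennreal (1 / (\<beta> + \<alpha>2 + 1)) + ennreal (a1 + a2) * ennreal (1 / (\<beta> + 1))"
  proof -
    have meas: "(\<lambda>t. ennreal c * (?i t * ennreal (t powr e))) \<in> borel_measurable lborel" for c e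
      by measurable
    have pw: "(\<integral>\<^sup>+t. ennreal c * (?i t * ennreal (t powr e)) \<partial>lborel) = ennreal c * ennreal (1 / (e + 1))" if "-1 < e" for c e
      by (subst nn_integral_cmult) (simp_all only: nn_integral_powr_unit[OF that], measurable)
    have "-1 < \<beta>" using \<beta>(1) by simp
    then show ?thesis
      by (simp only: nn_integral_add meas borel_measurable_add pw \<beta>(2,3))
  qed
  also have "\<dots> = ennreal (a1 * (1 / (\<beta> + \<alpha>1 + 1)) + a2 * (1 / (\<beta> + \<alpha>2 + 1)) + (a1 + a2) * (1 / (\<beta> + 1)))"
    using a \<beta> by (simp add: ennreal_mult[symmetric] ennreal_plus[symmetric] del: ennreal_plus)
  also have "\<dots> \<le> ennreal ((a1 + a2) * L)"
  proof (rule ennreal_leI)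
    have "a1 * (1 / (\<beta> + \<alpha>1 + 1)) \<le> (a1 + a2) * (1 / (\<beta> + \<alpha>1 + 1))" "a2 * (1 / (\<beta> + \<alpha>2 + 1)) \<le> (a1 + a2) * (1 / (\<beta> + \<alpha>2 + 1))"
      using a \<beta> by (intro mult_right_mono; simp)+
    then show "a1 * (1 / (\<beta> + \<alpha>1 + 1)) + a2 * (1 / (\<beta> + \<alpha>2 + 1)) + (a1 + a2) * (1 / (\<beta> + 1)) \<le> (a1 + a2) * L"
      unfolding L_def distrib_left by linarith
  qed
  also have "(a1 + a2) * L = K * L * (c1 * R powr (\<alpha>1 + CARD('n)) + c2 * R powr (\<alpha>2 + CARD('n)))"
    by (simp add: a1_def a2_def algebra_simps)
  finally show ?thesis .
qed


section \<open>Growth for finite q\<close>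

lemma powr_add_le:
  fixes x y p :: real
  assumes "0 \<le> x" "0 \<le> y" "0 \<le> p"
  shows "(x + y) powr p \<le> (2 * x) powr p + (2 * y) powr p"
proof -
  have "(x + y) powr p \<le> (2 * max x y) powr p"
    using assms by (intro powr_mono2) auto
  also have "\<dots> \<le> (2 * x) powr p + (2 * y) powr p"
    by (auto simp: max_def)
  finally show ?thesis .
qed

text \<open>Of the N + 1 terms C and r G i, one is at least a / (N + 1). This selects a single
  component before p-th powers are taken, and only the real number a is raised to a power; the G i
  may be infinite.\<close>

lemma pigeonhole_ennreal:
  fixes G :: "'n::finite \<Rightarrow> ennreal" and a C r :: real
  assumes a: "0 \<le> a" and C: "0 \<le> C" and r: "0 < r"
    and le: "ennreal a \<le> ennreal C + ennreal r * (\<Sum>i\<in>UNIV. G i)"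
  defines "m \<equiv> real CARD('n) + 1"
  obtains "a \<le> m * C" | i where "ennreal (a / (m * r)) \<le> G i"
proof (rule ccontr)
  assume contr: "\<not> thesis"
  have m: "m > 0" by (simp add: m_def)
  have aC: "m * C < a" and G: "G i \<le> ennreal (a / (m * r))" for i
    using contr that by (meson linorder_not_less linorder_le_less_linear less_imp_le)+
  have "ennreal a \<le> ennreal C + ennreal r * (\<Sum>i\<in>(UNIV::'n set). ennreal (a / (m * r)))"
    by (intro order_trans[OF le] add_left_mono mult_left_mono sum_mono G) auto
  also have "\<dots> = ennreal (C + r * (\<Sum>i\<in>(UNIV::'n set). a / (m * r)))"
  proof -
    have S: "0 \<le> (\<Sum>i\<in>(UNIV::'n set). a / (m * r))"
      using a r m by (intro sum_nonneg) auto
    have "(\<Sum>i\<in>(UNIV::'n set). ennreal (a / (m * r))) = ennreal (\<Sum>i\<in>(UNIV::'n set). a / (m * r))"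
      using a r m by (intro sum_ennreal) auto
    then show ?thesis
      using S C r by (simp only: ennreal_plus ennreal_mult mult_nonneg_nonneg less_imp_le)
  qed
  finally have "a \<le> C + r * (\<Sum>i\<in>(UNIV::'n set). a / (m * r))"
    using a C r m by (subst (asm) ennreal_le_iff) (auto intro!: add_nonneg_nonneg mult_nonneg_nonneg)
  also have "\<dots> = C + (m - 1) * (a / m)"
    using r by (simp add: m_def)
  finally have "m * a \<le> m * C + (m - 1) * a"
    using m by (simp add: field_simps)
  then show False using aC by (simp add: algebra_simps)
qed

text \<open>For x in the unit ball and y in the ball of radius R, the segment has length at most R +
  1. This is the source of the additional power of R.\<close>

lemma seg_avg_le:
  fixes f :: "real ^ 'n::finite \<Rightarrow> complex"
  assumes "\<And>x. 1 \<le> norm x \<Longrightarrow> w x = 0" and [measurable]: "w \<in> borel_measurable borel" "f \<in> borel_measurable borel"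
    and y: "norm y < R"
  shows "seg_avg w f y \<le> ennreal (R + 1) *
    (\<integral>\<^sup>+t. (\<integral>\<^sup>+x. indicator {0<..1} t * ennreal (norm (w x) * norm (f (x + t *\<^sub>R (y - x)))) \<partial>lborel) \<partial>lborel)"
proof -
  have R: "0 \<le> R + 1" using y norm_ge_zero[of y] by linarith
  have "seg_avg w f y \<le> (\<integral>\<^sup>+t. (\<integral>\<^sup>+x. ennreal (R + 1) * (indicator {0<..1} t * ennreal (norm (w x) * norm (f (x + t *\<^sub>R (y - x))))) \<partial>lborel) \<partial>lborel)"
    unfolding seg_avg_def
  proof (intro nn_integral_mono)
    fix t :: real and x :: "real ^ 'n"
    have "norm (w x) * norm (f (x + t *\<^sub>R (y - x))) * norm (y - x) \<le> norm (w x) * norm (f (x + t *\<^sub>R (y - x))) * (R + 1)"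
    proof (cases "1 \<le> norm x")
      case False
      then have "norm (y - x) \<le> R + 1" using norm_triangle_ineq4[of y x] y by simp
      then show ?thesis by (intro mult_left_mono) auto
    qed (simp add: assms(1))
    then show "indicator {0<..1} t * ennreal (norm (w x) * norm (f (x + t *\<^sub>R (y - x))) * norm (y - x))
      \<le> ennreal (R + 1) * (indicator {0<..1} t * ennreal (norm (w x) * norm (f (x + t *\<^sub>R (y - x)))))"
      using R by (auto simp: indicator_def ennreal_mult[symmetric] mult.commute intro!: ennreal_leI)
  qed
  also have "\<dots> = ennreal (R + 1) *
    (\<integral>\<^sup>+t. (\<integral>\<^sup>+x. indicator {0<..1} t * ennreal (norm (w x) * norm (f (x + t *\<^sub>R (y - x)))) \<partial>lborel) \<partial>lborel)"
    by (simp add: nn_integral_cmult)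
  finally show ?thesis .
qed

text \<open>Either the constant dominates, or one component has a segment average of at least a
  fixed fraction of \<open>norm (g y)\<close>, and Jensen's inequality applies to that one. Summing
  over all components makes the bound independent of the choice, which varies with y.\<close>

lemma growth_pointwise:
  fixes w :: "real ^ 'n::finite \<Rightarrow> complex" and f :: "'n \<Rightarrow> real ^ 'n \<Rightarrow> complex" and p b C R :: real
  assumes w: "\<And>x. 1 \<le> norm x \<Longrightarrow> w x = 0" "(\<integral>\<^sup>+x. ennreal (norm (w x)) \<partial>lborel) = 1"
    and [measurable]: "w \<in> borel_measurable borel" "\<And>i. f i \<in> borel_measurable borel"
    and p: "1 \<le> p" and b: "0 \<le> b" "b < 1" and C: "0 \<le> C"
    and g: "ennreal (norm (g y)) \<le> ennreal C + 2 * (\<Sum>i\<in>UNIV. seg_avg w (f i) y)" and y: "norm y < R"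
  defines "m \<equiv> real CARD('n) + 1"
  shows "ennreal (norm (g y) powr p) \<le> ennreal ((m * C) powr p) + ennreal ((m * (2 * (R + 1))) powr p * (1 - b) powr (1 - p)) *
    (\<Sum>i\<in>UNIV. (\<integral>\<^sup>+t. indicator {0<..1} t * ennreal (t powr (b * (p - 1))) *
      (\<integral>\<^sup>+x. ennreal (norm (w x)) * ennreal (norm (f i (x + t *\<^sub>R (y - x))) powr p) \<partial>lborel) \<partial>lborel))"
    (is "_ \<le> _ + ennreal (?r powr p * ?B) * (\<Sum>i\<in>UNIV. ?J i)")
proof -
  let ?G = "\<lambda>i. (\<integral>\<^sup>+t. (\<integral>\<^sup>+x. indicator {0<..1} t * ennreal (norm (w x) * norm (f i (x + t *\<^sub>R (y - x)))) \<partial>lborel) \<partial>lborel)"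
  have R: "0 < R + 1" using y norm_ge_zero[of y] by linarith
  have m: "m > 0" by (simp add: m_def)
  have "ennreal (norm (g y)) \<le> ennreal C + 2 * (\<Sum>i\<in>UNIV. ennreal (R + 1) * ?G i)"
    by (intro order_trans[OF g] add_left_mono mult_left_mono sum_mono seg_avg_le w(1) y) auto
  also have "\<dots> = ennreal C + ennreal (2 * (R + 1)) * (\<Sum>i\<in>UNIV. ?G i)"
  proof -
    have "ennreal (2 * (R + 1)) = 2 * ennreal (R + 1)" using R by (subst ennreal_mult) auto
    then show ?thesis by (simp only: sum_distrib_left[symmetric] mult.assoc)
  qed
  finally have le: "ennreal (norm (g y)) \<le> ennreal C + ennreal (2 * (R + 1)) * (\<Sum>i\<in>UNIV. ?G i)" .
  have R2: "0 < 2 * (R + 1)" using R by simp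
  consider "norm (g y) \<le> m * C" | i where "ennreal (norm (g y) / (m * (2 * (R + 1)))) \<le> ?G i"
    using pigeonhole_ennreal[OF norm_ge_zero C R2 le] unfolding m_def by metis
  then show ?thesis
  proof cases
    case 1
    then have "norm (g y) powr p \<le> (m * C) powr p" using p by (intro powr_mono2) auto
    then show ?thesis by (intro add_increasing2 ennreal_leI) auto
  next
    case (2 i)
    have r: "?r > 0" using m R by simp
    have "ennreal ((norm (g y) / ?r) powr p) \<le> ennreal ?B * ?J i"
      using 2 r by (intro seg_jensen[OF _ _ _ _ w(2) b p]) auto
    then have "ennreal (?r powr p) * ennreal ((norm (g y) / ?r) powr p) \<le> ennreal (?r powr p) * (ennreal ?B * ?J i)"
      by (intro mult_left_mono) auto
    also have "ennreal (?r powr p) * ennreal ((norm (g y) / ?r) powr p) = ennreal (norm (g y) powr p)"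
    proof -
      have "?r * (norm (g y) / ?r) = norm (g y)" using r by (metis nonzero_mult_div_cancel_left less_irrefl times_divide_eq_right)
      then have "?r powr p * (norm (g y) / ?r) powr p = norm (g y) powr p"
        using r by (simp only: powr_mult[symmetric] less_imp_le norm_ge_zero divide_nonneg_nonneg)
      then show ?thesis by (simp only: ennreal_mult[symmetric] powr_ge_zero)
    qed
    also have "ennreal (?r powr p) * (ennreal ?B * ?J i) = ennreal (?r powr p * ?B) * ?J i"
      by (simp add: ennreal_mult mult.assoc)
    also have "\<dots> \<le> ennreal (?r powr p * ?B) * (\<Sum>i\<in>UNIV. ?J i)"
      by (intro mult_left_mono member_le_sum) auto
    finally show ?thesis by (intro add_increasing) auto
  qed
qed


text \<open>K is fixed before f, g, E, A, C and R. The constant C is absorbed by R^(\<sigma> + 1),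
  since \<sigma> + 1 is positive, and so it never enters the leading coefficient K E.\<close>

lemma growth_finite:
  fixes w :: "real ^ 'n::finite \<Rightarrow> complex" and s \<sigma> p :: real
  assumes w: "w \<in> test_functions" "\<And>x. 1 \<le> norm x \<Longrightarrow> w x = 0" "(\<integral>\<^sup>+x. ennreal (norm (w x)) \<partial>lborel) = 1"
    and p: "1 \<le> p" and \<sigma>: "-1 < \<sigma>" "\<sigma> \<le> s"
  obtains K where "K \<ge> 0" "\<And>(f :: 'n \<Rightarrow> real ^ 'n \<Rightarrow> complex) g C E A R. (\<And>i. f i \<in> borel_measurable borel) \<Longrightarrow> 0 \<le> C \<Longrightarrow> 0 \<le> E \<Longrightarrow> 0 \<le> A \<Longrightarrow>
    (\<And>i r. 1 \<le> r \<Longrightarrow> ball_int (\<lambda>x. ennreal (norm (f i x) powr p)) r \<le> ennreal ((E * r powr s + A * r powr \<sigma>) powr p * r powr CARD('n))) \<Longrightarrow>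
    (\<And>y. ennreal (norm (g y)) \<le> ennreal C + 2 * (\<Sum>i\<in>UNIV. seg_avg w (f i) y)) \<Longrightarrow> 1 \<le> R \<Longrightarrow>
    ball_int (\<lambda>x. ennreal (norm (g x :: complex) powr p)) R \<le>
      ennreal ((K * E * R powr (s + 1) + K * (A + C) * R powr (\<sigma> + 1)) powr p * R powr CARD('n))"
proof -
  note [measurable] = test_borel[OF w(1)]
  let ?N = "real CARD('n)"
  obtain B where B: "B \<ge> 0" "\<And>x. norm (w x) \<le> B" using test_bounded[OF w(1)] by blast
  \<comment> \<open>For \<sigma> \<ge> 0 the density in t is uniform. For negative \<sigma> the
    choice b = -\<sigma> gives b (p - 1) + \<sigma> p = \<sigma>, which is above -1 for every
    p.\<close>
  define b where "b = max 0 (- \<sigma>)"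
  have b: "0 \<le> b" "b < 1" using \<sigma> by (auto simp: b_def)
  define \<beta> where "\<beta> = b * (p - 1)"
  have \<beta>0: "0 \<le> \<beta>" using b p by (simp add: \<beta>_def)
  have \<beta>2: "-1 < \<beta> + \<sigma> * p"
  proof (cases "\<sigma> \<ge> 0")
    case True
    then have "0 \<le> \<sigma> * p" using p by simp
    with \<beta>0 show ?thesis by simp
  next
    case False
    then have "\<beta> + \<sigma> * p = \<sigma>" by (simp add: \<beta>_def b_def algebra_simps)
    with \<sigma> show ?thesis by simp
  qed
  have "\<sigma> * p \<le> s * p" using \<sigma> p by (intro mult_right_mono) auto
  with \<beta>2 have \<beta>1: "-1 < \<beta> + s * p" by simp
  define K1 where "K1 = (1 + unit_ball_vol ?N * B * 2 ^ CARD('n)) * (4 powr \<bar>s * p + ?N\<bar> + 4 powr \<bar>\<sigma> * p + ?N\<bar>)"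
  define L where "L = 1 / (\<beta> + s * p + 1) + 1 / (\<beta> + \<sigma> * p + 1) + 1 / (\<beta> + 1)"
  have "K1 \<ge> 0" using B unfolding K1_def by (intro mult_nonneg_nonneg add_nonneg_nonneg) auto
  moreover have "L \<ge> 0" using \<beta>0 \<beta>1 \<beta>2 by (auto simp: L_def)
  ultimately have KL: "0 \<le> K1 * L" by simp
  define m where "m = ?N + 1"
  have m: "m \<ge> 1" by (simp add: m_def)
  \<comment> \<open>4 m comes from the pigeonhole factor m and 2 (R + 1) \<le> 4 R, the power of 1 -
    b from Jensen's inequality, and N (K1 L) from summing the energy bounds of the N
    components.\<close>
  define H where "H = (4 * m) powr p * (1 - b) powr (1 - p) * (?N * (K1 * L))"
  have H: "H \<ge> 0" using KL by (simp add: H_def)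
  define Q where "Q = unit_ball_vol ?N + H"
  have Q: "Q \<ge> 0" using H by (simp add: Q_def)
  \<comment> \<open>With this K each of the three contributions, from C, E and A, is at most a third
    of the p-th power of the claimed bound.\<close>
  define K where "K = (3 * Q * (2 * m) powr p) powr (1 / p)"
  have K0: "K \<ge> 0" by (simp add: K_def)
  have Kp: "K powr p = 3 * Q * (2 * m) powr p" using p Q by (simp add: K_def powr_powr)
  have KY: "Q * (2 * m * Y) powr p = (K * Y) powr p / 3" if "Y \<ge> 0" for Y
    using that m K0 by (simp add: powr_mult Kp)
  show ?thesis
  proof (rule that[OF K0])
    fix f :: "'n \<Rightarrow> real ^ 'n \<Rightarrow> complex" and g :: "real ^ 'n \<Rightarrow> complex" and C E A R :: real
    assume f [measurable]: "\<And>i. f i \<in> borel_measurable borel" and C: "0 \<le> C" and E: "0 \<le> E" and A: "0 \<le> A"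
      and fint: "\<And>i r. 1 \<le> r \<Longrightarrow> ball_int (\<lambda>x. ennreal (norm (f i x) powr p)) r \<le> ennreal ((E * r powr s + A * r powr \<sigma>) powr p * r powr ?N)"
      and g: "\<And>y. ennreal (norm (g y)) \<le> ennreal C + 2 * (\<Sum>i\<in>UNIV. seg_avg w (f i) y)" and R: "1 \<le> R"
    let ?J = "\<lambda>i y. \<integral>\<^sup>+t. indicator {0<..1} t * ennreal (t powr \<beta>) *
      (\<integral>\<^sup>+x. ennreal (norm (w x)) * ennreal (norm (f i (x + t *\<^sub>R (y - x))) powr p) \<partial>lborel) \<partial>lborel"
    let ?D = "(m * (2 * (R + 1))) powr p * (1 - b) powr (1 - p)"
    let ?c1 = "(2 * E) powr p" and ?c2 = "(2 * A) powr p"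
    let ?P = "?c1 * R powr (s * p + ?N) + ?c2 * R powr (\<sigma> * p + ?N)"
    \<comment> \<open>The p-th power of the two-term growth is split into two pure powers, with a
      factor 2 in each base; the energy estimate takes growth in this form.\<close>
    have fint2: "ball_int (\<lambda>x. ennreal (norm (f i x) powr p)) r \<le> ennreal (?c1 * r powr (s * p + ?N) + ?c2 * r powr (\<sigma> * p + ?N))" if "1 \<le> r" for i r
    proof (rule order_trans[OF fint[OF that]], rule ennreal_leI)
      have "(E * r powr s + A * r powr \<sigma>) powr p * r powr ?N \<le> ((2 * (E * r powr s)) powr p + (2 * (A * r powr \<sigma>)) powr p) * r powr ?N"
        using E A p by (intro mult_right_mono powr_add_le) auto
      also have "\<dots> = ?c1 * r powr (s * p + ?N) + ?c2 * r powr (\<sigma> * p + ?N)"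
        using E A that by (simp add: powr_mult powr_powr powr_add algebra_simps)
      finally show "(E * r powr s + A * r powr \<sigma>) powr p * r powr ?N \<le> ?c1 * r powr (s * p + ?N) + ?c2 * r powr (\<sigma> * p + ?N)" .
    qed
    have J: "(\<integral>\<^sup>+y. indicator (ball 0 R) y * ?J i y \<partial>lborel) \<le> ennreal (K1 * L * ?P)" for i
      unfolding K1_def L_def
      by (rule seg_energy_bound[where F = "\<lambda>x. ennreal (norm (f i x) powr p)" and W = "\<lambda>x. ennreal (norm (w x))"])
         (use w B \<beta>0 \<beta>1 \<beta>2 R fint2 in \<open>auto intro: ennreal_leI\<close>)
    have "ball_int (\<lambda>x. ennreal (norm (g x) powr p)) R \<le>
      (\<integral>\<^sup>+y. ennreal ((m * C) powr p) * indicator (ball 0 R) y + ennreal ?D * (\<Sum>i\<in>UNIV. indicator (ball 0 R) y * ?J i y) \<partial>lborel)"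
      unfolding ball_int_def
    proof (rule nn_integral_mono)
      fix y :: "real ^ 'n"
      have "norm y < R \<Longrightarrow> ennreal (norm (g y) powr p) \<le> ennreal ((m * C) powr p) + ennreal ?D * (\<Sum>i\<in>UNIV. ?J i y)"
        unfolding m_def \<beta>_def by (rule growth_pointwise[OF w(2,3) _ _ p b C g]) auto
      then show "indicator (ball 0 R) y * ennreal (norm (g y) powr p)
        \<le> ennreal ((m * C) powr p) * indicator (ball 0 R) y + ennreal ?D * (\<Sum>i\<in>UNIV. indicator (ball 0 R) y * ?J i y)"
        by (auto simp: indicator_def)
    qed
    also have "\<dots> = ennreal ((m * C) powr p) * emeasure lborel (ball (0 :: real ^ 'n) R) + ennreal ?D * (\<Sum>i\<in>UNIV. (\<integral>\<^sup>+y. indicator (ball 0 R) y * ?J i y \<partial>lborel))"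
    proof -
      let ?h = "\<lambda>i y. indicator (ball 0 R) y * ?J i y"
      have h: "?h i \<in> borel_measurable lborel" for i by measurable
      have "(\<integral>\<^sup>+y. ennreal ((m * C) powr p) * indicator (ball 0 R) y + ennreal ?D * (\<Sum>i\<in>UNIV. ?h i y) \<partial>lborel)
        = (\<integral>\<^sup>+y. ennreal ((m * C) powr p) * indicator (ball (0 :: real ^ 'n) R) y \<partial>lborel) + (\<integral>\<^sup>+y. ennreal ?D * (\<Sum>i\<in>UNIV. ?h i y) \<partial>lborel)"
      proof (rule nn_integral_add)
        show "(\<lambda>y. ennreal ((m * C) powr p) * indicator (ball (0 :: real ^ 'n) R) y) \<in> borel_measurable lborel"
          by measurable
        show "(\<lambda>y. ennreal ?D * (\<Sum>i\<in>UNIV. ?h i y)) \<in> borel_measurable lborel"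
          by (rule borel_measurable_times_ennreal[OF borel_measurable_const borel_measurable_sum[OF h]])
      qed
      also have "(\<integral>\<^sup>+y. ennreal ((m * C) powr p) * indicator (ball (0 :: real ^ 'n) R) y \<partial>lborel) = ennreal ((m * C) powr p) * emeasure lborel (ball (0 :: real ^ 'n) R)"
        by (rule nn_integral_cmult_indicator) simp
      also have "(\<integral>\<^sup>+y. ennreal ?D * (\<Sum>i\<in>UNIV. ?h i y) \<partial>lborel) = ennreal ?D * (\<integral>\<^sup>+y. (\<Sum>i\<in>UNIV. ?h i y) \<partial>lborel)"
        by (rule nn_integral_cmult) (intro borel_measurable_sum h)
      also have "(\<integral>\<^sup>+y. (\<Sum>i\<in>UNIV. ?h i y) \<partial>lborel) = (\<Sum>i\<in>UNIV. (\<integral>\<^sup>+y. ?h i y \<partial>lborel))"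
        by (rule nn_integral_sum) (rule h)
      finally show ?thesis .
    qed
    also have "\<dots> \<le> ennreal ((m * C) powr p) * ennreal (unit_ball_vol ?N * R powr ?N) + ennreal ?D * (\<Sum>i\<in>(UNIV::'n set). ennreal (K1 * L * ?P))"
      using R by (intro add_mono mult_left_mono sum_mono J) (auto simp: emeasure_ball powr_realpow)
    also have "\<dots> = ennreal ((m * C) powr p * (unit_ball_vol ?N * R powr ?N) + ?D * (?N * (K1 * L * ?P)))"
    proof -
      have P: "0 \<le> K1 * L * ?P" by (rule mult_nonneg_nonneg[OF KL]) auto
      then have "(\<Sum>i\<in>(UNIV::'n set). ennreal (K1 * L * ?P)) = ennreal (?N * (K1 * L * ?P))"
        by (subst sum_ennreal) simp_all
      with P show ?thesis
        by (simp only: ennreal_plus ennreal_mult mult_nonneg_nonneg powr_ge_zero of_nat_0_le_iff unit_ball_vol_nonneg)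
    qed
    also have "\<dots> \<le> ennreal ((K * E * R powr (s + 1) + K * (A + C) * R powr (\<sigma> + 1)) powr p * R powr ?N)"
    proof (rule ennreal_leI)
      let ?X = "K * E * R powr (s + 1) + K * (A + C) * R powr (\<sigma> + 1)"
      have X: "Q * (2 * m * Y) powr p * R powr ?N \<le> ?X powr p * R powr ?N / 3" if "0 \<le> Y" "K * Y \<le> ?X" for Y
      proof -
        have "(K * Y) powr p \<le> ?X powr p" using that K0 p by (intro powr_mono2) auto
        then show ?thesis unfolding KY[OF that(1)] by (simp add: mult_right_mono)
      qed
      have 1: "(m * C) powr p * (unit_ball_vol ?N * R powr ?N) \<le> ?X powr p * R powr ?N / 3"
      proof (rule order_trans[OF _ X])
        have "m * C * 1 \<le> 2 * m * C * R powr (\<sigma> + 1)"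
          using m C R \<sigma> by (intro mult_mono ge_one_powr_ge_zero) auto
        then have "(m * C) powr p \<le> (2 * m * (C * R powr (\<sigma> + 1))) powr p"
          using m C p by (intro powr_mono2) (auto simp: mult.assoc)
        then have "unit_ball_vol ?N * (m * C) powr p \<le> Q * (2 * m * (C * R powr (\<sigma> + 1))) powr p"
          using H by (intro mult_mono) (auto simp: Q_def)
        then show "(m * C) powr p * (unit_ball_vol ?N * R powr ?N) \<le> Q * (2 * m * (C * R powr (\<sigma> + 1))) powr p * R powr ?N"
          using mult_right_mono[of _ _ "R powr ?N"] by (fastforce simp: mult_ac)
        show "0 \<le> C * R powr (\<sigma> + 1)" "K * (C * R powr (\<sigma> + 1)) \<le> ?X"
          using K0 C E A by (auto simp: algebra_simps)
      qed
      have D: "?D * (?N * (K1 * L)) \<le> Q * R powr p"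
      proof -
        have "(m * (2 * (R + 1))) powr p \<le> (4 * m * R) powr p"
          using m R p by (intro powr_mono2) (auto simp: algebra_simps)
        also have "\<dots> = (4 * m) powr p * R powr p" using m R by (simp add: powr_mult)
        finally have "?D * (?N * (K1 * L)) \<le> (4 * m) powr p * R powr p * (1 - b) powr (1 - p) * (?N * (K1 * L))"
          using KL by (intro mult_right_mono) auto
        also have "\<dots> = H * R powr p" by (simp add: H_def mult_ac)
        also have "\<dots> \<le> Q * R powr p" by (intro mult_right_mono) (auto simp: Q_def)
        finally show ?thesis .
      qed
      have power_term: "Q * R powr p * ((2 * Y) powr p * R powr (e * p + ?N)) \<le> ?X powr p * R powr ?N / 3"
        if Y: "0 \<le> Y" "K * (Y * R powr (e + 1)) \<le> ?X" for Y e
      proof -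
        have "2 * Y * 1 \<le> 2 * Y * m" using Y m by (intro mult_left_mono) auto
        then have "(2 * Y) powr p \<le> (2 * m * Y) powr p" using Y p by (intro powr_mono2) (auto simp: mult_ac)
        then have "Q * R powr p * ((2 * Y) powr p * R powr (e * p + ?N)) \<le> Q * R powr p * ((2 * m * Y) powr p * R powr (e * p + ?N))"
          using Q by (intro mult_left_mono mult_right_mono) auto
        also have "\<dots> = Q * (2 * m * (Y * R powr (e + 1))) powr p * R powr ?N"
          using Y m R by (simp add: powr_mult powr_powr powr_add algebra_simps)
        also have "\<dots> \<le> ?X powr p * R powr ?N / 3" using Y by (intro X) auto
        finally show ?thesis .
      qed
      have "?D * (?N * (K1 * L * ?P)) = ?D * (?N * (K1 * L)) * ?P" by (simp add: mult_ac)
      also have "\<dots> \<le> Q * R powr p * ?P" by (intro mult_right_mono D) auto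
      also have "\<dots> = Q * R powr p * (?c1 * R powr (s * p + ?N)) + Q * R powr p * (?c2 * R powr (\<sigma> * p + ?N))"
        by (rule distrib_left)
      also have "\<dots> \<le> ?X powr p * R powr ?N / 3 + ?X powr p * R powr ?N / 3"
      proof (intro add_mono power_term E A)
        show "K * (E * R powr (s + 1)) \<le> ?X" "K * (A * R powr (\<sigma> + 1)) \<le> ?X"
          using K0 C E A by (simp_all add: algebra_simps)
      qed
      finally show "(m * C) powr p * (unit_ball_vol ?N * R powr ?N) + ?D * (?N * (K1 * L * ?P)) \<le> ?X powr p * R powr ?N"
        using 1 by linarith
    qed
    finally show "ball_int (\<lambda>x. ennreal (norm (g x) powr p)) R \<le>
      ennreal ((K * E * R powr (s + 1) + K * (A + C) * R powr (\<sigma> + 1)) powr p * R powr ?N)" .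
  qed
qed


section \<open>Pointwise bounds along segments\<close>

lemma seg_avg_bound_pointwise:
  fixes f :: "real ^ 'n::finite \<Rightarrow> complex" and D c :: real
  assumes w: "\<And>x. 1 \<le> norm x \<Longrightarrow> w x = 0" "(\<integral>\<^sup>+x. ennreal (norm (w x)) \<partial>lborel) = 1"
    and [measurable]: "w \<in> borel_measurable borel" and c: "-1 < c" and D: "0 \<le> D"
    and f: "\<And>x t. norm x < 1 \<Longrightarrow> 0 < t \<Longrightarrow> t \<le> 1 \<Longrightarrow> norm (f (x + t *\<^sub>R (y - x))) * norm (y - x) \<le> D * t powr c"
  shows "seg_avg w f y \<le> ennreal (D / (c + 1))"
proof -
  have "seg_avg w f y \<le> (\<integral>\<^sup>+t. (\<integral>\<^sup>+x. (indicator {0<..1} t * ennreal (D * t powr c)) * ennreal (norm (w x)) \<partial>lborel) \<partial>lborel)"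
    unfolding seg_avg_def
  proof (intro nn_integral_mono)
    fix t :: real and x :: "real ^ 'n"
    have "norm (w x) * norm (f (x + t *\<^sub>R (y - x))) * norm (y - x) \<le> D * t powr c * norm (w x)" if "t \<in> {0<..1}"
    proof (cases "1 \<le> norm x")
      case False
      then have "norm (w x) * (norm (f (x + t *\<^sub>R (y - x))) * norm (y - x)) \<le> norm (w x) * (D * t powr c)"
        using that by (intro mult_left_mono f) auto
      then show ?thesis by (simp add: mult_ac)
    qed (simp add: w)
    then show "indicator {0<..1} t * ennreal (norm (w x) * norm (f (x + t *\<^sub>R (y - x))) * norm (y - x))
      \<le> (indicator {0<..1} t * ennreal (D * t powr c)) * ennreal (norm (w x))"
      using D by (auto simp: indicator_def ennreal_mult[symmetric] intro!: ennreal_leI)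
  qed
  also have "\<dots> = (\<integral>\<^sup>+t. ennreal D * (indicator {0<..1} t * ennreal (t powr c)) \<partial>lborel)"
    using D by (simp add: nn_integral_cmult w(2) ennreal_mult mult.left_commute)
  also have "\<dots> = ennreal D * ennreal (1 / (c + 1))"
    by (subst nn_integral_cmult) (simp_all add: nn_integral_powr_unit[OF c])
  also have "\<dots> = ennreal (D / (c + 1))"
    using D c by (simp add: ennreal_mult[symmetric])
  finally show ?thesis .
qed

text \<open>Used with c = 0 for components bounded on balls and with c = -1/2 for components that
  decay at infinity; in the second case the singularity at t = 0 accounts for the part of the
  segment near the origin.\<close>

lemma growth_pointwise_bound:
  fixes f :: "'n::finite \<Rightarrow> real ^ 'n \<Rightarrow> complex" and D c C :: real
  assumes w: "\<And>x. 1 \<le> norm x \<Longrightarrow> w x = 0" "(\<integral>\<^sup>+x. ennreal (norm (w x)) \<partial>lborel) = 1"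
    and [measurable]: "w \<in> borel_measurable borel" and c: "-1 < c" and D: "0 \<le> D" and C: "0 \<le> C"
    and f: "\<And>i x t. norm x < 1 \<Longrightarrow> 0 < t \<Longrightarrow> t \<le> 1 \<Longrightarrow> norm (f i (x + t *\<^sub>R (y - x))) * norm (y - x) \<le> D * t powr c"
    and g: "ennreal (norm (g y)) \<le> ennreal C + 2 * (\<Sum>i\<in>UNIV. seg_avg w (f i) y)"
  shows "norm (g y) \<le> C + 2 * (real CARD('n) * (D / (c + 1)))"
proof -
  have D': "0 \<le> D / (c + 1)" using D c by simp
  then have T1: "0 \<le> real CARD('n) * (D / (c + 1))" by (rule mult_nonneg_nonneg[OF of_nat_0_le_iff])
  then have T: "0 \<le> 2 * (real CARD('n) * (D / (c + 1)))" by simp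
  have "ennreal (norm (g y)) \<le> ennreal C + 2 * (\<Sum>i\<in>(UNIV::'n set). ennreal (D / (c + 1)))"
    by (intro order_trans[OF g] add_left_mono mult_left_mono sum_mono seg_avg_bound_pointwise w c D f) auto
  also have "(\<Sum>i\<in>(UNIV::'n set). ennreal (D / (c + 1))) = ennreal (real CARD('n) * (D / (c + 1)))"
    using D' by (subst sum_ennreal) simp_all
  also have "ennreal C + 2 * \<dots> = ennreal (C + 2 * (real CARD('n) * (D / (c + 1))))"
  proof -
    have "ennreal (2 * (real CARD('n) * (D / (c + 1)))) = ennreal 2 * ennreal (real CARD('n) * (D / (c + 1)))"
      by (rule ennreal_mult[OF _ T1]) simp
    then show ?thesis using C T by (simp only: ennreal_plus ennreal_numeral)
  qed
  finally show ?thesis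
    using C T by (subst (asm) ennreal_le_iff) (auto intro: add_nonneg_nonneg)
qed

section \<open>The growth spaces\<close>

lemma nn_integral_lebesgue_on:
  assumes "A \<in> sets lebesgue"
  shows "(\<integral>\<^sup>+x. h x \<partial>lebesgue_on A) = (\<integral>\<^sup>+x. indicator A x * h x \<partial>lborel)"
  using assms by (simp add: nn_integral_restrict_space nn_integral_completion mult.commute)

lemma AE_lebesgue_on:
  assumes "A \<in> sets lebesgue"
  shows "(AE x in lebesgue_on A. P x) \<longleftrightarrow> (AE x in lborel. x \<in> A \<longrightarrow> P x)"
  using assms by (simp add: AE_restrict_space_iff AE_completion_iff)

lemma measurable_lebesgue_on: "f \<in> borel_measurable lebesgue \<Longrightarrow> f \<in> borel_measurable (lebesgue_on A)"
  by (rule measurable_restrict_space1)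

text \<open>Membership and norm bound go together, since \<open>Lq_norm\<close> maps an infinite
  norm to 0 and a bound on it says nothing outside \<open>Lq\<close>.\<close>

lemma Lq_infinity_iff:
  assumes A: "A \<in> sets lebesgue" and f: "f \<in> borel_measurable lebesgue" and b: "0 \<le> b"
  shows "f \<in> Lq \<infinity> A \<and> Lq_norm \<infinity> A f \<le> b \<longleftrightarrow> (AE x in lborel. x \<in> A \<longrightarrow> norm (f x) \<le> b)"
    and "esssup (lebesgue_on A) (\<lambda>x. ennreal (norm (f x))) \<le> ennreal b \<longleftrightarrow> (AE x in lborel. x \<in> A \<longrightarrow> norm (f x) \<le> b)"
proof -
  have f': "f \<in> borel_measurable (lebesgue_on A)" using f by (rule measurable_lebesgue_on)
  then have m: "(\<lambda>x. ennreal (norm (f x))) \<in> borel_measurable (lebesgue_on A)" by measurable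
  let ?e = "esssup (lebesgue_on A) (\<lambda>x. ennreal (norm (f x)))"
  show *: "?e \<le> ennreal b \<longleftrightarrow> (AE x in lborel. x \<in> A \<longrightarrow> norm (f x) \<le> b)"
  proof
    assume "?e \<le> ennreal b"
    then have "AE x in lebesgue_on A. norm (f x) \<le> b"
      using esssup_AE[of "\<lambda>x. ennreal (norm (f x))" "lebesgue_on A"] b
      by (auto elim!: eventually_mono dest: order_trans)
    then show "AE x in lborel. x \<in> A \<longrightarrow> norm (f x) \<le> b" by (simp add: AE_lebesgue_on[OF A])
  next
    assume "AE x in lborel. x \<in> A \<longrightarrow> norm (f x) \<le> b"
    then have "AE x in lebesgue_on A. ennreal (norm (f x)) \<le> ennreal b"
      using b by (simp add: AE_lebesgue_on[OF A])
    then show "?e \<le> ennreal b" using m by (rule esssup_I[rotated])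
  qed
  have "f \<in> Lq \<infinity> A \<and> Lq_norm \<infinity> A f \<le> b \<longleftrightarrow> ?e \<le> ennreal b"
  proof
    assume "f \<in> Lq \<infinity> A \<and> Lq_norm \<infinity> A f \<le> b"
    then have "?e < \<infinity>" "enn2real ?e \<le> b" by (auto simp: Lq_def Lq_norm_def)
    then show "?e \<le> ennreal b"
      by (metis ennreal_enn2real ennreal_leI infinity_ennreal_def)
  next
    assume e: "?e \<le> ennreal b"
    then have "?e < \<infinity>" by (metis ennreal_less_top infinity_ennreal_def order_le_less_trans)
    moreover have "enn2real ?e \<le> b" using e b by (rule enn2real_leI[rotated])
    ultimately show "f \<in> Lq \<infinity> A \<and> Lq_norm \<infinity> A f \<le> b" using f' by (simp add: Lq_def Lq_norm_def)
  qed
  with * show "f \<in> Lq \<infinity> A \<and> Lq_norm \<infinity> A f \<le> b \<longleftrightarrow> (AE x in lborel. x \<in> A \<longrightarrow> norm (f x) \<le> b)" by simp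
qed

lemma enn2real_ge_1: "1 \<le> q \<Longrightarrow> q \<noteq> \<infinity> \<Longrightarrow> 1 \<le> enn2real q"
  using enn2real_mono[of 1 q] by (simp add: top.not_eq_extremum)

lemma Lq_finite_iff:
  assumes A: "A \<in> sets lebesgue" and f: "f \<in> borel_measurable lebesgue" and b: "0 \<le> b" and q: "1 \<le> q" "q \<noteq> \<infinity>"
  shows "f \<in> Lq q A \<and> Lq_norm q A f \<le> b \<longleftrightarrow>
    (\<integral>\<^sup>+x. indicator A x * ennreal (norm (f x) powr enn2real q) \<partial>lborel) \<le> ennreal (b powr enn2real q)"
proof -
  let ?p = "enn2real q"
  have p: "?p > 0"
    using enn2real_ge_1[OF q] by simp
  let ?I = "\<integral>\<^sup>+x. indicator A x * ennreal (norm (f x) powr ?p) \<partial>lborel"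
  have mem: "f \<in> Lq q A \<longleftrightarrow> ?I < \<infinity>"
    using q by (simp add: Lq_def nn_integral_lebesgue_on[OF A] measurable_lebesgue_on[OF f])
  have nrm: "Lq_norm q A f = enn2real ?I powr (1 / ?p)"
    using q by (simp add: Lq_norm_def nn_integral_lebesgue_on[OF A])
  have le: "enn2real ?I powr (1 / ?p) \<le> b \<longleftrightarrow> enn2real ?I \<le> b powr ?p"
  proof
    assume "enn2real ?I powr (1 / ?p) \<le> b"
    then have "(enn2real ?I powr (1 / ?p)) powr ?p \<le> b powr ?p" using p by (intro powr_mono2) auto
    then show "enn2real ?I \<le> b powr ?p" using p by (simp add: powr_powr)
  next
    assume "enn2real ?I \<le> b powr ?p"
    then have "enn2real ?I powr (1 / ?p) \<le> (b powr ?p) powr (1 / ?p)" using p by (intro powr_mono2) auto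
    then show "enn2real ?I powr (1 / ?p) \<le> b" using p b by (simp add: powr_powr)
  qed
  show ?thesis
  proof
    assume "f \<in> Lq q A \<and> Lq_norm q A f \<le> b"
    then have "?I < \<infinity>" "enn2real ?I \<le> b powr ?p" by (simp_all add: mem nrm le)
    then show "?I \<le> ennreal (b powr ?p)"
      using ennreal_leI[of "enn2real ?I" "b powr ?p"] by (simp only: ennreal_enn2real infinity_ennreal_def)
  next
    assume I: "?I \<le> ennreal (b powr ?p)"
    then have "?I < \<infinity>" by (rule order_le_less_trans) simp
    moreover have "enn2real ?I \<le> b powr ?p" using I by (intro enn2real_leI) auto
    ultimately show "f \<in> Lq q A \<and> Lq_norm q A f \<le> b" by (simp add: mem nrm le)
  qed
qed

section \<open>Description of the spaces by bounds on balls\<close>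

definition dim_exp :: "'n::finite itself \<Rightarrow> ennreal \<Rightarrow> real" where
  "dim_exp _ q = (if q = \<infinity> then 0 else real CARD('n) / enn2real q)"

text \<open>The bound \<open>b R\<^sup>N\<^sup>/\<^sup>q\<close> on the norm over the ball of radius \<open>R\<close>, without reference to norms.\<close>

definition ball_bound :: "ennreal \<Rightarrow> (real ^ 'n::finite \<Rightarrow> complex) \<Rightarrow> real \<Rightarrow> real \<Rightarrow> bool" where
  "ball_bound q f R b \<longleftrightarrow>
    (if q = \<infinity> then AE x in lborel. x \<in> ball 0 R \<longrightarrow> norm (f x) \<le> b
     else ball_int (\<lambda>x. ennreal (norm (f x) powr enn2real q)) R \<le> ennreal (b powr enn2real q * R powr CARD('n)))"

lemma ball_bound_iff:
  fixes f :: "real ^ 'n::finite \<Rightarrow> complex"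
  assumes f: "f \<in> borel_measurable lebesgue" and b: "0 \<le> b" and R: "0 < R" and q: "1 \<le> q"
  shows "ball_bound q f R b \<longleftrightarrow> f \<in> Lq q (ball 0 R) \<and> Lq_norm q (ball 0 R) f \<le> b * R powr dim_exp TYPE('n) q"
proof (cases "q = \<infinity>")
  case True
  with Lq_infinity_iff(1)[OF _ f b, of "ball 0 R"] show ?thesis using R by (simp add: ball_bound_def dim_exp_def)
next
  case False
  have "(b * R powr dim_exp TYPE('n) q) powr enn2real q = b powr enn2real q * R powr CARD('n)"
    using b R enn2real_ge_1[OF q False] False by (simp add: powr_mult powr_powr dim_exp_def)
  with Lq_finite_iff[OF _ f _ q False, of "ball 0 R" "b * R powr dim_exp TYPE('n) q"] b False show ?thesis
    by (simp add: ball_bound_def ball_int_def)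
qed

lemma ball_bound_cong:
  assumes "AE x in lborel. f x = f' x"
  shows "ball_bound q f R b \<longleftrightarrow> ball_bound q f' R b"
proof (cases "q = \<infinity>")
  case True
  have "(AE x in lborel. x \<in> ball 0 R \<longrightarrow> norm (f x) \<le> b) \<longleftrightarrow> (AE x in lborel. x \<in> ball 0 R \<longrightarrow> norm (f' x) \<le> b)"
  proof
    assume "AE x in lborel. x \<in> ball 0 R \<longrightarrow> norm (f x) \<le> b"
    with assms show "AE x in lborel. x \<in> ball 0 R \<longrightarrow> norm (f' x) \<le> b" by eventually_elim simp
  next
    assume "AE x in lborel. x \<in> ball 0 R \<longrightarrow> norm (f' x) \<le> b"
    with assms show "AE x in lborel. x \<in> ball 0 R \<longrightarrow> norm (f x) \<le> b" by eventually_elim simp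
  qed
  with True show ?thesis by (simp add: ball_bound_def)
next
  case False
  have "ball_int (\<lambda>x. ennreal (norm (f x) powr enn2real q)) R = ball_int (\<lambda>x. ennreal (norm (f' x) powr enn2real q)) R"
    unfolding ball_int_def using assms by (intro nn_integral_cong_AE) (auto elim: eventually_mono)
  with False show ?thesis by (simp add: ball_bound_def)
qed

lemma growth_quot_le_iff:
  fixes f :: "real ^ 'n::finite \<Rightarrow> complex"
  assumes f: "f \<in> borel_measurable lebesgue" "f \<in> Lq q (ball 0 R)" and b: "0 \<le> b" and R: "0 < R" and q: "1 \<le> q"
  shows "growth_quot s q f R \<le> b \<longleftrightarrow> ball_bound q f R (b * R powr s)"
proof -
  let ?d = "dim_exp TYPE('n) q"
  have eq: "growth_quot s q f R = R powr (- (s + ?d)) * Lq_norm q (ball 0 R) f"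
    by (simp add: growth_quot_def dim_exp_def)
  have "growth_quot s q f R \<le> b \<longleftrightarrow> Lq_norm q (ball 0 R) f \<le> b * R powr (s + ?d)"
    unfolding eq powr_minus using R by (simp add: field_simps)
  also have "\<dots> \<longleftrightarrow> ball_bound q f R (b * R powr s)"
    using f R b by (subst ball_bound_iff[OF f(1) _ R q]) (auto simp: powr_add mult.assoc)
  finally show ?thesis .
qed

lemma growth_quot_nonneg: "0 \<le> growth_quot s q f R"
  by (simp add: growth_quot_def Lq_norm_def)

text \<open>Passing to a smaller ball changes the normalisation from R^(N/q) to r^(N/q); since r
  \<ge> 1, the factor R^(N/q) makes up for it. It is applied to radii below a fixed R.\<close>

lemma ball_bound_mono_radius:
  fixes f :: "real ^ 'n::finite \<Rightarrow> complex"
  assumes "ball_bound q f R b" "1 \<le> r" "r \<le> R" "1 \<le> q" "0 \<le> b"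
  shows "ball_bound q f r (b * (R powr dim_exp TYPE('n) q))"
proof (cases "q = \<infinity>")
  case True
  have "AE x in lborel. x \<in> ball 0 R \<longrightarrow> norm (f x) \<le> b" using assms(1) True by (simp add: ball_bound_def)
  then have "AE x in lborel. x \<in> ball 0 r \<longrightarrow> norm (f x) \<le> b" by eventually_elim (use assms(3) in auto)
  then show ?thesis using True assms by (simp add: ball_bound_def dim_exp_def)
next
  case False
  let ?p = "enn2real q"
  have p: "1 \<le> ?p" using enn2real_ge_1 assms False by blast
  have "ball_int (\<lambda>x. ennreal (norm (f x) powr ?p)) r \<le> ball_int (\<lambda>x. ennreal (norm (f x) powr ?p)) R"
    by (rule ball_int_mono[OF assms(3)])
  also have "\<dots> \<le> ennreal (b powr ?p * R powr CARD('n))"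
    using assms(1) False by (simp add: ball_bound_def)
  also have "b powr ?p * R powr CARD('n) = (b * R powr dim_exp TYPE('n) q) powr ?p * 1"
    using False p assms by (simp add: powr_mult powr_powr dim_exp_def)
  also have "\<dots> \<le> (b * R powr dim_exp TYPE('n) q) powr ?p * r powr CARD('n)"
    using assms by (intro mult_left_mono ge_one_powr_ge_zero) auto
  finally show ?thesis using False by (simp add: ball_bound_def ennreal_leI)
qed

lemma ball_bound_mono:
  assumes "ball_bound q f R b" "b \<le> b'" "0 \<le> b" "1 \<le> q"
  shows "ball_bound q f R b'"
proof (cases "q = \<infinity>")
  case True
  then show ?thesis using assms by (auto simp: ball_bound_def elim!: eventually_mono)
next
  case False
  have "ennreal (b powr enn2real q * R powr CARD('a)) \<le> ennreal (b' powr enn2real q * R powr CARD('a))"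
    using assms enn2real_ge_1[OF assms(4) False] by (intro ennreal_leI mult_right_mono powr_mono2) auto
  moreover have "ball_int (\<lambda>x. ennreal (norm (f x) powr enn2real q)) R \<le> ennreal (b powr enn2real q * R powr CARD('a))"
    using False assms(1) by (simp add: ball_bound_def)
  ultimately have "ball_int (\<lambda>x. ennreal (norm (f x) powr enn2real q)) R \<le> ennreal (b' powr enn2real q * R powr CARD('a))"
    by (rule order_trans[rotated])
  then show ?thesis using False by (simp add: ball_bound_def)
qed

lemma Lq_loc_ball: "f \<in> Lq_loc q \<Longrightarrow> f \<in> Lq q (ball (0 :: real ^ 'n::finite) R)"
proof -
  assume "f \<in> Lq_loc q"
  then have f: "f \<in> borel_measurable lebesgue" and K: "f \<in> Lq q (cball 0 R)" by (auto simp: Lq_loc_def)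
  show "f \<in> Lq q (ball 0 R)"
  proof (cases "q = \<infinity>")
    case True
    define b where "b = Lq_norm \<infinity> (cball 0 R) f"
    have "0 \<le> b" by (simp add: b_def Lq_norm_def)
    then have "AE x in lborel. x \<in> cball 0 R \<longrightarrow> norm (f x) \<le> b"
      using Lq_infinity_iff(1)[of "cball 0 R" f b] f K True by (simp add: b_def)
    then have "AE x in lborel. x \<in> ball 0 R \<longrightarrow> norm (f x) \<le> b" by eventually_elim auto
    then show ?thesis using Lq_infinity_iff(1)[of "ball 0 R" f b] f True \<open>0 \<le> b\<close> by simp
  next
    case False
    have "(\<integral>\<^sup>+x. indicator (ball 0 R) x * ennreal (norm (f x) powr enn2real q) \<partial>lborel)
      \<le> (\<integral>\<^sup>+x. indicator (cball 0 R) x * ennreal (norm (f x) powr enn2real q) \<partial>lborel)"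
      by (intro nn_integral_mono) (auto simp: indicator_def)
    also have "\<dots> < \<infinity>" using K False by (simp add: Lq_def nn_integral_lebesgue_on)
    finally show ?thesis using False f by (simp add: Lq_def nn_integral_lebesgue_on measurable_lebesgue_on)
  qed
qed

text \<open>The exponent r = q serves membership in the spaces, r = 1 the representation of
  distributions. For finite q the second case rests on x \<le> 1 + x^q, integrated over the bounded
  set K.\<close>

lemma Lq_locI:
  fixes f :: "real ^ 'n::finite \<Rightarrow> complex"
  assumes f: "f \<in> borel_measurable lebesgue" and bnd: "\<And>R. 1 \<le> R \<Longrightarrow> \<exists>b. ball_bound q f R b" and q: "1 \<le> q" and r: "r = 1 \<or> r = q"
  shows "f \<in> Lq_loc r"
  unfolding Lq_loc_def
proof (intro CollectI conjI f allI impI)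
  fix K :: "(real ^ 'n) set" assume "compact K"
  then have K: "K \<in> sets lebesgue" "bounded K" by (auto intro: compact_imp_bounded simp: compact_imp_closed)
  obtain R where "K \<subseteq> ball 0 R" using bounded_subset_ballD[OF K(2)] by blast
  then have R: "K \<subseteq> ball 0 (max 1 R)" by (auto simp: subset_iff)
  obtain b where b: "ball_bound q f (max 1 R) b" using bnd[of "max 1 R"] by auto
  show "f \<in> Lq r K"
  proof (cases "q = \<infinity>")
    case True
    then have "AE x in lborel. x \<in> ball 0 (max 1 R) \<longrightarrow> norm (f x) \<le> b" using b by (simp add: ball_bound_def)
    then have AE: "AE x in lborel. x \<in> K \<longrightarrow> norm (f x) \<le> \<bar>b\<bar>" by eventually_elim (use R in fastforce)
    show ?thesis
    proof (cases "r = \<infinity>")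
      case True
      then show ?thesis using Lq_infinity_iff(1)[OF K(1) f, of "\<bar>b\<bar>"] AE by simp
    next
      case False
      then have "r = 1" using r True by auto
      have "(\<integral>\<^sup>+x. indicator K x * ennreal (norm (f x)) \<partial>lborel) \<le> (\<integral>\<^sup>+x. ennreal \<bar>b\<bar> * indicator K x \<partial>lborel)"
        using AE by (intro nn_integral_mono_AE) (auto simp: indicator_def intro!: ennreal_leI elim!: eventually_mono)
      also have "\<dots> = ennreal \<bar>b\<bar> * emeasure lborel K"
        using \<open>compact K\<close> by (intro nn_integral_cmult_indicator) (auto intro: borel_compact)
      also have "\<dots> < \<infinity>" using emeasure_bounded_finite[OF K(2)] by (simp add: ennreal_mult_less_top)
      finally show ?thesis
        unfolding \<open>r = 1\<close> by (simp add: Lq_def nn_integral_lebesgue_on[OF K(1)] measurable_lebesgue_on[OF f])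
    qed
  next
    case False
    let ?p = "enn2real q"
    have "(\<integral>\<^sup>+x. indicator K x * ennreal (norm (f x) powr ?p) \<partial>lborel) \<le> ball_int (\<lambda>x. ennreal (norm (f x) powr ?p)) (max 1 R)"
      unfolding ball_int_def using R by (intro nn_integral_mono) (auto simp: indicator_def)
    also have "\<dots> \<le> ennreal (b powr ?p * max 1 R powr CARD('n))" using b False by (simp add: ball_bound_def)
    also have "\<dots> < \<infinity>" by simp
    finally have I: "(\<integral>\<^sup>+x. indicator K x * ennreal (norm (f x) powr ?p) \<partial>lborel) < \<infinity>" .
    show ?thesis
    proof (cases "r = q")
      case True
      then show ?thesis using False I by (simp add: Lq_def nn_integral_lebesgue_on[OF K(1)] measurable_lebesgue_on[OF f])
    next
      case r1: False
      then have "r = 1" using r by auto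
      have p: "1 \<le> ?p" using enn2real_ge_1 q False by blast
      have "ennreal x \<le> 1 + ennreal (x powr ?p)" if "0 \<le> x" for x :: real
      proof -
        have "x \<le> 1 + x powr ?p"
        proof (cases "x \<le> 1")
          case False
          then have "x powr 1 \<le> x powr ?p" using p by (intro powr_mono) auto
          with False show ?thesis by simp
        qed (auto intro: add_increasing2)
        from ennreal_leI[OF this] show ?thesis by (simp add: ennreal_plus)
      qed
      then have "(\<integral>\<^sup>+x. indicator K x * ennreal (norm (f x)) \<partial>lborel) \<le> (\<integral>\<^sup>+x. indicator K x + indicator K x * ennreal (norm (f x) powr ?p) \<partial>lborel)"
        by (intro nn_integral_mono) (auto simp: indicator_def)
      also have "\<dots> = (\<integral>\<^sup>+x. indicator K x \<partial>lebesgue) + (\<integral>\<^sup>+x. indicator K x * ennreal (norm (f x) powr ?p) \<partial>lebesgue)"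
        unfolding nn_integral_completion[symmetric, of lborel] using K f by (intro nn_integral_add) auto
      also have "\<dots> < \<infinity>" using I emeasure_bounded_finite[OF K(2)] \<open>compact K\<close>
        by (simp add: nn_integral_completion borel_compact)
      finally show ?thesis
        unfolding \<open>r = 1\<close> by (simp add: Lq_def nn_integral_lebesgue_on[OF K(1)] measurable_lebesgue_on[OF f])
    qed
  qed
qed

lemma M_space_ball_bound:
  fixes f :: "real ^ 'n::finite \<Rightarrow> complex"
  assumes q: "1 \<le> q"
  shows "f \<in> M_space s q \<longleftrightarrow> f \<in> borel_measurable lebesgue \<and> (\<exists>E\<ge>0. \<forall>R\<ge>1. ball_bound q f R (E * R powr s))"
proof
  assume f: "f \<in> M_space s q"
  then have loc: "f \<in> Lq_loc q" and m: "f \<in> borel_measurable lebesgue" by (auto simp: M_space_def Lq_loc_def)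
  obtain E where E: "\<And>R. 1 \<le> R \<Longrightarrow> growth_quot s q f R \<le> E"
    using f by (auto simp: M_space_def bdd_above_def)
  have "ball_bound q f R (\<bar>E\<bar> * R powr s)" if "1 \<le> R" for R
  proof (rule iffD1[OF growth_quot_le_iff[OF m Lq_loc_ball[OF loc] _ _ q]])
    show "growth_quot s q f R \<le> \<bar>E\<bar>" using E[OF that] by simp
  qed (use that in simp_all)
  then show "f \<in> borel_measurable lebesgue \<and> (\<exists>E\<ge>0. \<forall>R\<ge>1. ball_bound q f R (E * R powr s))"
    using m by (intro conjI exI[of _ "\<bar>E\<bar>"]) auto
next
  assume "f \<in> borel_measurable lebesgue \<and> (\<exists>E\<ge>0. \<forall>R\<ge>1. ball_bound q f R (E * R powr s))"
  then obtain E where m: "f \<in> borel_measurable lebesgue" and E: "E \<ge> 0" "\<And>R. 1 \<le> R \<Longrightarrow> ball_bound q f R (E * R powr s)"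
    by blast
  have "\<exists>b. ball_bound q f R b" if "1 \<le> R" for R using E(2)[OF that] by (rule exI)
  then have loc: "f \<in> Lq_loc q" using Lq_locI[OF m _ q] by simp
  have "growth_quot s q f R \<le> E" if "1 \<le> R" for R
    using that by (intro iffD2[OF growth_quot_le_iff[OF m Lq_loc_ball[OF loc] E(1) _ q] E(2)]) simp_all
  then show "f \<in> M_space s q" using loc by (auto simp: M_space_def bdd_above_def)
qed

text \<open>Once the quotient is below \<epsilon> beyond R0, the radii in [1, R0] remain; there
  R^\<sigma> is bounded below, so a large A absorbs them. Conversely A R^(\<sigma> - s) tends to
  0.\<close>

lemma M0_space_ball_bound:
  fixes f :: "real ^ 'n::finite \<Rightarrow> complex"
  assumes q: "1 \<le> q" and \<sigma>: "\<sigma> < s"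
  shows "f \<in> M0_space s q \<longleftrightarrow> f \<in> borel_measurable lebesgue \<and>
    (\<forall>\<epsilon>>0. \<exists>A\<ge>0. \<forall>R\<ge>1. ball_bound q f R (\<epsilon> * R powr s + A * R powr \<sigma>))"
proof
  assume f: "f \<in> M0_space s q"
  then have loc: "f \<in> Lq_loc q" and m: "f \<in> borel_measurable lebesgue"
    and lim: "(growth_quot s q f \<longlongrightarrow> 0) at_top" by (auto simp: M0_space_def Lq_loc_def)
  note iff = growth_quot_le_iff[OF m Lq_loc_ball[OF loc]]
  have "\<exists>A\<ge>0. \<forall>R\<ge>1. ball_bound q f R (\<epsilon> * R powr s + A * R powr \<sigma>)" if \<epsilon>: "\<epsilon> > 0" for \<epsilon>
  proof -
    have "eventually (\<lambda>R. growth_quot s q f R < \<epsilon>) at_top" using lim \<epsilon> by (rule order_tendstoD(2))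
    then obtain R1 where R1: "\<And>R. R1 \<le> R \<Longrightarrow> growth_quot s q f R < \<epsilon>" by (auto simp: eventually_at_top_linorder)
    define R0 where "R0 = max 1 R1"
    have R0: "1 \<le> R0" "\<And>R. R0 \<le> R \<Longrightarrow> ball_bound q f R (\<epsilon> * R powr s)"
    proof -
      fix R assume "R0 \<le> R"
      then have "0 < R" "R1 \<le> R" by (auto simp: R0_def)
      then show "ball_bound q f R (\<epsilon> * R powr s)"
        using R1[of R] iff[of \<epsilon> R s] \<epsilon> q by simp
    qed (simp add: R0_def)
    define B where "B = \<epsilon> * R0 powr s * R0 powr dim_exp TYPE('n) q"
    have B: "B \<ge> 0" using \<epsilon> by (simp add: B_def)
    \<comment> \<open>The two summands serve the two signs of \<sigma>: on [1, R0] the power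
      R^\<sigma> is at least 1 if \<sigma> \<ge> 0, and at least R0^\<sigma> otherwise.\<close>
    define A where "A = B * (1 + R0 powr (- \<sigma>))"
    have A: "A \<ge> 0" using B by (simp add: A_def)
    have "ball_bound q f R (\<epsilon> * R powr s + A * R powr \<sigma>)" if R: "1 \<le> R" for R
    proof (cases "R0 \<le> R")
      case True
      then show ?thesis
        using \<epsilon> A by (intro ball_bound_mono[OF R0(2)[OF True] _ _ q]) auto
    next
      case False
      then have "ball_bound q f R B"
        unfolding B_def using R \<epsilon> by (intro ball_bound_mono_radius[OF R0(2)] q) auto
      moreover have "B \<le> A * R powr \<sigma>"
      proof -
        have "1 \<le> (1 + R0 powr (- \<sigma>)) * R powr \<sigma>"
        proof (cases "\<sigma> \<ge> 0")
          case True
          have "1 * 1 \<le> (1 + R0 powr (- \<sigma>)) * R powr \<sigma>"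
            using R True by (intro mult_mono ge_one_powr_ge_zero) auto
          then show ?thesis by simp
        next
          case neg: False
          have "R0 powr \<sigma> \<le> R powr \<sigma>" using R False neg by (intro powr_mono2') auto
          then have "R0 powr (- \<sigma>) * R0 powr \<sigma> \<le> (1 + R0 powr (- \<sigma>)) * R powr \<sigma>"
            by (intro mult_mono) auto
          then show ?thesis using R0(1) by (simp add: powr_add[symmetric])
        qed
        from mult_left_mono[OF this B] show ?thesis by (simp add: A_def mult.assoc)
      qed
      then have "B \<le> \<epsilon> * R powr s + A * R powr \<sigma>" using \<epsilon> by (simp add: add_increasing)
      ultimately show ?thesis by (rule ball_bound_mono[OF _ _ B q])
    qed
    then show ?thesis using A by blast
  qed
  with m show "f \<in> borel_measurable lebesgue \<and>
    (\<forall>\<epsilon>>0. \<exists>A\<ge>0. \<forall>R\<ge>1. ball_bound q f R (\<epsilon> * R powr s + A * R powr \<sigma>))" by blast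
next
  assume "f \<in> borel_measurable lebesgue \<and>
    (\<forall>\<epsilon>>0. \<exists>A\<ge>0. \<forall>R\<ge>1. ball_bound q f R (\<epsilon> * R powr s + A * R powr \<sigma>))"
  then have m: "f \<in> borel_measurable lebesgue"
    and b: "\<And>\<epsilon>. \<epsilon> > 0 \<Longrightarrow> \<exists>A\<ge>0. \<forall>R\<ge>1. ball_bound q f R (\<epsilon> * R powr s + A * R powr \<sigma>)" by blast+
  have "\<exists>b. ball_bound q f R b" if "1 \<le> R" for R using b[of 1] that by auto
  then have loc: "f \<in> Lq_loc q" using Lq_locI[OF m _ q] by simp
  have "(growth_quot s q f \<longlongrightarrow> 0) at_top"
  proof (rule tendstoI)
    fix e :: real assume e: "e > 0"
    obtain A where A: "A \<ge> 0" "\<And>R. 1 \<le> R \<Longrightarrow> ball_bound q f R (e / 2 * R powr s + A * R powr \<sigma>)"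
      using b[of "e / 2"] e by auto
    have "((\<lambda>R. A * R powr (\<sigma> - s)) \<longlongrightarrow> A * 0) at_top"
      using \<sigma> by (intro tendsto_mult tendsto_const tendsto_neg_powr filterlim_ident) auto
    then have "eventually (\<lambda>R. A * R powr (\<sigma> - s) < e / 2) at_top"
      using e by (intro order_tendstoD(2)[where y = "A * 0"]) auto
    then show "eventually (\<lambda>R. dist (growth_quot s q f R) 0 < e) at_top"
      using eventually_ge_at_top[of 1]
    proof eventually_elim
      case (elim R)
      have "e / 2 * R powr s + A * R powr \<sigma> = (e / 2 + A * R powr (\<sigma> - s)) * R powr s"
        using elim(2) by (simp add: powr_diff field_simps)
      then have "ball_bound q f R ((e / 2 + A * R powr (\<sigma> - s)) * R powr s)"
        using A(2)[OF elim(2)] by (simp only:)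
      then have "growth_quot s q f R \<le> e / 2 + A * R powr (\<sigma> - s)"
        using A(1) elim(2) e by (intro iffD2[OF growth_quot_le_iff[OF m Lq_loc_ball[OF loc] _ _ q]]) (auto intro: add_nonneg_nonneg)
      with elim show ?case using growth_quot_nonneg[of s q f R] by simp
    qed
  qed
  with loc show "f \<in> M0_space s q" by (simp add: M0_space_def)
qed


section \<open>Representatives for pointwise estimates\<close>

text \<open>A representative that is bounded everywhere, not just almost everywhere, on each ball by its
  essential supremum there; averages along single segments are sensitive to null sets.\<close>

definition regular :: "(real ^ 'n::finite \<Rightarrow> complex) \<Rightarrow> bool" where
  "regular f \<longleftrightarrow> f \<in> borel_measurable borel \<and> (\<forall>n x. x \<in> ball 0 (real n) \<longrightarrow>
     ennreal (norm (f x)) \<le> esssup (lebesgue_on (ball 0 (real n))) (\<lambda>x. ennreal (norm (f x))))"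

lemma borel_measurable_lebesgue: "f \<in> borel_measurable borel \<Longrightarrow> f \<in> borel_measurable lebesgue"
  by (rule measurable_completion) simp

text \<open>A Borel version is set to 0 on a Borel null set that contains all violations of the
  countably many bounds for integer radii. The last property transfers limits at infinity from f to
  f0.\<close>

lemma ex_regular_representative:
  fixes f :: "real ^ 'n::finite \<Rightarrow> complex"
  assumes f: "f \<in> borel_measurable lebesgue"
  obtains f0 where "regular f0" "AE x in lborel. f x = f0 x" "\<And>x. f0 x = f x \<or> f0 x = 0"
proof -
  define e where "e n = esssup (lebesgue_on (ball 0 (real n))) (\<lambda>x. ennreal (norm (f x)))" for n
  obtain r i where ri [measurable]: "r \<in> borel_measurable lborel" "i \<in> borel_measurable lborel"
    and ae: "AE x in lborel. Re (f x) = r x" "AE x in lborel. Im (f x) = i x"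
    using completion_ex_borel_measurable_real[of "\<lambda>x. Re (f x)" lborel]
      completion_ex_borel_measurable_real[of "\<lambda>x. Im (f x)" lborel] f
    by (auto intro: borel_measurable_Re borel_measurable_Im)
  define f1 where "f1 x = complex_of_real (r x) + \<i> * complex_of_real (i x)" for x
  have f1 [measurable]: "f1 \<in> borel_measurable borel" using ri unfolding f1_def by simp
  have "AE x in lborel. \<forall>n. x \<in> ball 0 (real n) \<longrightarrow> ennreal (norm (f x)) \<le> e n"
    unfolding AE_all_countable
  proof
    fix n
    show "AE x in lborel. x \<in> ball 0 (real n) \<longrightarrow> ennreal (norm (f x)) \<le> e n"
      using esssup_AE[of "\<lambda>x. ennreal (norm (f x))" "lebesgue_on (ball 0 (real n))"]
      unfolding e_def by (subst (asm) AE_lebesgue_on) auto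
  qed
  with ae have "AE x in lborel. f x = f1 x \<and> (\<forall>n. x \<in> ball 0 (real n) \<longrightarrow> ennreal (norm (f x)) \<le> e n)"
    by eventually_elim (auto simp: f1_def complex_eq_iff)
  then obtain N where N: "{x \<in> space lborel. \<not> (f x = f1 x \<and> (\<forall>n. x \<in> ball 0 (real n) \<longrightarrow> ennreal (norm (f x)) \<le> e n))} \<subseteq> N"
    "emeasure lborel N = 0" "N \<in> sets lborel"
    by (rule AE_E)
  then have [measurable]: "N \<in> sets borel" by simp
  have N': "f x = f1 x" "x \<in> ball 0 (real n) \<Longrightarrow> ennreal (norm (f x)) \<le> e n" if "x \<notin> N" for x n
  proof -
    have "f x = f1 x \<and> (\<forall>n. x \<in> ball 0 (real n) \<longrightarrow> ennreal (norm (f x)) \<le> e n)"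
    proof (rule ccontr)
      assume "\<not> ?thesis"
      then have "x \<in> {x \<in> space lborel. \<not> (f x = f1 x \<and> (\<forall>n. x \<in> ball 0 (real n) \<longrightarrow> ennreal (norm (f x)) \<le> e n))}"
        by simp
      with N(1) that show False by blast
    qed
    then show "f x = f1 x" "x \<in> ball 0 (real n) \<Longrightarrow> ennreal (norm (f x)) \<le> e n" by blast+
  qed
  define f0 where "f0 x = (if x \<in> N then 0 else f1 x)" for x
  have f0 [measurable]: "f0 \<in> borel_measurable borel" unfolding f0_def by measurable
  have "AE x in lborel. x \<notin> N" using N by (intro AE_not_in) (auto simp: null_sets_def)
  then have AE: "AE x in lborel. f x = f0 x" by eventually_elim (simp add: f0_def N')
  have "esssup (lebesgue_on (ball 0 (real n))) (\<lambda>x. ennreal (norm (f0 x))) = e n" for n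
    unfolding e_def
  proof (rule esssup_AE_cong)
    have "f0 \<in> borel_measurable (lebesgue_on (ball 0 (real n)))" "f \<in> borel_measurable (lebesgue_on (ball 0 (real n)))"
      by (intro measurable_lebesgue_on borel_measurable_lebesgue f f0)+
    then show "(\<lambda>x. ennreal (norm (f0 x))) \<in> borel_measurable (lebesgue_on (ball 0 (real n)))"
        "(\<lambda>x. ennreal (norm (f x))) \<in> borel_measurable (lebesgue_on (ball 0 (real n)))"
      by measurable
    show "AE x in lebesgue_on (ball 0 (real n)). ennreal (norm (f0 x)) = ennreal (norm (f x))"
      using AE by (subst AE_lebesgue_on) (auto elim: eventually_mono)
  qed
  then have "regular f0"
    using N' f0 by (auto simp: regular_def f0_def)
  moreover have "f0 x = f x \<or> f0 x = 0" for x by (simp add: f0_def N')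
  ultimately show ?thesis using AE that by blast
qed

lemma regular_pointwise:
  assumes "regular f" "ball_bound \<infinity> f (real n) b" "0 \<le> b" "norm x < real n"
  shows "norm (f x) \<le> b"
proof -
  have "f \<in> borel_measurable lebesgue" using assms(1) by (auto simp: regular_def intro: borel_measurable_lebesgue)
  then have "esssup (lebesgue_on (ball 0 (real n))) (\<lambda>x. ennreal (norm (f x))) \<le> ennreal b"
    using assms(2,3) by (subst Lq_infinity_iff(2)) (auto simp: ball_bound_def)
  moreover have "ennreal (norm (f x)) \<le> esssup (lebesgue_on (ball 0 (real n))) (\<lambda>x. ennreal (norm (f x)))"
    using assms(1,4) by (simp add: regular_def)
  ultimately have "ennreal (norm (f x)) \<le> ennreal b" by (rule order_trans[rotated])
  then show ?thesis using assms(3) by (subst (asm) ennreal_le_iff) auto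
qed

text \<open>The bridge from Lebesgue measurable functions, in which the spaces are defined, to Borel
  functions and \<open>lborel\<close>, where the fluxes and product measures live.\<close>

lemma Lq_loc_1_representative:
  fixes f :: "real ^ 'n::finite \<Rightarrow> complex"
  assumes f: "f \<in> Lq_loc 1" and f0 [measurable]: "f0 \<in> borel_measurable borel" and AE: "AE x in lborel. f x = f0 x"
  shows "locally_integrable f0"
    and "\<phi> \<in> test_functions \<Longrightarrow> integral\<^sup>L lebesgue (\<lambda>x. f x * \<phi> x) = (\<integral>x. f0 x * \<phi> x \<partial>lborel)"
proof -
  show "locally_integrable f0"
    unfolding locally_integrable_def
  proof (intro conjI f0 allI integrableI_bounded)
    fix r :: real
    have "(\<integral>\<^sup>+x. ennreal (norm (of_real (indicator (ball 0 r) x) * f0 x)) \<partial>lborel) = (\<integral>\<^sup>+x. indicator (ball 0 r) x * ennreal (norm (f x)) \<partial>lborel)"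
      using AE by (intro nn_integral_cong_AE) (auto elim!: eventually_mono simp: norm_mult indicator_def)
    also have "\<dots> < \<infinity>"
      using Lq_loc_ball[OF f, of r] by (simp add: Lq_def nn_integral_lebesgue_on)
    finally show "(\<integral>\<^sup>+x. ennreal (norm (of_real (indicator (ball 0 r) x) * f0 x)) \<partial>lborel) < \<infinity>" .
  qed measurable
  assume \<phi>: "\<phi> \<in> test_functions"
  note [measurable] = test_borel[OF \<phi>]
  have "integral\<^sup>L lebesgue (\<lambda>x. f x * \<phi> x) = integral\<^sup>L lebesgue (\<lambda>x. f0 x * \<phi> x)"
  proof (rule integral_cong_AE)
    show "(\<lambda>x. f x * \<phi> x) \<in> borel_measurable lebesgue" "(\<lambda>x. f0 x * \<phi> x) \<in> borel_measurable lebesgue"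
      using f borel_measurable_lebesgue[OF f0] borel_measurable_lebesgue[OF test_borel[OF \<phi>]]
      by (auto simp: Lq_loc_def intro!: borel_measurable_times)
    show "AE x in lebesgue. f x * \<phi> x = f0 x * \<phi> x"
      unfolding AE_completion_iff using AE by eventually_elim simp
  qed
  also have "\<dots> = (\<integral>x. f0 x * \<phi> x \<partial>lborel)"
    by (rule integral_completion) simp
  finally show "integral\<^sup>L lebesgue (\<lambda>x. f x * \<phi> x) = (\<integral>x. f0 x * \<phi> x \<partial>lborel)" .
qed

text \<open>In K, the summand 1 takes care of C; 4 N is the factor 2 in the bound for g, a factor 2
  from norm (y - x) \<le> 2 R and the number of components; the powers of 2 pay for rounding the
  radius.\<close>

lemma growth_infinite:
  fixes f :: "'n::finite \<Rightarrow> real ^ 'n \<Rightarrow> complex" and s \<sigma> C E A R :: real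
  assumes w: "w \<in> test_functions" "\<And>x. 1 \<le> norm x \<Longrightarrow> w x = 0" "(\<integral>\<^sup>+x. ennreal (norm (w x)) \<partial>lborel) = 1"
    and \<sigma>: "-1 < \<sigma>"
    and f: "\<And>i. regular (f i)" and nn: "0 \<le> C" "0 \<le> E" "0 \<le> A"
    and bnd: "\<And>i r. 1 \<le> r \<Longrightarrow> ball_bound \<infinity> (f i) r (E * r powr s + A * r powr \<sigma>)"
    and g: "\<And>y. ennreal (norm (g y)) \<le> ennreal C + 2 * (\<Sum>i\<in>UNIV. seg_avg w (f i) y)" and R: "1 \<le> R"
  defines "K \<equiv> 1 + 4 * real CARD('n) * (2 powr \<bar>s\<bar> + 2 powr \<bar>\<sigma>\<bar>)"
  shows "ball_bound \<infinity> g R (K * E * R powr (s + 1) + K * (A + C) * R powr (\<sigma> + 1))"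
proof -
  let ?P = "2 powr \<bar>s\<bar> + 2 powr \<bar>\<sigma>\<bar>"
  \<comment> \<open>\<open>regular\<close> controls balls of integer radius only. Rounding R up at
    most doubles it, because R \<ge> 1.\<close>
  define n where "n = nat \<lceil>R\<rceil>"
  have n: "R \<le> real n" "real n \<le> 2 * R" "1 \<le> real n" using R by (auto simp: n_def) linarith+
  define b where "b = E * real n powr s + A * real n powr \<sigma>"
  have b0: "0 \<le> b" using nn by (simp add: b_def)
  have "norm (g y) \<le> K * E * R powr (s + 1) + K * (A + C) * R powr (\<sigma> + 1)" if y: "norm y < R" for y
  proof -
    have fb: "norm (f i (x + t *\<^sub>R (y - x))) * norm (y - x) \<le> (b * (2 * R)) * t powr 0"
      if x: "norm x < 1" and t: "0 < t" "t \<le> 1" for i x t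
    proof -
      have eq: "x + t *\<^sub>R (y - x) = t *\<^sub>R y + (1 - t) *\<^sub>R x" by (simp add: algebra_simps)
      have "norm (x + t *\<^sub>R (y - x)) \<le> t * norm y + (1 - t) * norm x"
        unfolding eq using t by (intro order_trans[OF norm_triangle_ineq]) simp
      also have "\<dots> < t * R + (1 - t) * R"
        using t x y R by (intro add_less_le_mono mult_strict_left_mono mult_left_mono) auto
      also have "\<dots> \<le> real n" using n by (simp add: algebra_simps)
      finally have "norm (f i (x + t *\<^sub>R (y - x))) \<le> b"
        using bnd[OF n(3), of i] b0 by (intro regular_pointwise[OF f, where n = n]) (simp_all add: b_def)
      moreover have "norm (y - x) \<le> 2 * R" using norm_triangle_ineq4[of y x] x y R by linarith
      ultimately show ?thesis using t b0 by (auto intro!: mult_mono)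
    qed
    have "norm (g y) \<le> C + 2 * (real CARD('n) * (b * (2 * R) / (0 + 1)))"
    proof (rule growth_pointwise_bound[where y = y and f = f and g = g, OF w(2,3) test_borel[OF w(1)]])
      show "0 \<le> b * (2 * R)" using b0 R by simp
      show "ennreal (norm (g y)) \<le> ennreal C + 2 * (\<Sum>i\<in>UNIV. seg_avg w (f i) y)" by (rule g)
    qed (use fb nn in auto)
    also have "\<dots> = C + 4 * real CARD('n) * (b * R)" by simp
    also have "b * R \<le> ?P * E * R powr (s + 1) + ?P * A * R powr (\<sigma> + 1)"
    proof -
      have "real n powr e \<le> 2 powr \<bar>e\<bar> * R powr e" for e
        using R n by (intro powr_doubling) auto
      then have "b \<le> E * (2 powr \<bar>s\<bar> * R powr s) + A * (2 powr \<bar>\<sigma>\<bar> * R powr \<sigma>)"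
        unfolding b_def by (intro add_mono mult_left_mono nn) auto
      also have "\<dots> \<le> E * (?P * R powr s) + A * (?P * R powr \<sigma>)"
        by (intro add_mono mult_left_mono mult_right_mono nn) auto
      finally have "b * R \<le> (E * (?P * R powr s) + A * (?P * R powr \<sigma>)) * R"
        using R by (intro mult_right_mono) auto
      also have "\<dots> = ?P * E * R powr (s + 1) + ?P * A * R powr (\<sigma> + 1)"
        using R by (simp add: powr_add algebra_simps)
      finally show ?thesis .
    qed
    finally have "norm (g y) \<le> C + 4 * real CARD('n) * (?P * E * R powr (s + 1) + ?P * A * R powr (\<sigma> + 1))"
      by (simp add: mult_left_mono)
    also have "C \<le> K * C * R powr (\<sigma> + 1)"
    proof -
      have "1 * C * 1 \<le> K * C * R powr (\<sigma> + 1)"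
        using nn \<sigma> R by (intro mult_mono ge_one_powr_ge_zero) (auto simp: K_def)
      then show ?thesis by simp
    qed
    also have "4 * real CARD('n) * (?P * E * R powr (s + 1) + ?P * A * R powr (\<sigma> + 1)) \<le> K * (E * R powr (s + 1) + A * R powr (\<sigma> + 1))"
    proof -
      have "4 * real CARD('n) * ?P * (E * R powr (s + 1) + A * R powr (\<sigma> + 1)) \<le> K * (E * R powr (s + 1) + A * R powr (\<sigma> + 1))"
        using nn by (intro mult_right_mono) (auto simp: K_def)
      then show ?thesis by (simp add: algebra_simps)
    qed
    finally show ?thesis by (simp add: algebra_simps)
  qed
  then show ?thesis by (simp add: ball_bound_def)
qed

section \<open>Primitives\<close>

text \<open>This part of \<open>distribution\<close> passes from v to
  \<open>\<lambda>\<phi>. - v (partial_deriv i \<phi>)\<close>, the functional on which the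
  induction on k continues.\<close>

definition linear_on_tests :: "((real ^ 'n::finite \<Rightarrow> complex) \<Rightarrow> complex) \<Rightarrow> bool" where
  "linear_on_tests v \<longleftrightarrow>
    (\<forall>\<phi>\<in>test_functions. \<forall>\<psi>\<in>test_functions. v (\<lambda>x. \<phi> x + \<psi> x) = v \<phi> + v \<psi>) \<and>
    (\<forall>c. \<forall>\<phi>\<in>test_functions. v (\<lambda>x. c * \<phi> x) = c * v \<phi>)"

lemma ex_complex_mollifier:
  obtains w :: "real ^ 'n::finite \<Rightarrow> complex" where "w \<in> test_functions"
    "\<And>x. 1 \<le> norm x \<Longrightarrow> w x = 0" "(\<integral>\<^sup>+x. ennreal (norm (w x)) \<partial>lborel) = 1" "(\<integral>x. w x \<partial>lborel) = 1"
proof -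
  obtain W :: "real ^ 'n \<Rightarrow> real" where W: "(\<lambda>x. complex_of_real (W x)) \<in> test_functions"
    "\<And>x. W x \<ge> 0" "\<And>x. 1 \<le> norm x \<Longrightarrow> W x = 0" "(\<integral>x. W x \<partial>lborel) = 1" "integrable lborel W"
    using ex_mollifier by blast
  have "(\<integral>\<^sup>+x. ennreal (norm (complex_of_real (W x))) \<partial>lborel) = 1"
    using W by (simp add: nn_integral_eq_integral)
  moreover have "(\<integral>x. complex_of_real (W x) \<partial>lborel) = 1"
    using W by simp
  ultimately show ?thesis using W by (intro that[of "\<lambda>x. complex_of_real (W x)"]) auto
qed

text \<open>One estimate for finite and infinite q. K stands before all data, so that E can be made
  small against it.\<close>

definition growth_constant :: "(real ^ 'n::finite \<Rightarrow> complex) \<Rightarrow> ennreal \<Rightarrow> real \<Rightarrow> real \<Rightarrow> real \<Rightarrow> bool" where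
  "growth_constant w q s \<sigma> K \<longleftrightarrow> 0 \<le> K \<and> (\<forall>(f :: 'n \<Rightarrow> real ^ 'n \<Rightarrow> complex) g C E A R.
    (\<forall>i. regular (f i)) \<longrightarrow> 0 \<le> C \<longrightarrow> 0 \<le> E \<longrightarrow> 0 \<le> A \<longrightarrow>
    (\<forall>i. \<forall>r\<ge>1. ball_bound q (f i) r (E * r powr s + A * r powr \<sigma>)) \<longrightarrow>
    (\<forall>y. ennreal (norm (g y)) \<le> ennreal C + 2 * (\<Sum>i\<in>UNIV. seg_avg w (f i) y)) \<longrightarrow> 1 \<le> R \<longrightarrow>
    ball_bound q g R (K * E * R powr (s + 1) + K * (A + C) * R powr (\<sigma> + 1)))"

lemma ex_growth_constant:
  fixes w :: "real ^ 'n::finite \<Rightarrow> complex" and s \<sigma> :: real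
  assumes w: "w \<in> test_functions" "\<And>x. 1 \<le> norm x \<Longrightarrow> w x = 0" "(\<integral>\<^sup>+x. ennreal (norm (w x)) \<partial>lborel) = 1"
    and q: "1 \<le> q" and \<sigma>: "-1 < \<sigma>" "\<sigma> \<le> s"
  shows "\<exists>K. growth_constant w q s \<sigma> K"
proof (cases "q = \<infinity>")
  case True
  have "growth_constant w \<infinity> s \<sigma> (1 + 4 * real CARD('n) * (2 powr \<bar>s\<bar> + 2 powr \<bar>\<sigma>\<bar>))"
    unfolding growth_constant_def
  proof (intro conjI allI impI)
    fix f :: "'n \<Rightarrow> real ^ 'n \<Rightarrow> complex" and g :: "real ^ 'n \<Rightarrow> complex" and C E A R :: real
    assume f: "\<forall>i. regular (f i)" and nn: "0 \<le> C" "0 \<le> E" "0 \<le> A"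
      and b: "\<forall>i. \<forall>r\<ge>1. ball_bound \<infinity> (f i) r (E * r powr s + A * r powr \<sigma>)"
      and g: "\<forall>y. ennreal (norm (g y)) \<le> ennreal C + 2 * (\<Sum>i\<in>UNIV. seg_avg w (f i) y)" and R: "1 \<le> R"
    show "ball_bound \<infinity> g R ((1 + 4 * real CARD('n) * (2 powr \<bar>s\<bar> + 2 powr \<bar>\<sigma>\<bar>)) * E * R powr (s + 1)
        + (1 + 4 * real CARD('n) * (2 powr \<bar>s\<bar> + 2 powr \<bar>\<sigma>\<bar>)) * (A + C) * R powr (\<sigma> + 1))"
      by (rule growth_infinite[where f = f and g = g, OF w \<sigma>(1) spec[OF f] nn _ spec[OF g] R]) (use b in auto)
  qed simp
  with True show ?thesis by blast
next
  case False
  show ?thesis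
  proof (rule growth_finite[OF w enn2real_ge_1[OF q False] \<sigma>])
    fix K :: real assume K: "K \<ge> 0" "\<And>(f :: 'n \<Rightarrow> real ^ 'n \<Rightarrow> complex) g C E A R. (\<And>i. f i \<in> borel_measurable borel) \<Longrightarrow> 0 \<le> C \<Longrightarrow> 0 \<le> E \<Longrightarrow> 0 \<le> A \<Longrightarrow>
      (\<And>i r. 1 \<le> r \<Longrightarrow> ball_int (\<lambda>x. ennreal (norm (f i x) powr enn2real q)) r \<le> ennreal ((E * r powr s + A * r powr \<sigma>) powr enn2real q * r powr CARD('n))) \<Longrightarrow>
      (\<And>y. ennreal (norm (g y)) \<le> ennreal C + 2 * (\<Sum>i\<in>UNIV. seg_avg w (f i) y)) \<Longrightarrow> 1 \<le> R \<Longrightarrow>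
      ball_int (\<lambda>x. ennreal (norm (g x :: complex) powr enn2real q)) R \<le>
        ennreal ((K * E * R powr (s + 1) + K * (A + C) * R powr (\<sigma> + 1)) powr enn2real q * R powr CARD('n))"
    have "growth_constant w q s \<sigma> K"
      unfolding growth_constant_def
    proof (intro conjI allI impI K(1))
      fix f :: "'n \<Rightarrow> real ^ 'n \<Rightarrow> complex" and g :: "real ^ 'n \<Rightarrow> complex" and C E A R :: real
      assume f: "\<forall>i. regular (f i)" and nn: "0 \<le> C" "0 \<le> E" "0 \<le> A"
        and b: "\<forall>i. \<forall>r\<ge>1. ball_bound q (f i) r (E * r powr s + A * r powr \<sigma>)"
        and g: "\<forall>y. ennreal (norm (g y)) \<le> ennreal C + 2 * (\<Sum>i\<in>UNIV. seg_avg w (f i) y)" and R: "1 \<le> R"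
      have m: "f i \<in> borel_measurable borel" for i using f by (simp add: regular_def)
      have b': "ball_int (\<lambda>x. ennreal (norm (f i x) powr enn2real q)) r \<le> ennreal ((E * r powr s + A * r powr \<sigma>) powr enn2real q * r powr CARD('n))"
        if "1 \<le> r" for i r using b that False by (simp add: ball_bound_def)
      show "ball_bound q g R (K * E * R powr (s + 1) + K * (A + C) * R powr (\<sigma> + 1))"
        using K(2)[OF m nn b' spec[OF g] R] False by (simp add: ball_bound_def)
    qed
    then show ?thesis by blast
  qed
qed

text \<open>The mollifier, the regular versions of the components and the function g are produced
  together, because the growth estimates for g refer to the same w and f0.\<close>

lemma primitive_representation:
  fixes v :: "(real ^ 'n::finite \<Rightarrow> complex) \<Rightarrow> complex"
  assumes v: "linear_on_tests v" and f: "\<And>i. represents (f i) (\<lambda>\<phi>. - v (partial_deriv i \<phi>))"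
  obtains w f0 g C where "w \<in> test_functions" "\<And>x. 1 \<le> norm x \<Longrightarrow> w x = 0" "(\<integral>\<^sup>+x. ennreal (norm (w x)) \<partial>lborel) = 1"
    "\<And>i. regular (f0 i)" "\<And>i. AE x in lborel. f i x = f0 i x" "\<And>i x. f0 i x = f i x \<or> f0 i x = 0"
    "g \<in> borel_measurable borel" "0 \<le> C" "\<And>y. ennreal (norm (g y)) \<le> ennreal C + 2 * (\<Sum>i\<in>UNIV. seg_avg w (f0 i) y)"
    "\<And>\<phi>. \<phi> \<in> test_functions \<Longrightarrow> v \<phi> = (\<integral>y. g y * \<phi> y \<partial>lborel)"
proof -
  have loc: "f i \<in> Lq_loc 1" for i using f[of i] by (simp add: represents_def)
  have "\<exists>f0. regular f0 \<and> (AE x in lborel. f i x = f0 x) \<and> (\<forall>x. f0 x = f i x \<or> f0 x = 0)" for i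
    by (rule ex_regular_representative[of "f i"]) (use loc[of i] in \<open>auto simp: Lq_loc_def\<close>)
  then obtain f0 where f0: "\<And>i. regular (f0 i)" "\<And>i. AE x in lborel. f i x = f0 i x" "\<And>i x. f0 i x = f i x \<or> f0 i x = 0"
    by metis
  have m: "f0 i \<in> borel_measurable borel" for i using f0(1)[of i] by (simp add: regular_def)
  note rep = Lq_loc_1_representative[OF loc m f0(2)]
  obtain w :: "real ^ 'n \<Rightarrow> complex" where w: "w \<in> test_functions"
    "\<And>x. 1 \<le> norm x \<Longrightarrow> w x = 0" "(\<integral>\<^sup>+x. ennreal (norm (w x)) \<partial>lborel) = 1" "(\<integral>x. w x \<partial>lborel) = 1"
    using ex_complex_mollifier by blast
  have deriv: "v (partial_deriv i \<phi>) = - (\<integral>z. f0 i z * \<phi> z \<partial>lborel)" if "\<phi> \<in> test_functions" for i \<phi>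
    using f[of i] rep(2)[OF that, of i] that by (simp add: represents_def) (metis add.inverse_inverse)
  obtain g C where g: "g \<in> borel_measurable borel" "C \<ge> 0"
    "\<And>y. ennreal (norm (g y)) \<le> ennreal C + 2 * (\<Sum>i\<in>UNIV. seg_avg w (f0 i) y)"
    "\<And>\<phi>. \<phi> \<in> test_functions \<Longrightarrow> v \<phi> = (\<integral>y. g y * \<phi> y \<partial>lborel)"
    by (rule representation[OF w(1,4) rep(1), of v])
       (use v in \<open>auto simp: linear_on_tests_def intro: deriv\<close>)
  show ?thesis by (rule that[OF w(1-3) f0 g])
qed

lemma representsI:
  fixes g :: "real ^ 'n::finite \<Rightarrow> complex"
  assumes g: "g \<in> borel_measurable borel" and rep: "\<And>\<phi>. \<phi> \<in> test_functions \<Longrightarrow> v \<phi> = (\<integral>y. g y * \<phi> y \<partial>lborel)"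
    and bnd: "\<And>R. 1 \<le> R \<Longrightarrow> \<exists>b. ball_bound q g R b" and q: "1 \<le> q"
  shows "represents g v"
  unfolding represents_def
proof (intro conjI ballI)
  show "g \<in> Lq_loc 1" by (rule Lq_locI[OF borel_measurable_lebesgue[OF g] bnd q]) auto
  fix \<phi> :: "real ^ 'n \<Rightarrow> complex" assume \<phi>: "\<phi> \<in> test_functions"
  then show "v \<phi> = integral\<^sup>L lebesgue (\<lambda>x. g x * \<phi> x)"
    unfolding rep[OF \<phi>] using g test_borel[OF \<phi>] by (intro integral_completion[symmetric]) auto
qed

lemma primitive_M_space:
  fixes v :: "(real ^ 'n::finite \<Rightarrow> complex) \<Rightarrow> complex"
  assumes v: "linear_on_tests v" and q: "1 \<le> q" and s: "-1 < s"
    and f: "\<And>i. distr_in (\<lambda>\<phi>. - v (partial_deriv i \<phi>)) (M_space s q)"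
  shows "distr_in v (M_space (s + 1) q)"
proof -
  obtain f where f: "\<And>i. f i \<in> M_space s q" "\<And>i. represents (f i) (\<lambda>\<phi>. - v (partial_deriv i \<phi>))"
    using f unfolding distr_in_def by metis
  obtain w f0 g C where w: "w \<in> test_functions" "\<And>x. 1 \<le> norm x \<Longrightarrow> w x = 0" "(\<integral>\<^sup>+x. ennreal (norm (w x)) \<partial>lborel) = 1"
    and f0: "\<And>i. regular (f0 i)" "\<And>i. AE x in lborel. f i x = f0 i x"
    and g: "g \<in> borel_measurable borel" "0 \<le> C" "\<And>y. ennreal (norm (g y)) \<le> ennreal C + 2 * (\<Sum>i\<in>UNIV. seg_avg w (f0 i) y)"
      "\<And>\<phi>. \<phi> \<in> test_functions \<Longrightarrow> v \<phi> = (\<integral>y. g y * \<phi> y \<partial>lborel)"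
    by (rule primitive_representation[OF v f(2)]) blast
  \<comment> \<open>Taking \<sigma> = s and A = 0 turns the two-power estimate into one in the
    single power R^(s + 1).\<close>
  obtain K where K: "growth_constant w q s s K"
    using ex_growth_constant[OF w q s order_refl] by blast
  have K0: "0 \<le> K" using K by (simp add: growth_constant_def)
  have K2: "ball_bound q g R (K * E * R powr (s + 1) + K * (A + C) * R powr (s + 1))"
    if "0 \<le> E" "0 \<le> A" "\<And>i r. 1 \<le> r \<Longrightarrow> ball_bound q (f0 i) r (E * r powr s + A * r powr s)" "1 \<le> R" for E A R
    using that f0(1) g(2,3) K unfolding growth_constant_def by blast
  have "\<exists>E\<ge>0. \<forall>R\<ge>1. ball_bound q (f i) R (E * R powr s)" for i
    using f(1)[of i] by (simp add: M_space_ball_bound[OF q])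
  then obtain e where e: "\<And>i. e i \<ge> 0" "\<And>i R. 1 \<le> R \<Longrightarrow> ball_bound q (f i) R (e i * R powr s)" by metis
  define E where "E = (\<Sum>i\<in>UNIV. e i)"
  have E: "0 \<le> E" "e i \<le> E" for i using e(1) by (auto simp: E_def intro: sum_nonneg member_le_sum)
  have b: "ball_bound q (f0 i) r (E * r powr s + 0 * r powr s)" if "1 \<le> r" for i r
  proof -
    have "ball_bound q (f0 i) r (e i * r powr s)"
      using e(2)[OF that] ball_bound_cong[OF f0(2)] by blast
    then show ?thesis
      using E e(1) by (elim ball_bound_mono[OF _ _ _ q]) (auto intro: mult_right_mono)
  qed
  have bg: "ball_bound q g R ((K * E + K * (0 + C)) * R powr (s + 1))" if "1 \<le> R" for R
    using K2[OF E(1) order_refl b that] by (simp only: distrib_right)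
  have "g \<in> M_space (s + 1) q"
    unfolding M_space_ball_bound[OF q]
  proof (intro conjI exI[of _ "K * E + K * (0 + C)"] allI impI bg borel_measurable_lebesgue g(1))
    show "0 \<le> K * E + K * (0 + C)" using K0 E(1) g(2) by simp
  qed
  moreover have "represents g v"
    by (rule representsI[OF g(1,4) _ q]) (use bg in blast)+
  ultimately show ?thesis unfolding distr_in_def by blast
qed

lemma primitive_M0_space:
  fixes v :: "(real ^ 'n::finite \<Rightarrow> complex) \<Rightarrow> complex"
  assumes v: "linear_on_tests v" and q: "1 \<le> q" and s: "-1 < s"
    and f: "\<And>i. distr_in (\<lambda>\<phi>. - v (partial_deriv i \<phi>)) (M0_space s q)"
  shows "distr_in v (M0_space (s + 1) q)"
proof -
  \<comment> \<open>The midpoint of -1 and s: the lower exponent has to exceed -1 for integrability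
    and to stay strictly below s.\<close>
  define \<sigma> where "\<sigma> = (s - 1) / 2"
  have \<sigma>: "-1 < \<sigma>" "\<sigma> < s" using s by (auto simp: \<sigma>_def)
  obtain f where f: "\<And>i. f i \<in> M0_space s q" "\<And>i. represents (f i) (\<lambda>\<phi>. - v (partial_deriv i \<phi>))"
    using f unfolding distr_in_def by metis
  obtain w f0 g C where w: "w \<in> test_functions" "\<And>x. 1 \<le> norm x \<Longrightarrow> w x = 0" "(\<integral>\<^sup>+x. ennreal (norm (w x)) \<partial>lborel) = 1"
    and f0: "\<And>i. regular (f0 i)" "\<And>i. AE x in lborel. f i x = f0 i x"
    and g: "g \<in> borel_measurable borel" "0 \<le> C" "\<And>y. ennreal (norm (g y)) \<le> ennreal C + 2 * (\<Sum>i\<in>UNIV. seg_avg w (f0 i) y)"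
      "\<And>\<phi>. \<phi> \<in> test_functions \<Longrightarrow> v \<phi> = (\<integral>y. g y * \<phi> y \<partial>lborel)"
    by (rule primitive_representation[OF v f(2)]) blast
  obtain K where K: "growth_constant w q s \<sigma> K"
    using ex_growth_constant[OF w q \<sigma>(1) less_imp_le[OF \<sigma>(2)]] by blast
  have K0: "0 \<le> K" using K by (simp add: growth_constant_def)
  have K2: "ball_bound q g R (K * E * R powr (s + 1) + K * (A + C) * R powr (\<sigma> + 1))"
    if "0 \<le> E" "0 \<le> A" "\<And>i r. 1 \<le> r \<Longrightarrow> ball_bound q (f0 i) r (E * r powr s + A * r powr \<sigma>)" "1 \<le> R" for E A R
    using that f0(1) g(2,3) K unfolding growth_constant_def by blast
  have bg: "\<exists>A\<ge>0. \<forall>R\<ge>1. ball_bound q g R (\<epsilon> * R powr (s + 1) + A * R powr (\<sigma> + 1))" if \<epsilon>: "\<epsilon> > 0" for \<epsilon>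
  proof -
    \<comment> \<open>K + 1 in place of K keeps the quotient meaningful if K = 0, and K E \<le>
      \<epsilon> still holds.\<close>
    define E where "E = \<epsilon> / (K + 1)"
    have E: "0 < E" using \<epsilon> K0 by (simp add: E_def)
    have "\<exists>A\<ge>0. \<forall>R\<ge>1. ball_bound q (f i) R (E * R powr s + A * R powr \<sigma>)" for i
      using f(1)[of i] E by (simp add: M0_space_ball_bound[OF q \<sigma>(2)])
    then obtain a where a: "\<And>i. a i \<ge> 0" "\<And>i R. 1 \<le> R \<Longrightarrow> ball_bound q (f i) R (E * R powr s + a i * R powr \<sigma>)" by metis
    define A where "A = (\<Sum>i\<in>UNIV. a i)"
    have A: "0 \<le> A" "a i \<le> A" for i using a(1) by (auto simp: A_def intro: sum_nonneg member_le_sum)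
    have b: "ball_bound q (f0 i) r (E * r powr s + A * r powr \<sigma>)" if "1 \<le> r" for i r
    proof -
      have "ball_bound q (f0 i) r (E * r powr s + a i * r powr \<sigma>)"
        using a(2)[OF that] ball_bound_cong[OF f0(2)] by blast
      then show ?thesis
        using E A a(1) by (elim ball_bound_mono[OF _ _ _ q]) (auto intro: mult_right_mono add_nonneg_nonneg)
    qed
    have KE: "K * E \<le> \<epsilon>"
      using \<epsilon> K0 by (simp add: E_def divide_simps algebra_simps)
    have "ball_bound q g R (\<epsilon> * R powr (s + 1) + (K * (A + C)) * R powr (\<sigma> + 1))" if "1 \<le> R" for R
    proof (rule ball_bound_mono[OF K2[OF less_imp_le[OF E] A(1) b that] _ _ q])
      show "K * E * R powr (s + 1) + K * (A + C) * R powr (\<sigma> + 1) \<le> \<epsilon> * R powr (s + 1) + (K * (A + C)) * R powr (\<sigma> + 1)"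
        by (intro add_right_mono mult_right_mono KE) auto
      show "0 \<le> K * E * R powr (s + 1) + K * (A + C) * R powr (\<sigma> + 1)"
        using K0 E A(1) g(2) by simp
    qed
    moreover have "0 \<le> K * (A + C)" using K0 A(1) g(2) by simp
    ultimately show ?thesis by blast
  qed
  have \<sigma>': "\<sigma> + 1 < s + 1" using \<sigma> by simp
  have "g \<in> M0_space (s + 1) q"
    unfolding M0_space_ball_bound[OF q \<sigma>'] using bg borel_measurable_lebesgue[OF g(1)] by blast
  moreover have "represents g v"
    by (rule representsI[OF g(1,4) _ q]) (use bg[of 1] in \<open>auto\<close>)
  ultimately show ?thesis unfolding distr_in_def by blast
qed

text \<open>Decay at infinity and boundedness give norm (f z) \<le> \<delta> + A (1 + norm z)^(-1/2)
  for every \<delta>. On a segment 1 + norm z is at least t norm (y - x), so the second term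
  contributes t^(-1/2) R^(1/2), integrable in t and of lower order than R.\<close>

lemma primitive_vanishing:
  fixes v :: "(real ^ 'n::finite \<Rightarrow> complex) \<Rightarrow> complex"
  assumes v: "linear_on_tests v" and f: "\<And>i. represents (f i) (\<lambda>\<phi>. - v (partial_deriv i \<phi>))"
    and lim: "\<And>i. (f i \<longlongrightarrow> 0) at_infinity" and bnd: "\<And>i. AE x in lborel. norm (f i x) \<le> E"
  shows "distr_in v (M0_space 1 \<infinity>)"
proof -
  obtain w f0 g C where w: "w \<in> test_functions" "\<And>x. 1 \<le> norm x \<Longrightarrow> w x = 0" "(\<integral>\<^sup>+x. ennreal (norm (w x)) \<partial>lborel) = 1"
    and f0: "\<And>i. regular (f0 i)" "\<And>i. AE x in lborel. f i x = f0 i x" "\<And>i x. f0 i x = f i x \<or> f0 i x = 0"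
    and g: "g \<in> borel_measurable borel" "0 \<le> C" "\<And>y. ennreal (norm (g y)) \<le> ennreal C + 2 * (\<Sum>i\<in>UNIV. seg_avg w (f0 i) y)"
      "\<And>\<phi>. \<phi> \<in> test_functions \<Longrightarrow> v \<phi> = (\<integral>y. g y * \<phi> y \<partial>lborel)"
    by (rule primitive_representation[OF v f]) blast
  let ?N = "real CARD('n)"
  have f0E: "norm (f0 i x) \<le> \<bar>E\<bar>" for i x
  proof -
    obtain n where n: "norm x < real n" using reals_Archimedean2 by blast
    have "AE x in lborel. x \<in> ball 0 (real n) \<longrightarrow> norm (f0 i x) \<le> \<bar>E\<bar>"
      using bnd[of i] f0(2)[of i] by eventually_elim auto
    then show ?thesis using n by (intro regular_pointwise[OF f0(1), where n = n]) (simp_all add: ball_bound_def)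
  qed
  have bg: "\<exists>A\<ge>0. \<forall>R\<ge>1. ball_bound \<infinity> g R (\<epsilon> * R powr 1 + A * R powr (1/2))" if \<epsilon>: "\<epsilon> > 0" for \<epsilon>
  proof -
    \<comment> \<open>8 N is the product of the factor 2 in the bound for g, the N components, the
      integral 2 of t^(-1/2) over the unit interval, and 2 from norm (y - x) \<le> 2 R.\<close>
    define \<delta> where "\<delta> = \<epsilon> / (8 * ?N)"
    have \<delta>: "\<delta> > 0" using \<epsilon> by (simp add: \<delta>_def)
    have "\<exists>r. \<forall>x. r \<le> norm x \<longrightarrow> norm (f i x) < \<delta>" for i
      using tendstoD[OF lim \<delta>, of i] by (simp add: eventually_at_infinity)
    then obtain r where r: "\<And>i x. r i \<le> norm x \<Longrightarrow> norm (f i x) < \<delta>" by metis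
    define R0 where "R0 = (\<Sum>i\<in>UNIV. \<bar>r i\<bar>)"
    have R0: "0 \<le> R0" "r i \<le> R0" for i
      using member_le_sum[of i UNIV "\<lambda>i. \<bar>r i\<bar>"] by (auto simp: R0_def intro: sum_nonneg)
    \<comment> \<open>Within radius R0 only the bound \<bar>E\<bar> is available; there it is at
      most A (1 + norm z)^(-1/2).\<close>
    define A where "A = \<bar>E\<bar> * (1 + R0) powr (1/2)"
    have A: "A \<ge> 0" by (simp add: A_def)
    have fz: "norm (f0 i z) \<le> \<delta> + A * (1 + norm z) powr (-1/2)" for i z
    proof (cases "R0 \<le> norm z")
      case True
      then have "norm (f i z) < \<delta>" using R0(2)[of i] by (intro r) simp
      then have "norm (f0 i z) \<le> \<delta>" using f0(3)[of i z] \<delta> by auto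
      then show ?thesis using A by (simp add: add_increasing2)
    next
      case False
      have "\<bar>E\<bar> * 1 = \<bar>E\<bar> * ((1 + R0) powr (1/2) * (1 + R0) powr (-1/2))"
        using R0(1) by (simp add: powr_add[symmetric])
      also have "\<dots> \<le> \<bar>E\<bar> * ((1 + R0) powr (1/2) * (1 + norm z) powr (-1/2))"
        using False by (intro mult_left_mono powr_mono2') (auto intro: add_pos_nonneg)
      also have "\<dots> = A * (1 + norm z) powr (-1/2)" by (simp add: A_def)
      finally show ?thesis using f0E[of i z] \<delta> by simp
    qed
    have "norm (g y) \<le> \<epsilon> * R powr 1 + (C + 8 * ?N * A) * R powr (1/2)" if R: "1 \<le> R" and y: "norm y < R" for R y
    proof -
      let ?D = "\<delta> * (2 * R) + A * (2 * R) powr (1/2)"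
      have fb: "norm (f0 i (x + t *\<^sub>R (y - x))) * norm (y - x) \<le> ?D * t powr (-1/2)"
        if x: "norm x < 1" and t: "0 < t" "t \<le> 1" for i x t
      proof (cases "y = x")
        case False
        let ?z = "x + t *\<^sub>R (y - x)" and ?n = "norm (y - x)"
        have n: "0 < ?n" "?n \<le> 2 * R" using False norm_triangle_ineq4[of y x] x y R by auto
        \<comment> \<open>The point \<open>?z\<close> has distance t \<open>?n\<close> from x, and x
          lies in the unit ball; so the moving point is near the origin only while t
          \<open>?n\<close> is bounded.\<close>
        have "t * ?n \<le> norm ?z + norm x"
          using norm_triangle_ineq4[of ?z x] t by simp
        then have tn: "t * ?n \<le> 1 + norm ?z" using x by simp
        have "norm (f0 i ?z) * ?n \<le> (\<delta> + A * (t * ?n) powr (-1/2)) * ?n"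
        proof (rule mult_right_mono)
          have "(1 + norm ?z) powr (-1/2) \<le> (t * ?n) powr (-1/2)"
            using tn t n by (intro powr_mono2') auto
          then show "norm (f0 i ?z) \<le> \<delta> + A * (t * ?n) powr (-1/2)"
            using A by (intro order_trans[OF fz] add_left_mono mult_left_mono)
        qed simp
        also have "\<dots> = \<delta> * ?n + A * (t powr (-1/2) * (?n powr (-1/2) * ?n powr 1))"
          using t n by (simp add: powr_mult algebra_simps)
        also have "?n powr (-1/2) * ?n powr 1 = ?n powr (1/2)"
          by (simp only: powr_add[symmetric]) simp
        also have "\<delta> * ?n + A * (t powr (-1/2) * ?n powr (1/2)) \<le> \<delta> * (2 * R) * t powr (-1/2) + A * (t powr (-1/2) * (2 * R) powr (1/2))"
        proof (intro add_mono mult_left_mono powr_mono2)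
          have "1 powr (-1/2) \<le> t powr (-1/2)" using t by (intro powr_mono2') auto
          then have "\<delta> * ?n * 1 \<le> \<delta> * (2 * R) * t powr (-1/2)"
            using \<delta> n R by (intro mult_mono) auto
          then show "\<delta> * ?n \<le> \<delta> * (2 * R) * t powr (-1/2)" by simp
        qed (use n A in auto)
        finally show ?thesis by (simp add: algebra_simps)
      qed (use \<delta> A R in simp)
      have "norm (g y) \<le> C + 2 * (?N * (?D / (-1/2 + 1)))"
      proof (rule growth_pointwise_bound[where y = y and f = f0 and g = g, OF w(2,3) test_borel[OF w(1)]])
        show "0 \<le> ?D" using \<delta> A R by simp
        show "ennreal (norm (g y)) \<le> ennreal C + 2 * (\<Sum>i\<in>UNIV. seg_avg w (f0 i) y)" by (rule g)
      qed (use fb g(2) in auto)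
      also have "\<dots> = C + 8 * ?N * \<delta> * R + 4 * ?N * A * (2 * R) powr (1/2)" by (simp add: algebra_simps)
      also have "8 * ?N * \<delta> = \<epsilon>" by (simp add: \<delta>_def)
      finally have "norm (g y) \<le> C + \<epsilon> * R + 4 * ?N * A * (2 * R) powr (1/2)" .
      moreover have "4 * ?N * A * (2 * R) powr (1/2) \<le> 4 * ?N * A * (2 * R powr (1/2))"
      proof (rule mult_left_mono)
        have "2 powr (1/2) \<le> (2 powr 1 :: real)" by (intro powr_mono) auto
        then show "(2 * R) powr (1/2) \<le> 2 * R powr (1/2)" using R by (simp add: powr_mult mult_right_mono)
      qed (use A in simp)
      moreover have "C \<le> C * R powr (1/2)"
        using g(2) ge_one_powr_ge_zero[OF R, of "1/2"] by (simp add: mult_le_cancel_left1)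
      ultimately show ?thesis using R by (simp add: algebra_simps)
    qed
    moreover have "0 \<le> C + 8 * ?N * A" using g(2) A by simp
    ultimately show ?thesis unfolding ball_bound_def by (intro exI[of _ "C + 8 * ?N * A"]) auto
  qed
  have half: "1/2 < (1::real)" by simp
  have q: "1 \<le> (\<infinity>::ennreal)" by simp
  have "g \<in> M0_space 1 \<infinity>"
    unfolding M0_space_ball_bound[OF q half] using bg borel_measurable_lebesgue[OF g(1)] by blast
  moreover have "represents g v"
    by (rule representsI[OF g(1,4) _ q]) (use bg[of 1] in \<open>auto\<close>)
  ultimately show ?thesis unfolding distr_in_def by blast
qed

section \<open>Uniqueness of representatives\<close>

text \<open>Cut off to a box, the positive and the negative part of r are densities of measures that
  are finite and equal on all boxes. Boxes are stable under intersection and generate the Borel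
  sets, so the two parts agree almost everywhere, which forces r = 0.\<close>

lemma AE_zero_of_box_integrals:
  fixes r :: "'a::euclidean_space \<Rightarrow> real"
  assumes r: "\<And>n :: nat. integrable lborel (\<lambda>x. indicator (box (- (real n *\<^sub>R One)) (real n *\<^sub>R One)) x * r x)"
    and [measurable]: "r \<in> borel_measurable borel"
    and box: "\<And>l u. (\<integral>x. indicator (box l u) x * r x \<partial>lborel) = 0"
  shows "AE x in lborel. r x = 0"
proof -
  let ?A = "\<lambda>n::nat. box (- (real n *\<^sub>R One)) (real n *\<^sub>R One) :: 'a set"
  have UN: "(\<Union>n. ?A n) = UNIV" by (rule UN_box_eq_UNIV)
  have bI: "\<exists>c d. box l u \<inter> ?A n = box c d" for l u n unfolding box_Int_box by blast
  have eq: "AE x in lborel. x \<in> ?A n \<longrightarrow> r x = 0" for n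
  proof -
    let ?p = "\<lambda>x. ennreal (indicator (?A n) x * r x)" and ?m = "\<lambda>x. ennreal (- (indicator (?A n) x * r x))"
    have "density lborel ?p = density lborel ?m"
    proof (rule measure_eqI_generator_eq)
      let ?E = "range (\<lambda>(a, b). box a b :: 'a set)"
      show "Int_stable ?E" by (auto simp: Int_stable_def box_Int_box)
      show "?E \<subseteq> Pow UNIV" "sets (density lborel ?p) = sigma_sets UNIV ?E" "sets (density lborel ?m) = sigma_sets UNIV ?E"
        by (simp_all add: borel_eq_box)
      show "range ?A \<subseteq> ?E" "(\<Union>i. ?A i) = UNIV" using UN by auto
      have box_eq: "emeasure (density lborel ?p) (box l u) = emeasure (density lborel ?m) (box l u)"
        and fin: "emeasure (density lborel ?p) (box l u) \<noteq> \<infinity>" for l u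
      proof -
        let ?f = "\<lambda>x. indicator (box l u) x * (indicator (?A n) x * r x)"
        have int: "integrable lborel ?f"
          using integrable_mult_indicator[OF _ r[of n], of "box l u"] by simp
        \<comment> \<open>The cut-off to \<open>?A n\<close> merely replaces the box by a smaller
          one, to which the hypothesis applies.\<close>
        obtain c d where cd: "box l u \<inter> ?A n = box c d" using bI by blast
        have "(\<integral>x. ?f x \<partial>lborel) = (\<integral>x. indicator (box c d) x * r x \<partial>lborel)"
          unfolding cd[symmetric] by (simp add: indicator_inter_arith mult.assoc)
        then have z: "(\<integral>x. ?f x \<partial>lborel) = 0" using box by simp
        have p: "emeasure (density lborel ?p) (box l u) = (\<integral>\<^sup>+x. ennreal (?f x) \<partial>lborel)"
          by (subst emeasure_density) (auto intro!: nn_integral_cong simp: indicator_def)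
        have m: "emeasure (density lborel ?m) (box l u) = (\<integral>\<^sup>+x. ennreal (- ?f x) \<partial>lborel)"
          by (subst emeasure_density) (auto intro!: nn_integral_cong simp: indicator_def)
        have fp: "(\<integral>\<^sup>+x. ennreal (?f x) \<partial>lborel) < \<infinity>" and fm: "(\<integral>\<^sup>+x. ennreal (- ?f x) \<partial>lborel) < \<infinity>"
          using int by (auto simp: real_integrable_def top.not_eq_extremum)
        have eq: "enn2real (\<integral>\<^sup>+x. ennreal (?f x) \<partial>lborel) = enn2real (\<integral>\<^sup>+x. ennreal (- ?f x) \<partial>lborel)"
          using real_lebesgue_integral_def[OF int] z by simp
        have "(\<integral>\<^sup>+x. ennreal (?f x) \<partial>lborel) = ennreal (enn2real (\<integral>\<^sup>+x. ennreal (?f x) \<partial>lborel))"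
          using fp by (intro ennreal_enn2real[symmetric]) simp
        also have "\<dots> = ennreal (enn2real (\<integral>\<^sup>+x. ennreal (- ?f x) \<partial>lborel))" by (simp only: eq)
        also have "\<dots> = (\<integral>\<^sup>+x. ennreal (- ?f x) \<partial>lborel)"
          using fm by (intro ennreal_enn2real) simp
        finally show "emeasure (density lborel ?p) (box l u) = emeasure (density lborel ?m) (box l u)"
          unfolding p m .
        show "emeasure (density lborel ?p) (box l u) \<noteq> \<infinity>" unfolding p using fp by simp
      qed
      show "emeasure (density lborel ?p) (?A i) \<noteq> \<infinity>" for i by (rule fin)
      show "emeasure (density lborel ?p) X = emeasure (density lborel ?m) X" if "X \<in> ?E" for X
        using that box_eq by auto
    qed
    then have "AE x in lborel. ?p x = ?m x"
      by (intro sigma_finite_measure.density_unique[OF sigma_finite_lborel]) auto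
    then show ?thesis
    proof eventually_elim
      case (elim x)
      show ?case
      proof
        assume x: "x \<in> ?A n"
        show "r x = 0"
          using elim x by (cases "r x" "0::real" rule: linorder_cases) (auto simp: ennreal_neg)
      qed
    qed
  qed
  have "AE x in lborel. \<forall>n. x \<in> ?A n \<longrightarrow> r x = 0" unfolding AE_all_countable using eq by blast
  then show ?thesis
  proof eventually_elim
    case (elim x)
    have "x \<in> (\<Union>n. ?A n)" using UN by simp
    with elim show ?case by blast
  qed
qed

text \<open>The test functions \<open>1 - (1 - b)\<^sup>n\<close>, with \<open>b\<close> a bump on a box, increase to the indicator of the box.\<close>

lemma AE_zero_of_test_integrals:
  fixes d :: "real ^ 'n::finite \<Rightarrow> complex"
  assumes d: "locally_integrable d" and zero: "\<And>\<phi>. \<phi> \<in> test_functions \<Longrightarrow> (\<integral>x. d x * \<phi> x \<partial>lborel) = 0"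
  shows "AE x in lborel. d x = 0"
proof -
  have [measurable]: "d \<in> borel_measurable borel" using d by (simp add: locally_integrable_def)
  have int: "integrable lborel (\<lambda>x. complex_of_real (indicator (box l u) x) * d x)" for l u
  proof -
    obtain r where r: "box l u \<subseteq> ball 0 r" using bounded_subset_ballD[OF bounded_box] by blast
    have "integrable lborel (\<lambda>x. complex_of_real (indicator (ball 0 r) x) * d x)"
      using d by (simp add: locally_integrable_def)
    then show ?thesis
    proof (rule Bochner_Integration.integrable_bound)
      show "AE x in lborel. norm (complex_of_real (indicator (box l u) x) * d x) \<le> norm (complex_of_real (indicator (ball 0 r) x) * d x)"
      proof (rule AE_I2)
        fix x
        show "norm (complex_of_real (indicator (box l u) x) * d x) \<le> norm (complex_of_real (indicator (ball 0 r) x) * d x)"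
          using subsetD[OF r, of x] by (cases "x \<in> box l u") auto
      qed
    qed simp
  qed
  have box: "(\<integral>x. complex_of_real (indicator (box l u) x) * d x \<partial>lborel) = 0" for l u
  proof -
    define \<phi> where "\<phi> n x = complex_of_real (1 - (1 - box_bump l u x) ^ n)" for n x
    have \<phi>0: "\<phi> n x = 0" if "x \<notin> box l u" for n x
    proof -
      have "box_bump l u x = 0" using that box_bump_pos[of l u x] box_bump_bounds(1)[of l u x] by simp
      then show ?thesis by (simp add: \<phi>_def)
    qed
    have \<phi>: "\<phi> n \<in> test_functions" for n
    proof (rule test_functions_boxI[OF _ \<phi>0])
      have "smooth (\<lambda>x. 1 + (- 1) * (1 + (- 1) * complex_of_real (box_bump l u x)) ^ n)"
        by (intro smooth_add smooth_mult smooth_const smooth_power box_bump_smooth)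
      then show "smooth (\<phi> n)" by (simp add: \<phi>_def[abs_def])
    qed
    have bnd: "\<bar>1 - (1 - box_bump l u x) ^ n\<bar> \<le> 1" for n x
      using box_bump_bounds[of l u x] power_le_one[of "1 - box_bump l u x" n] zero_le_power[of "1 - box_bump l u x" n] by simp
    have "(\<lambda>n. (\<integral>x. d x * \<phi> n x \<partial>lborel)) \<longlonglongrightarrow> (\<integral>x. complex_of_real (indicator (box l u) x) * d x \<partial>lborel)"
    proof (rule integral_dominated_convergence)
      show "integrable lborel (\<lambda>x. norm (complex_of_real (indicator (box l u) x) * d x))" using int by simp
      show "(\<lambda>x. d x * \<phi> n x) \<in> borel_measurable lborel" for n
        using test_borel[OF \<phi>, of n] by simp
      show "AE x in lborel. (\<lambda>n. d x * \<phi> n x) \<longlonglongrightarrow> complex_of_real (indicator (box l u) x) * d x"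
      proof (rule AE_I2)
        fix x
        show "(\<lambda>n. d x * \<phi> n x) \<longlonglongrightarrow> complex_of_real (indicator (box l u) x) * d x"
        proof (cases "x \<in> box l u")
          case True
          then have "0 \<le> 1 - box_bump l u x" "1 - box_bump l u x < 1"
            using box_bump_pos[of l u x] box_bump_bounds[of l u x] by auto
          then have "(\<lambda>n. (1 - box_bump l u x) ^ n) \<longlonglongrightarrow> 0" by (intro LIMSEQ_realpow_zero)
          then have "(\<lambda>n. d x * complex_of_real (1 - (1 - box_bump l u x) ^ n)) \<longlonglongrightarrow> d x * complex_of_real (1 - 0)"
            by (intro tendsto_mult tendsto_of_real tendsto_diff tendsto_const)
          with True show ?thesis by (simp add: \<phi>_def)
        qed (simp add: \<phi>0)
      qed
      show "AE x in lborel. norm (d x * \<phi> n x) \<le> norm (complex_of_real (indicator (box l u) x) * d x)" for n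
      proof (rule AE_I2)
        fix x
        have "norm (\<phi> n x) \<le> 1" using bnd[of x n] unfolding \<phi>_def norm_of_real .
        then show "norm (d x * \<phi> n x) \<le> norm (complex_of_real (indicator (box l u) x) * d x)"
          by (cases "x \<in> box l u") (auto simp: \<phi>0 norm_mult mult_left_le)
      qed
    qed simp
    then show ?thesis using zero[OF \<phi>] by (simp add: LIMSEQ_const_iff)
  qed
  have "AE x in lborel. Re (d x) = 0"
  proof (rule AE_zero_of_box_integrals)
    show "integrable lborel (\<lambda>x. indicator (box (- (real n *\<^sub>R One)) (real n *\<^sub>R One)) x * Re (d x))" for n :: nat
      using integrable_Re[OF int] by simp
    show "(\<integral>x. indicator (box l u) x * Re (d x) \<partial>lborel) = 0" for l u
      using integral_Re[OF int[of l u]] box[of l u] by simp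
  qed measurable
  moreover have "AE x in lborel. Im (d x) = 0"
  proof (rule AE_zero_of_box_integrals)
    show "integrable lborel (\<lambda>x. indicator (box (- (real n *\<^sub>R One)) (real n *\<^sub>R One)) x * Im (d x))" for n :: nat
      using integrable_Im[OF int] by simp
    show "(\<integral>x. indicator (box l u) x * Im (d x) \<partial>lborel) = 0" for l u
      using integral_Im[OF int[of l u]] box[of l u] by simp
  qed measurable
  ultimately show ?thesis by eventually_elim (simp add: complex_eq_iff)
qed

lemma integrable_mult_test:
  assumes f: "locally_integrable f" and \<phi>: "\<phi> \<in> test_functions"
  shows "integrable lborel (\<lambda>x. f x * \<phi> x)"
proof -
  obtain r where r: "r > 0" "\<And>x. r \<le> norm x \<Longrightarrow> \<phi> x = 0" using test_support[OF \<phi>] by blast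
  obtain B where B: "\<And>x. norm (\<phi> x) \<le> B" using test_bounded[OF \<phi>] by blast
  have "integrable lborel (\<lambda>x. (of_real (indicator (ball 0 r) x) * f x) * \<phi> x)"
    using f test_borel[OF \<phi>] by (intro integrable_mult_bounded[OF _ _ B]) (auto simp: locally_integrable_def)
  also have "(\<lambda>x. (of_real (indicator (ball 0 r) x) * f x) * \<phi> x) = (\<lambda>x. f x * \<phi> x)"
    using r(2) by (force simp: indicator_def)
  finally show ?thesis .
qed

lemma Lq_loc_measurable: "f \<in> Lq_loc q \<Longrightarrow> f \<in> borel_measurable lebesgue"
  by (simp add: Lq_loc_def)

text \<open>The fundamental lemma of the calculus of variations, applied to the difference of Borel
  representatives. It will transfer the bound known for one representative of a derivative to the
  one that tends to 0 at infinity.\<close>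

lemma represents_unique:
  fixes f g :: "real ^ 'n::finite \<Rightarrow> complex"
  assumes f: "represents f u" and g: "represents g u"
  shows "AE x in lborel. f x = g x"
proof -
  have loc: "f \<in> Lq_loc 1" "g \<in> Lq_loc 1" using f g by (auto simp: represents_def)
  obtain f0 where f0: "regular f0" "AE x in lborel. f x = f0 x"
    using ex_regular_representative[OF Lq_loc_measurable[OF loc(1)]] by blast
  obtain g0 where g0: "regular g0" "AE x in lborel. g x = g0 x"
    using ex_regular_representative[OF Lq_loc_measurable[OF loc(2)]] by blast
  have m: "f0 \<in> borel_measurable borel" "g0 \<in> borel_measurable borel" using f0 g0 by (auto simp: regular_def)
  note rf = Lq_loc_1_representative[OF loc(1) m(1) f0(2)]
  note rg = Lq_loc_1_representative[OF loc(2) m(2) g0(2)]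
  have "AE x in lborel. f0 x - g0 x = 0"
  proof (rule AE_zero_of_test_integrals)
    show "locally_integrable (\<lambda>x. f0 x - g0 x)"
      using rf(1) rg(1) by (auto simp: locally_integrable_def right_diff_distrib)
    fix \<phi> :: "real ^ 'n \<Rightarrow> complex" assume \<phi>: "\<phi> \<in> test_functions"
    have "(\<integral>x. f0 x * \<phi> x \<partial>lborel) = u \<phi>" "(\<integral>x. g0 x * \<phi> x \<partial>lborel) = u \<phi>"
      using f g rf(2)[OF \<phi>] rg(2)[OF \<phi>] \<phi> by (auto simp: represents_def)
    then show "(\<integral>x. (f0 x - g0 x) * \<phi> x \<partial>lborel) = 0"
      using integrable_mult_test[OF rf(1) \<phi>] integrable_mult_test[OF rg(1) \<phi>] by (simp add: left_diff_distrib)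
  qed
  with f0(2) g0(2) show ?thesis by eventually_elim simp
qed

section \<open>Higher derivatives and the theorem\<close>

lemma represents_cong:
  assumes "represents f u" "\<And>\<phi>. \<phi> \<in> test_functions \<Longrightarrow> u \<phi> = v \<phi>"
  shows "represents f v"
  using assms unfolding represents_def by metis

lemma distr_in_cong:
  assumes "distr_in u X" "\<And>\<phi>. \<phi> \<in> test_functions \<Longrightarrow> u \<phi> = v \<phi>"
  shows "distr_in v X"
  using assms represents_cong unfolding distr_in_def by blast

lemma distribution_linear: "distribution u \<Longrightarrow> linear_on_tests u"
  by (simp add: distribution_def linear_on_tests_def)

lemma foldr_partial_deriv_linear:
  assumes "smooth \<phi>" "smooth \<psi>"
  shows "foldr partial_deriv is (\<lambda>x. \<phi> x + \<psi> x) = (\<lambda>x. foldr partial_deriv is \<phi> x + foldr partial_deriv is \<psi> x)"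
    and "foldr partial_deriv is (\<lambda>x. c * \<phi> x) = (\<lambda>x. c * foldr partial_deriv is \<phi> x)"
proof -
  show "foldr partial_deriv is (\<lambda>x. \<phi> x + \<psi> x) = (\<lambda>x. foldr partial_deriv is \<phi> x + foldr partial_deriv is \<psi> x)"
    by (induction "is") (simp_all add: partial_deriv_add smooth_differentiable smooth_foldr_partial_deriv assms)
  show "foldr partial_deriv is (\<lambda>x. c * \<phi> x) = (\<lambda>x. c * foldr partial_deriv is \<phi> x)"
    by (induction "is")
       (simp_all add: partial_deriv_mult smooth_differentiable smooth_foldr_partial_deriv smooth_const assms)
qed

lemma ex_mi_deriv_list:
  fixes \<beta> :: "'n::finite \<Rightarrow> nat"
  obtains "is" where "\<And>i. count_list is i = \<beta> i" "\<And>\<phi>. \<phi> \<in> test_functions \<Longrightarrow> mi_deriv \<beta> \<phi> = foldr partial_deriv is \<phi>"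
proof -
  obtain js where "\<And>i. count_list js i = \<beta> i" using ex_count_list[of \<beta>] by blast
  then show ?thesis using mi_deriv_eq[OF test_smooth] that by blast
qed

lemma distr_deriv_linear:
  assumes u: "linear_on_tests u"
  shows "linear_on_tests (distr_deriv \<beta> u)"
proof -
  obtain "is" where md: "\<And>\<phi>. \<phi> \<in> test_functions \<Longrightarrow> mi_deriv \<beta> \<phi> = foldr partial_deriv is \<phi>"
    using ex_mi_deriv_list by blast
  show ?thesis
    using u unfolding linear_on_tests_def distr_deriv_def
    by (auto simp: md test_add test_cmult foldr_partial_deriv_linear[OF test_smooth test_smooth]
        test_foldr_partial_deriv distrib_left)
qed

lemma count_list_Suc:
  fixes \<beta> :: "'n::finite \<Rightarrow> nat"
  assumes "\<And>j. count_list is j = \<beta> j"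
  shows "count_list (i # is) j = (\<beta>(i := Suc (\<beta> i))) j" "count_list (is @ [i]) j = (\<beta>(i := Suc (\<beta> i))) j"
  using assms by auto

lemma mi_order_Suc: "mi_order (\<beta>(i := Suc (\<beta> i))) = Suc (mi_order \<beta>)"
proof -
  have "mi_order (\<beta>(i := Suc (\<beta> i))) = (\<Sum>j\<in>UNIV. \<beta> j + (if j = i then 1 else 0))"
    unfolding mi_order_def by (intro sum.cong) auto
  then show ?thesis by (simp add: mi_order_def sum.distrib)
qed

text \<open>The added derivative may act on \<phi> outermost or innermost. The first form turns a
  derivative of u into a lower derivative of a first derivative of u, for the induction; the second
  into a first derivative of a lower derivative, the setting of primitives.\<close>

lemma distr_deriv_Suc:
  assumes \<phi>: "\<phi> \<in> test_functions"
  shows "distr_deriv (\<beta>(i := Suc (\<beta> i))) u \<phi> = distr_deriv \<beta> (\<lambda>\<psi>. - u (partial_deriv i \<psi>)) \<phi>"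
    and "distr_deriv (\<beta>(i := Suc (\<beta> i))) u \<phi> = - distr_deriv \<beta> u (partial_deriv i \<phi>)"
proof -
  obtain "is" where "is": "\<And>i. count_list is i = \<beta> i"
      "\<And>\<phi>. \<phi> \<in> test_functions \<Longrightarrow> mi_deriv \<beta> \<phi> = foldr partial_deriv is \<phi>"
    using ex_mi_deriv_list by blast
  let ?\<beta> = "\<beta>(i := Suc (\<beta> i))"
  have 1: "mi_deriv ?\<beta> \<phi> = partial_deriv i (mi_deriv \<beta> \<phi>)"
    using mi_deriv_eq[where \<beta> = ?\<beta>, OF test_smooth[OF \<phi>] count_list_Suc(1)[OF "is"(1), of i]] by (simp add: "is"(2) \<phi>)
  have 2: "mi_deriv ?\<beta> \<phi> = mi_deriv \<beta> (partial_deriv i \<phi>)"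
    using mi_deriv_eq[where \<beta> = ?\<beta>, OF test_smooth[OF \<phi>] count_list_Suc(2)[OF "is"(1), of i]]
    by (simp add: "is"(2) \<phi> test_partial_deriv)
  show "distr_deriv ?\<beta> u \<phi> = distr_deriv \<beta> (\<lambda>\<psi>. - u (partial_deriv i \<psi>)) \<phi>"
    unfolding distr_deriv_def mi_order_Suc 1 by simp
  show "distr_deriv ?\<beta> u \<phi> = - distr_deriv \<beta> u (partial_deriv i \<phi>)"
    unfolding distr_deriv_def mi_order_Suc 2 by simp
qed

lemma mi_deriv_order_0: "mi_order \<beta> = 0 \<Longrightarrow> \<phi> \<in> test_functions \<Longrightarrow> mi_deriv \<beta> \<phi> = \<phi>"
  using mi_deriv_eq[OF test_smooth, of \<phi> "[]" \<beta>] by (simp add: mi_order_def)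

lemma distr_deriv_order_0: "mi_order \<beta> = 0 \<Longrightarrow> \<phi> \<in> test_functions \<Longrightarrow> distr_deriv \<beta> u \<phi> = u \<phi>"
  by (simp add: distr_deriv_def mi_deriv_order_0)

lemma linear_neg_partial_deriv:
  assumes "linear_on_tests u"
  shows "linear_on_tests (\<lambda>\<phi>. - u (partial_deriv i \<phi>))"
proof -
  have "linear_on_tests (distr_deriv ((\<lambda>_. 0)(i := Suc 0)) u)" by (rule distr_deriv_linear[OF assms])
  moreover have "distr_deriv ((\<lambda>_. 0)(i := Suc 0)) u \<phi> = - u (partial_deriv i \<phi>)" if "\<phi> \<in> test_functions" for \<phi>
    using distr_deriv_Suc(2)[OF that, of "\<lambda>_. 0" i u] distr_deriv_order_0[of "\<lambda>_. 0" "partial_deriv i \<phi>" u] that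
    by (simp add: mi_order_def test_partial_deriv)
  ultimately show ?thesis
    by (simp add: linear_on_tests_def test_add test_cmult)
qed

text \<open>The induction generalises over u: the hypothesis for order k + 1 contains the one for
  order k on each first derivative of u, which thus lies in X (s + k), and \<open>step\<close> adds
  the last unit. The exponent stays above -1 throughout.\<close>

lemma iterate_primitive:
  fixes X :: "real \<Rightarrow> (real ^ 'n::finite \<Rightarrow> complex) set"
  assumes step: "\<And>s v. linear_on_tests v \<Longrightarrow> -1 < s \<Longrightarrow> (\<And>i. distr_in (\<lambda>\<phi>. - v (partial_deriv i \<phi>)) (X s)) \<Longrightarrow> distr_in v (X (s + 1))"
    and s: "-1 < s"
  shows "linear_on_tests u \<Longrightarrow> (\<And>\<beta>. mi_order \<beta> = k \<Longrightarrow> distr_in (distr_deriv \<beta> u) (X s)) \<Longrightarrow> distr_in u (X (s + real k))"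
proof (induction k arbitrary: u)
  case 0
  have z: "mi_order (\<lambda>_::'n. 0) = 0" by (simp add: mi_order_def)
  have "distr_in u (X s)"
    by (rule distr_in_cong[OF 0(2)[OF z]]) (rule distr_deriv_order_0[OF z])
  then show ?case by simp
next
  case (Suc k)
  have "distr_in (\<lambda>\<phi>. - u (partial_deriv i \<phi>)) (X (s + real k))" for i
  proof (rule Suc.IH[OF linear_neg_partial_deriv[OF Suc.prems(1)]])
    fix \<beta> :: "'n \<Rightarrow> nat" assume "mi_order \<beta> = k"
    then have "mi_order (\<beta>(i := Suc (\<beta> i))) = Suc k" by (simp only: mi_order_Suc)
    from distr_in_cong[OF Suc.prems(2)[OF this] distr_deriv_Suc(1)]
    show "distr_in (distr_deriv \<beta> (\<lambda>\<phi>. - u (partial_deriv i \<phi>))) (X s)" .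
  qed
  then have "distr_in u (X (s + real k + 1))"
    using s by (intro step Suc.prems(1)) auto
  then show ?case by (simp add: add_ac)
qed

text \<open>A list with counts \<beta> has length k, so the square of this component is among the
  summands under the root.\<close>

lemma tensor_norm_component:
  assumes "mi_order \<beta> = k"
  shows "norm (g \<beta> x) \<le> tensor_norm k g x"
proof -
  obtain "is" where "is": "\<And>i. count_list is i = \<beta> i" using ex_count_list[of \<beta>] by blast
  then have \<beta>: "count_list is = \<beta>" by blast
  have "length is = size (mset is)" by simp
  also have "\<dots> = (\<Sum>i\<in>set is. count_list is i)"
    unfolding size_multiset_overloaded_eq by (simp add: count_mset)
  also have "\<dots> = (\<Sum>i\<in>UNIV. count_list is i)"
    by (intro sum.mono_neutral_left) (auto simp: count_list_0_iff)
  also have "\<dots> = k" using assms by (simp add: "is" mi_order_def)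
  finally have len: "length is = k" .
  have fin: "finite {is :: 'a list. length is = k}"
    using finite_lists_length_eq[of "UNIV :: 'a set" k] by simp
  have "(norm (g \<beta> x))\<^sup>2 \<le> (\<Sum>is | length is = k. (norm (g (count_list is) x))\<^sup>2)"
    using member_le_sum[OF _ _ fin, of "is" "\<lambda>is. (norm (g (count_list is) x))\<^sup>2"] len by (simp add: \<beta>)
  then show ?thesis unfolding tensor_norm_def by (rule real_le_rsqrt)
qed


section \<open>The borderline case s = 0, q = \<infinity>\<close>

lemma M0_space_0_infinity: "M0_space 0 \<infinity> = {f :: real ^ 'n::finite \<Rightarrow> complex. AE x in lebesgue. f x = 0}"
proof (intro equalityI subsetI CollectI)
  have q: "1 \<le> (\<infinity>::ennreal)" by simp
  have neg: "-1 < (0::real)" by simp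
  note iff = M0_space_ball_bound[OF q neg, where ?'n = 'n]
  fix f :: "real ^ 'n \<Rightarrow> complex"
  {
    assume "f \<in> M0_space 0 \<infinity>"
    \<comment> \<open>Choosing \<epsilon> = 1/(m + 1), and below the radii n + 1, leaves countably
      many bounds, so one null set serves all. At a fixed point, n to infinity removes the term with
      A m, then m to infinity gives 0.\<close>
    then have "\<forall>m. \<exists>A. \<forall>R\<ge>1. ball_bound \<infinity> f R (1 / real (Suc m) * R powr 0 + A * R powr (-1))"
      unfolding iff by (metis of_nat_0_less_iff zero_less_Suc zero_less_divide_1_iff)
    then obtain A where A: "\<And>m R. 1 \<le> R \<Longrightarrow> ball_bound \<infinity> f R (1 / real (Suc m) * R powr 0 + A m * R powr (-1))"
      by metis
    have "AE x in lborel. \<forall>m n. x \<in> ball 0 (real (Suc n)) \<longrightarrow> norm (f x) \<le> 1 / real (Suc m) * real (Suc n) powr 0 + A m * real (Suc n) powr (-1)"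
      using A unfolding AE_all_countable ball_bound_def by simp
    then have "AE x in lborel. f x = 0"
    proof eventually_elim
      case (elim x)
      have "norm (f x) \<le> 1 / real (Suc m)" for m
      proof (rule LIMSEQ_le_const)
        have "(\<lambda>n. 1 / real (Suc m) + A m * (1 / real (Suc n))) \<longlonglongrightarrow> 1 / real (Suc m) + A m * 0"
          by (intro tendsto_intros LIMSEQ_Suc[OF lim_1_over_n])
        then show "(\<lambda>n. 1 / real (Suc m) + A m * (1 / real (Suc n))) \<longlonglongrightarrow> 1 / real (Suc m)" by simp
        obtain N :: nat where N: "norm x < real N" using reals_Archimedean2 by blast
        show "\<exists>N. \<forall>n\<ge>N. norm (f x) \<le> 1 / real (Suc m) + A m * (1 / real (Suc n))"
        proof (intro exI[of _ N] allI impI)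
          fix n assume "N \<le> n"
          with N have "x \<in> ball 0 (real (Suc n))" by simp
          with elim have "norm (f x) \<le> 1 / real (Suc m) * real (Suc n) powr 0 + A m * real (Suc n) powr (-1)" by blast
          then show "norm (f x) \<le> 1 / real (Suc m) + A m * (1 / real (Suc n))"
            by (simp add: powr_minus inverse_eq_divide del: of_nat_Suc)
        qed
      qed
      moreover have "(\<lambda>m. 1 / real (Suc m)) \<longlonglongrightarrow> 0" by (rule LIMSEQ_Suc[OF lim_1_over_n])
      ultimately have "norm (f x) \<le> 0" by (intro LIMSEQ_le_const) auto
      then show ?case by simp
    qed
    then show "AE x in lebesgue. f x = 0" by (simp add: AE_completion_iff)
  }
  {
    assume "f \<in> {f. AE x in lebesgue. f x = 0}"
    then have AE: "AE x in lebesgue. f x = 0" by simp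
    then have "AE x in lebesgue. 0 = f x" by eventually_elim simp
    then have "f \<in> borel_measurable lebesgue" by (rule borel_measurable_AE[rotated]) simp
    moreover have "ball_bound \<infinity> f R (\<epsilon> * R powr 0 + 0 * R powr (-1))" if "0 < \<epsilon>" for \<epsilon> R
    proof -
      have "AE x in lborel. f x = 0" using AE by (simp add: AE_completion_iff)
      then have "AE x in lborel. x \<in> ball 0 R \<longrightarrow> norm (f x) \<le> \<epsilon> * R powr 0 + 0 * R powr (-1)"
        by eventually_elim (use that in auto)
      then show ?thesis by (simp add: ball_bound_def)
    qed
    ultimately show "f \<in> M0_space 0 \<infinity>" unfolding iff by blast
  }
qed


text \<open>The derivatives of order k - 1 have first derivatives that are bounded and tend to 0, so
  they lie in the subscript-0 space of exponent 1. From there the iteration with s = 1 adds k -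
  1.\<close>

lemma vanishing_gradient_M0_space:
  fixes u :: "(real ^ 'n::finite \<Rightarrow> complex) \<Rightarrow> complex"
  assumes u: "linear_on_tests u" and M: "\<And>\<beta>. mi_order \<beta> = k \<Longrightarrow> distr_in (distr_deriv \<beta> u) (M_space 0 \<infinity>)"
    and k: "k \<ge> 1" and lim: "nabla_vanishes_at_infinity k u"
  shows "distr_in u (M0_space (real k) \<infinity>)"
proof -
  have q: "1 \<le> (\<infinity>::ennreal)" by simp
  obtain l where l: "k = Suc l" using k by (cases k) auto
  obtain g where g: "\<And>\<beta>. mi_order \<beta> = k \<Longrightarrow> represents (g \<beta>) (distr_deriv \<beta> u)" "(tensor_norm k g \<longlongrightarrow> 0) at_infinity"
    using lim by (auto simp: nabla_vanishes_at_infinity_def)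
  have "distr_in (distr_deriv \<gamma> u) (M0_space 1 \<infinity>)" if \<gamma>: "mi_order \<gamma> = l" for \<gamma>
  proof -
    let ?\<beta> = "\<lambda>i. \<gamma>(i := Suc (\<gamma> i))"
    have ord: "mi_order (?\<beta> i) = k" for i using \<gamma> l by (simp only: mi_order_Suc)
    have rep: "represents (g (?\<beta> i)) (\<lambda>\<phi>. - distr_deriv \<gamma> u (partial_deriv i \<phi>))" for i
      by (rule represents_cong[OF g(1)[OF ord[of i]] distr_deriv_Suc(2)])
    have "\<exists>E. AE x in lborel. norm (g (?\<beta> i) x) \<le> E" for i
    proof -
      obtain f where f: "f \<in> M_space 0 \<infinity>" "represents f (distr_deriv (?\<beta> i) u)"
        using M[OF ord[of i]] by (auto simp: distr_in_def)
      obtain E where E: "\<And>R. 1 \<le> R \<Longrightarrow> ball_bound \<infinity> f R (E * R powr 0)"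
        using f(1) unfolding M_space_ball_bound[OF q] by blast
      \<comment> \<open>With exponent 0 the bound E is the same on every ball, so integer radii give
        a global bound; uniqueness of representatives carries it from f to g.\<close>
      have "AE x in lborel. \<forall>n. x \<in> ball 0 (real (Suc n)) \<longrightarrow> norm (f x) \<le> E * real (Suc n) powr 0"
        using E unfolding AE_all_countable ball_bound_def by simp
      then have "AE x in lborel. norm (g (?\<beta> i) x) \<le> E"
        using represents_unique[OF f(2) g(1)[OF ord[of i]]]
      proof eventually_elim
        case (elim x)
        obtain n :: nat where "norm x < real n" using reals_Archimedean2 by blast
        then have "x \<in> ball 0 (real (Suc n))" by simp
        with elim(1) have "norm (f x) \<le> E * real (Suc n) powr 0" by blast
        with elim(2) show ?case by simp
      qed
      then show ?thesis by blast
    qed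
    then obtain e where e: "\<And>i. AE x in lborel. norm (g (?\<beta> i) x) \<le> e i" by metis
    have bnd: "AE x in lborel. norm (g (?\<beta> i) x) \<le> (\<Sum>i\<in>UNIV. \<bar>e i\<bar>)" for i
      using e[of i] member_le_sum[of i UNIV "\<lambda>i. \<bar>e i\<bar>"] by (auto elim!: eventually_mono)
    have lim0: "(g (?\<beta> i) \<longlongrightarrow> 0) at_infinity" for i
      by (rule Lim_null_comparison[OF always_eventually g(2)]) (intro allI tensor_norm_component ord)
    show ?thesis
      by (rule primitive_vanishing[OF distr_deriv_linear[OF u] rep lim0 bnd])
  qed
  then have "distr_in u (M0_space (1 + real l) \<infinity>)"
    by (intro iterate_primitive[where X = "\<lambda>s. M0_space s \<infinity>" and s = 1] primitive_M0_space u q) auto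
  then show ?thesis by (simp add: l)
qed

text \<open>For k = 0 the limit condition concerns the function itself; a bounded function of
  compact support satisfies it without vanishing almost everywhere.\<close>

lemma ball_indicator_counterexample:
  defines "f \<equiv> \<lambda>x :: real ^ 'n::finite. complex_of_real (indicator (ball 0 1) x)"
  defines "u \<equiv> \<lambda>\<phi>. integral\<^sup>L lebesgue (\<lambda>x. f x * \<phi> x)"
  shows "distribution u" "represents f u" "f \<in> M_space 0 \<infinity>" "\<not> distr_in u (M0_space 0 \<infinity>)"
proof -
  have q: "1 \<le> (\<infinity>::ennreal)" by simp
  have f [measurable]: "f \<in> borel_measurable borel" unfolding f_def by measurable
  show fM: "f \<in> M_space 0 \<infinity>"
    unfolding M_space_ball_bound[OF q] ball_bound_def
    using borel_measurable_lebesgue[OF f] by (intro conjI exI[of _ 1]) (auto simp: f_def indicator_def)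
  have "f \<in> Lq_loc 1"
  proof (rule Lq_locI[OF borel_measurable_lebesgue[OF f] _ q])
    have "ball_bound \<infinity> f R 1" for R by (auto simp: ball_bound_def f_def indicator_def)
    then show "\<exists>b. ball_bound \<infinity> f R b" for R by blast
  qed simp
  then show rep: "represents f u" by (simp add: represents_def u_def)
  have loc: "locally_integrable f"
    by (rule Lq_loc_1_representative(1)[OF \<open>f \<in> Lq_loc 1\<close> f]) simp
  have u: "u \<phi> = (\<integral>x. f x * \<phi> x \<partial>lborel)" if "\<phi> \<in> test_functions" for \<phi>
    unfolding u_def by (rule Lq_loc_1_representative(2)[OF \<open>f \<in> Lq_loc 1\<close> f _ that]) simp
  show "\<not> distr_in u (M0_space 0 \<infinity>)"
  proof
    assume "distr_in u (M0_space 0 \<infinity>)"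
    then obtain h where h: "AE x in lebesgue. h x = 0" "represents h u"
      unfolding M0_space_0_infinity distr_in_def by blast
    \<comment> \<open>The mollifier is supported where f = 1, so u w is its integral 1, while a
      representative vanishing almost everywhere would give 0.\<close>
    obtain w :: "real ^ 'n \<Rightarrow> complex" where w: "w \<in> test_functions" "\<And>x. 1 \<le> norm x \<Longrightarrow> w x = 0" "(\<integral>x. w x \<partial>lborel) = 1"
      using ex_complex_mollifier by blast
    have "u w = integral\<^sup>L lebesgue (\<lambda>x. h x * w x)" using h(2) w(1) by (simp add: represents_def)
    also have "\<dots> = 0"
      by (rule integral_eq_zero_AE) (use h(1) in eventually_elim, simp)
    finally have "(\<integral>x. f x * w x \<partial>lborel) = 0" using u[OF w(1)] by simp
    also have "(\<lambda>x. f x * w x) = w"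
      using w(2) by (force simp: f_def indicator_def)
    finally show False using w(3) by simp
  qed
  show "distribution u"
    unfolding distribution_def
  proof (intro conjI ballI allI impI)
    fix \<phi> \<psi> :: "real ^ 'n \<Rightarrow> complex" assume t: "\<phi> \<in> test_functions" "\<psi> \<in> test_functions"
    show "u (\<lambda>x. \<phi> x + \<psi> x) = u \<phi> + u \<psi>"
      using integrable_mult_test[OF loc t(1)] integrable_mult_test[OF loc t(2)]
      by (simp add: u t test_add distrib_left)
  next
    fix c and \<phi> :: "real ^ 'n \<Rightarrow> complex" assume t: "\<phi> \<in> test_functions"
    have "(\<integral>x. f x * (c * \<phi> x) \<partial>lborel) = (\<integral>x. c * (f x * \<phi> x) \<partial>lborel)" by (simp add: mult_ac)
    then show "u (\<lambda>x. c * \<phi> x) = c * u \<phi>" by (simp add: u t test_cmult)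
  next
    fix K :: "(real ^ 'n) set"
    \<comment> \<open>u has order 0: the volume of the unit ball is a constant that serves every K
      with m = 0.\<close>
    let ?C = "measure lborel (ball (0 :: real ^ 'n) 1)"
    have "norm (u \<phi>) \<le> ?C * (\<Sum>\<alpha> | mi_order \<alpha> \<le> 0. SUP x. norm (mi_deriv \<alpha> \<phi> x))" if t: "\<phi> \<in> test_functions" for \<phi>
    proof -
      have \<alpha>: "{\<alpha> :: 'n \<Rightarrow> nat. mi_order \<alpha> \<le> 0} = {\<lambda>_. 0}" by (auto simp: mi_order_def)
      have 0: "mi_deriv (\<lambda>_. 0) \<phi> = \<phi>" by (rule mi_deriv_order_0[OF _ t]) (simp add: mi_order_def)
      let ?S = "SUP x. norm (\<phi> x)"
      obtain B where B: "\<And>x. norm (\<phi> x) \<le> B" using test_bounded[OF t] by blast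
      have S: "norm (\<phi> x) \<le> ?S" for x
        using B by (intro cSUP_upper bdd_aboveI2[where M = B]) auto
      have "norm (u \<phi>) \<le> (\<integral>x. norm (f x * \<phi> x) \<partial>lborel)" unfolding u[OF t] by (rule integral_norm_bound)
      also have "\<dots> \<le> (\<integral>x. ?S * indicator (ball (0 :: real ^ 'n) 1) x \<partial>lborel)"
      proof (rule Bochner_Integration.integral_mono)
        show "integrable lborel (\<lambda>x. norm (f x * \<phi> x))" using integrable_mult_test[OF loc t] by simp
        show "integrable lborel (\<lambda>x :: real ^ 'n. ?S * indicator (ball 0 1) x)"
          by (intro integrable_mult_right integrable_real_indicator emeasure_bounded_finite) auto
        show "norm (f x * \<phi> x) \<le> ?S * indicator (ball 0 1) x" for x
          using S[of x] by (auto simp: f_def indicator_def norm_mult)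
      qed
      also have "\<dots> = ?C * ?S" by simp
      finally show ?thesis unfolding \<alpha> by (simp add: 0)
    qed
    then show "\<exists>C m. \<forall>\<phi>\<in>test_functions. closure {x. \<phi> x \<noteq> 0} \<subseteq> K \<longrightarrow>
      norm (u \<phi>) \<le> C * (\<Sum>\<alpha> | mi_order \<alpha> \<le> m. SUP x. norm (mi_deriv \<alpha> \<phi> x))"
      by blast
  qed
qed

theorem theorem3p2:
  fixes k :: nat and s :: real and q :: ennreal
  assumes "s > -1" and "1 \<le> q"
  shows
    "(\<forall>u :: (real ^ 'n::finite \<Rightarrow> complex) \<Rightarrow> complex.
        distribution u \<longrightarrow>
        (\<forall>\<beta>. mi_order \<beta> = k \<longrightarrow> distr_in (distr_deriv \<beta> u) (M_space s q)) \<longrightarrow>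
        distr_in u (M_space (s + real k) q)) \<and>
     (\<forall>u :: (real ^ 'n \<Rightarrow> complex) \<Rightarrow> complex.
        distribution u \<longrightarrow>
        (\<forall>\<beta>. mi_order \<beta> = k \<longrightarrow> distr_in (distr_deriv \<beta> u) (M0_space s q)) \<longrightarrow>
        distr_in u (M0_space (s + real k) q)) \<and>
     (\<forall>u :: (real ^ 'n \<Rightarrow> complex) \<Rightarrow> complex.
        distribution u \<longrightarrow>
        (\<forall>\<beta>. mi_order \<beta> = k \<longrightarrow> distr_in (distr_deriv \<beta> u) (M_space s q)) \<longrightarrow>
        k \<ge> 1 \<longrightarrow> s = 0 \<longrightarrow> q = \<infinity> \<longrightarrow>
        nabla_vanishes_at_infinity k u \<longrightarrow>
        distr_in u (M0_space (real k) \<infinity>)) \<and>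
     M0_space 0 \<infinity> = {f :: real ^ 'n \<Rightarrow> complex. AE x in lebesgue. f x = 0} \<and>
     (\<exists>u :: (real ^ 'n \<Rightarrow> complex) \<Rightarrow> complex.
        distribution u \<and>
        (\<forall>\<beta>. mi_order \<beta> = 0 \<longrightarrow> distr_in (distr_deriv \<beta> u) (M_space 0 \<infinity>)) \<and>
        nabla_vanishes_at_infinity 0 u \<and>
        \<not> distr_in u (M0_space 0 \<infinity>))"
proof (intro conjI allI impI)
  fix u :: "(real ^ 'n \<Rightarrow> complex) \<Rightarrow> complex"
  assume u: "distribution u" and M: "\<forall>\<beta>. mi_order \<beta> = k \<longrightarrow> distr_in (distr_deriv \<beta> u) (M_space s q)"
  show "distr_in u (M_space (s + real k) q)"
    by (rule iterate_primitive[where X = "\<lambda>s. M_space s q"])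
       (use M in \<open>auto intro: primitive_M_space distribution_linear u assms\<close>)
next
  fix u :: "(real ^ 'n \<Rightarrow> complex) \<Rightarrow> complex"
  assume u: "distribution u" and M: "\<forall>\<beta>. mi_order \<beta> = k \<longrightarrow> distr_in (distr_deriv \<beta> u) (M0_space s q)"
  show "distr_in u (M0_space (s + real k) q)"
    by (rule iterate_primitive[where X = "\<lambda>s. M0_space s q"])
       (use M in \<open>auto intro: primitive_M0_space distribution_linear u assms\<close>)
next
  fix u :: "(real ^ 'n \<Rightarrow> complex) \<Rightarrow> complex"
  assume "distribution u" "\<forall>\<beta>. mi_order \<beta> = k \<longrightarrow> distr_in (distr_deriv \<beta> u) (M_space s q)"
    "k \<ge> 1" "s = 0" "q = \<infinity>" "nabla_vanishes_at_infinity k u"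
  then show "distr_in u (M0_space (real k) \<infinity>)"
    by (intro vanishing_gradient_M0_space distribution_linear) auto
next
  show "M0_space 0 \<infinity> = {f :: real ^ 'n \<Rightarrow> complex. AE x in lebesgue. f x = 0}"
    by (rule M0_space_0_infinity)
next
  let ?f = "\<lambda>x :: real ^ 'n. complex_of_real (indicator (ball 0 1) x)"
  let ?u = "\<lambda>\<phi>. integral\<^sup>L lebesgue (\<lambda>x. ?f x * \<phi> x)"
  note ex = ball_indicator_counterexample[where 'n = 'n]
  have rep: "represents ?f (distr_deriv \<beta> ?u)" if "mi_order \<beta> = 0" for \<beta>
    by (rule represents_cong[OF ex(2)]) (simp only: distr_deriv_order_0[OF that])
  \<comment> \<open>A tensor of order 0 has one component, indexed by the empty list, so its norm is
    that of the function.\<close>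
  have "tensor_norm 0 (\<lambda>_. ?f) = (\<lambda>x. norm (?f x))"
    by (rule ext) (simp add: tensor_norm_def)
  moreover have "((\<lambda>x. norm (?f x)) \<longlongrightarrow> 0) at_infinity"
    by (rule tendsto_eventually) (auto simp: eventually_at_infinity indicator_def intro!: exI[of _ 1])
  ultimately have "nabla_vanishes_at_infinity 0 ?u"
    unfolding nabla_vanishes_at_infinity_def using rep by (intro exI[of _ "\<lambda>_. ?f"]) simp
  moreover have "\<forall>\<beta>. mi_order \<beta> = 0 \<longrightarrow> distr_in (distr_deriv \<beta> ?u) (M_space 0 \<infinity>)"
    using rep ex(3) unfolding distr_in_def by blast
  ultimately show "\<exists>u :: (real ^ 'n \<Rightarrow> complex) \<Rightarrow> complex. distribution u \<and>
        (\<forall>\<beta>. mi_order \<beta> = 0 \<longrightarrow> distr_in (distr_deriv \<beta> u) (M_space 0 \<infinity>)) \<and>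
        nabla_vanishes_at_infinity 0 u \<and> \<not> distr_in u (M0_space 0 \<infinity>)"
    using ex(1,4) by blast
qed

end
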